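(* There are exactly twelve $\overline{\mathbb{Q}}$-conjugacy classes of quadratic (degree $2$) post-critically finite rational maps defined over $\mathbb{Q}$. More precisely, every degree-$2$ post-critically finite map $\phi(z)\in\mathbb{Q}(z)$ is conjugate by some $f\in \mathrm{PGL}_2(\overline{\mathbb{Q}})$ to exactly one of the following maps, each of which is post-critically finite, and no two of which are conjugate over $\overline{\mathbb{Q}}$: (1) $z^2$, (2) $\dfrac{1}{z^2}$, (3) $z^2-2$, (4) $z^2-1$, (5) $\dfrac{1}{2(z-1)^2}$, (6) $\dfrac{1}{(z-1)^2}$, (7) $\dfrac{-1}{4z^2-4z}$, (8) $\dfrac{-4}{9z^2-12z}$, (9) $\dfrac{2}{(z-1)^2}$, (10) $\dfrac{2z+1}{4z-2z^2}$, (11) $\dfrac{-2z}{2z^2-4z+1}$, (12) $\dfrac{3z^2-4z+1}{1-4z}$.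
   Context: A rational map $\phi:\mathbb{P}^1\to\mathbb{P}^1$ of degree $d\ge 2$ is post-critically finite (PCF) if the forward orbit $\{\phi^n(\gamma): n\ge 0\}$ of each critical point $\gamma$ of $\phi$ (points where $\phi$ is ramified) is finite. For $f\in\mathrm{PGL}_2$, the conjugate of $\phi$ by $f$ is $\phi^f=f\circ\phi\circ f^{-1}$; two maps are conjugate over a field $K$ if they are related in this way with $f\in\mathrm{PGL}_2(K)$. *)

theory Defs
  imports Complex_Main "HOL-Computational_Algebra.Polynomial"
begin

text \<open>The points \<open>K \<union> {\<infinity>}\<close> of the projective line over a field: \<open>Fin z\<close> is \<open>[z : 1]\<close> and
  \<open>Infty\<close> is \<open>[1 : 0]\<close>.\<close>

datatype 'a P1 = Fin 'a | Infty

fun hcoords :: "'a::field P1 \<Rightarrow> 'a \<times> 'a" where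
  "hcoords (Fin z) = (z, 1)"
| "hcoords Infty = (1, 0)"

text \<open>The point \<open>[x : y]\<close>; meaningful only for \<open>(x, y) \<noteq> (0, 0)\<close>.\<close>

definition proj :: "'a::field \<Rightarrow> 'a \<Rightarrow> 'a P1" where
  "proj x y = (if y = 0 then Infty else Fin (x / y))"

text \<open>The self-map of the projective line induced by \<open>p / q\<close> for coprime \<open>p\<close> and \<open>q\<close>.  The value at
  infinity is that of the homogenisations of \<open>p\<close> and \<open>q\<close> to degree
  \<open>max (degree p) (degree q)\<close>.\<close>

fun ratmap :: "'a::field poly \<Rightarrow> 'a poly \<Rightarrow> 'a P1 \<Rightarrow> 'a P1" where
  "ratmap p q (Fin z) = proj (poly p z) (poly q z)"
| "ratmap p q Infty =
    (let d = max (degree p) (degree q) in proj (coeff p d) (coeff q d))"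

text \<open>\<open>rational_map K d \<phi>\<close>: \<open>\<phi>\<close> is a rational map of degree \<open>d\<close> defined over the subfield \<open>K\<close>.
  Over an infinite field a rational map is determined by the function it induces on points,
  and \<open>p\<close>, \<open>q\<close> are then unique up to a common scalar.\<close>

definition rational_map :: "'a::field set \<Rightarrow> nat \<Rightarrow> ('a P1 \<Rightarrow> 'a P1) \<Rightarrow> bool" where
  "rational_map K d \<phi> \<longleftrightarrow>
    (\<exists>p q. coprime p q \<and> (\<forall>i. coeff p i \<in> K) \<and> (\<forall>i. coeff q i \<in> K) \<and>
           max (degree p) (degree q) = d \<and> \<phi> = ratmap p q)"

text \<open>The ramification index of a nonconstant \<open>p / q\<close> at a point \<open>P\<close> with image \<open>[a : b]\<close>: the
  multiplicity of \<open>P\<close> as a zero of the form \<open>b p - a q\<close>, homogenised to the degree of the map,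
  that is, as a solution of \<open>\<phi>(X) = \<phi>(P)\<close>.\<close>

definition ram_index :: "'a::field poly \<Rightarrow> 'a poly \<Rightarrow> 'a P1 \<Rightarrow> nat" where
  "ram_index p q P =
    (let (a, b) = hcoords (ratmap p q P); g = smult b p - smult a q in
       case P of Fin z \<Rightarrow> order z g
               | Infty \<Rightarrow> max (degree p) (degree q) - degree g)"

definition critical_point :: "('a::field P1 \<Rightarrow> 'a P1) \<Rightarrow> 'a P1 \<Rightarrow> bool" where
  "critical_point \<phi> P \<longleftrightarrow>
    (\<exists>p q. coprime p q \<and> \<phi> = ratmap p q \<and> ram_index p q P \<ge> 2)"

text \<open>Meant for rational maps of degree at least 2 over an algebraically closed field, where
  all critical points are visible.\<close>

definition PCF :: "('a::field P1 \<Rightarrow> 'a P1) \<Rightarrow> bool" where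
  "PCF \<phi> \<longleftrightarrow> (\<forall>P. critical_point \<phi> P \<longrightarrow> finite {(\<phi> ^^ n) P | n. True})"

definition moebius :: "'a::field \<Rightarrow> 'a \<Rightarrow> 'a \<Rightarrow> 'a \<Rightarrow> 'a P1 \<Rightarrow> 'a P1" where
  "moebius a b c d P = (let (x, y) = hcoords P in proj (a * x + b * y) (c * x + d * y))"

text \<open>\<open>PGL\<^sub>2(K)\<close> for a subfield \<open>K\<close>, through its faithful action on the projective line.\<close>

definition PGL2 :: "'a::field set \<Rightarrow> ('a P1 \<Rightarrow> 'a P1) set" where
  "PGL2 K = {moebius a b c d | a b c d.
     a \<in> K \<and> b \<in> K \<and> c \<in> K \<and> d \<in> K \<and> a * d - b * c \<noteq> 0}"

definition conj_by :: "('a P1 \<Rightarrow> 'a P1) \<Rightarrow> ('a P1 \<Rightarrow> 'a P1) \<Rightarrow> 'a P1 \<Rightarrow> 'a P1" where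
  "conj_by f \<phi> = f \<circ> \<phi> \<circ> inv f"

definition conjugate_over :: "'a::field set \<Rightarrow> ('a P1 \<Rightarrow> 'a P1) \<Rightarrow> ('a P1 \<Rightarrow> 'a P1) \<Rightarrow> bool" where
  "conjugate_over K \<phi> \<psi> \<longleftrightarrow> (\<exists>f \<in> PGL2 K. \<psi> = conj_by f \<phi>)"

text \<open>The algebraic closure of the rationals inside the complex numbers.\<close>

definition Qbar :: "complex set" where
  "Qbar = {x. algebraic x}"

definition quadratic_PCF_over_Q :: "(complex P1 \<Rightarrow> complex P1) set" where
  "quadratic_PCF_over_Q = {\<phi>. rational_map \<rat> 2 \<phi> \<and> PCF \<phi>}"

definition Qbar_conj_rel :: "((complex P1 \<Rightarrow> complex P1) \<times> (complex P1 \<Rightarrow> complex P1)) set" where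
  "Qbar_conj_rel = {(\<phi>, \<psi>). \<phi> \<in> quadratic_PCF_over_Q \<and> \<psi> \<in> quadratic_PCF_over_Q \<and>
                            conjugate_over Qbar \<phi> \<psi>}"

text \<open>Coefficient lists \<open>[:c0, c1, \<dots>:]\<close> are in ascending order, so \<open>[:-1, 1:]\<close> is \<open>z - 1\<close>.\<close>

definition census :: "(complex P1 \<Rightarrow> complex P1) list" where
  "census =
    [ratmap [:0, 0, 1:] 1,
     ratmap 1 [:0, 0, 1:],
     ratmap [:-2, 0, 1:] 1,
     ratmap [:-1, 0, 1:] 1,
     ratmap 1 (smult 2 ([:-1, 1:] ^ 2)),
     ratmap 1 ([:-1, 1:] ^ 2),
     ratmap [:-1:] [:0, -4, 4:],
     ratmap [:-4:] [:0, -12, 9:],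
     ratmap [:2:] ([:-1, 1:] ^ 2),
     ratmap [:1, 2:] [:0, 4, -2:],
     ratmap [:0, -2:] [:1, -4, 2:],
     ratmap [:1, -4, 3:] [:1, -4:]]"

end

theory Submission
  imports "HOL-Complex_Analysis.Complex_Analysis" "HOL-Computational_Algebra.Fundamental_Theorem_Algebra" Defs
begin

text \<open>A quadratic map with a fixed point of multiplier \<open>1 / \<mu> \<noteq> 0\<close> is conjugate to
  \<open>z \<mapsto> \<mu> (z + 1/z + \<beta>)\<close>, whose critical points are \<open>1\<close> and \<open>-1\<close>; its conjugacy class is determined by the
  elementary symmetric functions of the three multipliers, which are rational for a map over the
  rationals.  If a multiplier vanishes, the map is conjugate to a polynomial \<open>z\<^sup>2 + c\<close>, and \<open>c\<close> is one
  of \<open>0\<close>, \<open>-1\<close>, \<open>-2\<close>.  Otherwise finiteness of the critical orbits bounds every \<open>\<mu>\<close> at all places: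
  \<open>4 \<mu>\<close> lies in each valuation ring above a prime, for else a critical orbit escapes to infinity, and
  \<open>|\<mu>| \<le> 1\<close>, for else infinity attracts a critical orbit.  Hence the numbers \<open>4 \<mu>\<close> are the roots of one
  of 256 monic integral cubics.  Nine of these belong to the census.  For each of the others there is
  a prime modulo which a critical point becomes periodic and a second prime that shows that it is not
  periodic; then its orbit is infinite.  The twelve maps are told apart by the preperiods and periods
  of their critical points.\<close>

subsection \<open>Algebraic numbers\<close>

text \<open>The multipliers of the fixed points are in general irrational, and so is the normal form
  attached to each of them. Two devices keep number fields out: a place is a valuation ring of the
  whole of C, and only the symmetric functions of the multipliers \<kappa> have to be rational. The
  fixed point formula makes their sum equal to 2 plus their product \<open>s3\<close>. So, for
  nonzero \<open>s3\<close>, two integers suffice: with \<open>h = 32 / s3\<close>, the three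
  numbers 4 / \<kappa> have sum \<open>m\<close>, second symmetric function 16 + h and product 2 h.
  The factor 4 comes from the two critical values \<mu> (\<beta> + 2) and \<mu> (\<beta> - 2), which
  differ by 4 \<mu>. A place selects one multiplier and the sign of \<beta> by congruences, hence
  the two primes of a certificate may speak of different normal forms of the same map; conjugacy
  carries periodicity of a critical point from one to the other. Residual periodicity can be lifted
  because the derivative vanishes at a critical point: the return map contracts quadratically
  there.\<close>

interpretation rat_vs: vector_space "\<lambda>(q::rat) (x::complex). of_rat q * x"
  by unfold_locales (simp_all add: algebra_simps of_rat_add of_rat_mult)

text \<open>More than \<open>card B\<close> powers in a space of dimension at most
  \<open>card B\<close> satisfy a linear relation, which is a polynomial equation for
  \<open>x\<close>.\<close>

lemma algebraic_if_powers_in_span: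
  fixes x :: complex
  assumes "finite B" and span: "\<And>n. x ^ n \<in> rat_vs.span B"
  shows "algebraic x"
proof (cases "inj_on (\<lambda>n. x ^ n) {..card B}")
  case True
  define S where "S = (\<lambda>n. x ^ n) ` {..card B}"
  have "card S = Suc (card B)"
    using True by (simp add: S_def card_image)
  then have "rat_vs.dependent S"
    using rat_vs.independent_span_bound[OF \<open>finite B\<close>, of S] span by (auto simp: S_def)
  moreover have "finite S" by (simp add: S_def)
  ultimately obtain u where u: "(\<Sum>v\<in>S. of_rat (u v) * v) = 0" and "\<exists>v\<in>S. u v \<noteq> 0"
    by (auto simp: rat_vs.dependent_finite)
  then obtain m where m: "m \<le> card B" "u (x ^ m) \<noteq> 0" by (auto simp: S_def)
  define p :: "complex poly" where "p = (\<Sum>n\<le>card B. monom (of_rat (u (x ^ n))) n)"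
  have c: "coeff p i = (if i \<le> card B then of_rat (u (x ^ i)) else 0)" for i
    by (simp add: p_def coeff_sum coeff_monom)
  have "poly p x = (\<Sum>n\<le>card B. of_rat (u (x ^ n)) * x ^ n)"
    by (simp add: p_def poly_sum poly_monom)
  also have "\<dots> = 0"
    using u True by (simp add: S_def sum.reindex)
  finally have "poly p x = 0" .
  moreover have "p \<noteq> 0" using m c[of m] by auto
  moreover have "\<forall>i. coeff p i \<in> \<rat>" by (simp add: c)
  ultimately show ?thesis by (auto simp: algebraic_altdef)
next
  \<comment> \<open>Linear dependence concerns the set of powers and does not see a repeated power;
    a repetition is itself a polynomial equation.\<close>
  case False
  then obtain i j where ij: "i \<noteq> j" "x ^ i = x ^ j" by (auto simp: inj_on_def)
  define p :: "complex poly" where "p = monom 1 i - monom 1 j"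
  have "poly p x = 0" using ij by (simp add: p_def poly_monom)
  moreover have "coeff p i \<noteq> 0" using ij by (simp add: p_def)
  then have "p \<noteq> 0" by auto
  moreover have "\<forall>i. coeff p i \<in> \<rat>" by (simp add: p_def)
  ultimately show ?thesis by (auto simp: algebraic_altdef)
qed

text \<open>A polynomial of degree \<open>n\<close> expresses \<open>x ^ n\<close> by lower powers,
  and multiplication by \<open>x ^ (k - n)\<close> carries this over to all higher ones.\<close>

lemma algebraic_powers_in_span:
  fixes x :: complex
  assumes "algebraic x"
  obtains n where "\<And>k. x ^ k \<in> rat_vs.span ((\<lambda>i. x ^ i) ` {..<n})"
proof -
  obtain p where p: "\<And>i. coeff p i \<in> \<rat>" "p \<noteq> 0" "poly p x = 0"
    using assms by (auto simp: algebraic_altdef)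
  define n where "n = degree p"
  have "coeff p n \<noteq> 0" using p by (simp add: n_def)
  have "x ^ k \<in> rat_vs.span ((\<lambda>i. x ^ i) ` {..<n})" for k
  proof (induction k rule: less_induct)
    case (less k)
    show ?case
    proof (cases "k < n")
      case True
      then show ?thesis by (intro rat_vs.span_base) auto
    next
      case False
      have "(\<Sum>i<n. coeff p i * x ^ i) + coeff p n * x ^ n = 0"
        using p(3) by (simp add: poly_altdef n_def lessThan_Suc_atMost[symmetric])
      then have "x ^ n = - (\<Sum>i<n. coeff p i * x ^ i) / coeff p n"
        using \<open>coeff p n \<noteq> 0\<close> by (simp add: field_simps add_eq_0_iff)
      then have "x ^ n = (\<Sum>i<n. - (coeff p i / coeff p n) * x ^ i)"
        by (simp add: sum_divide_distrib sum_negf)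
      then have "x ^ (k - n) * x ^ n = (\<Sum>i<n. - (coeff p i / coeff p n) * x ^ (k - n + i))"
        by (simp add: sum_distrib_left power_add algebra_simps)
      then have *: "x ^ k = (\<Sum>i<n. - (coeff p i / coeff p n) * x ^ (k - n + i))"
        using False by (simp flip: power_add)
      have "- (coeff p i / coeff p n) * x ^ (k - n + i) \<in> rat_vs.span ((\<lambda>i. x ^ i) ` {..<n})"
        if i: "i < n" for i
      proof -
        have "- (coeff p i / coeff p n) \<in> \<rat>" using p(1) by (intro Rats_minus_iff[THEN iffD2] Rats_divide)
        then obtain q where "- (coeff p i / coeff p n) = of_rat q" by (rule Rats_cases)
        then show ?thesis using less[of "k - n + i"] i False rat_vs.span_scale by auto
      qed
      then show ?thesis unfolding * by (intro rat_vs.span_sum) auto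
    qed
  qed
  then show ?thesis using that by blast
qed

lemma span_mult_span:
  fixes A B :: "complex set"
  assumes "x \<in> rat_vs.span A" "y \<in> rat_vs.span B"
  shows "x * y \<in> rat_vs.span ((\<lambda>(a, b). a * b) ` (A \<times> B))"
proof -
  let ?C = "(\<lambda>(a, b). a * b) ` (A \<times> B)"
  have 1: "a * y \<in> rat_vs.span ?C" if "a \<in> A" for a
    using assms(2)
  proof (induction rule: rat_vs.span_induct_alt)
    case (step c b z)
    have "a * b \<in> rat_vs.span ?C" using that step by (intro rat_vs.span_base) auto
    then have "of_rat c * (a * b) + a * z \<in> rat_vs.span ?C"
      using step by (intro rat_vs.span_add rat_vs.span_scale)
    then show ?case by (simp add: algebra_simps)
  qed (simp add: rat_vs.span_zero)
  show ?thesis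
    using assms(1)
  proof (induction rule: rat_vs.span_induct_alt)
    case (step c a z)
    then have "of_rat c * (a * y) + z * y \<in> rat_vs.span ?C"
      using 1 by (intro rat_vs.span_add rat_vs.span_scale) auto
    then show ?case by (simp add: algebra_simps)
  qed (simp add: rat_vs.span_zero)
qed

text \<open>All powers of \<open>x + y\<close> and \<open>x * y\<close> stay in the
  finite-dimensional span of the products \<open>x ^ i * y ^ j\<close> with bounded
  exponents.\<close>

lemma algebraic_add_mult:
  fixes x y :: complex
  assumes "algebraic x" "algebraic y"
  shows "algebraic (x + y)" "algebraic (x * y)"
proof -
  obtain m where m: "\<And>k. x ^ k \<in> rat_vs.span ((\<lambda>i. x ^ i) ` {..<m})"
    using algebraic_powers_in_span[OF assms(1)] by blast
  obtain n where n: "\<And>k. y ^ k \<in> rat_vs.span ((\<lambda>i. y ^ i) ` {..<n})"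
    using algebraic_powers_in_span[OF assms(2)] by blast
  let ?C = "(\<lambda>(a, b). a * b) ` ((\<lambda>i. x ^ i) ` {..<m} \<times> (\<lambda>i. y ^ i) ` {..<n})"
  have xy: "x ^ i * y ^ j \<in> rat_vs.span ?C" for i j
    using span_mult_span[OF m n] .
  have "(x + y) ^ k \<in> rat_vs.span ?C" for k
  proof -
    have "(x + y) ^ k = (\<Sum>i\<le>k. of_rat (of_nat (k choose i)) * (x ^ i * y ^ (k - i)))"
      by (simp add: binomial_ring algebra_simps)
    also have "\<dots> \<in> rat_vs.span ?C"
      by (intro rat_vs.span_sum rat_vs.span_scale xy)
    finally show ?thesis .
  qed
  then show "algebraic (x + y)" by (rule algebraic_if_powers_in_span[rotated]) auto
  have "(x * y) ^ k \<in> rat_vs.span ?C" for k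
    using xy[of k k] by (simp add: power_mult_distrib)
  then show "algebraic (x * y)" by (rule algebraic_if_powers_in_span[rotated]) auto
qed

lemma Qbar_closed:
  shows Qbar_add: "x \<in> Qbar \<Longrightarrow> y \<in> Qbar \<Longrightarrow> x + y \<in> Qbar"
    and Qbar_mult: "x \<in> Qbar \<Longrightarrow> y \<in> Qbar \<Longrightarrow> x * y \<in> Qbar"
    and Qbar_uminus: "x \<in> Qbar \<Longrightarrow> - x \<in> Qbar"
    and Qbar_diff: "x \<in> Qbar \<Longrightarrow> y \<in> Qbar \<Longrightarrow> x - y \<in> Qbar"
    and Qbar_divide: "x \<in> Qbar \<Longrightarrow> y \<in> Qbar \<Longrightarrow> x / y \<in> Qbar"
    and Qbar_power: "x \<in> Qbar \<Longrightarrow> x ^ n \<in> Qbar"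
    and Qbar_csqrt: "x \<in> Qbar \<Longrightarrow> csqrt x \<in> Qbar"
    and Qbar_Rats: "x \<in> \<rat> \<Longrightarrow> x \<in> Qbar"
proof -
  show "x + y \<in> Qbar" if "x \<in> Qbar" "y \<in> Qbar" for x y
    using that by (auto simp: Qbar_def algebraic_add_mult)
  show *: "x * y \<in> Qbar" if "x \<in> Qbar" "y \<in> Qbar" for x y
    using that by (auto simp: Qbar_def algebraic_add_mult)
  show "- x \<in> Qbar" if "x \<in> Qbar" for x
    using that by (auto simp: Qbar_def)
  show "x - y \<in> Qbar" if "x \<in> Qbar" "y \<in> Qbar"
    using that algebraic_add_mult(1)[of x "- y"] by (auto simp: Qbar_def)
  show "x / y \<in> Qbar" if "x \<in> Qbar" "y \<in> Qbar"
    using that *[of x "inverse y"] by (auto simp: Qbar_def divide_inverse)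
  show "x ^ n \<in> Qbar" if "x \<in> Qbar"
    using that * by (induction n) (auto simp: Qbar_def rat_imp_algebraic)
  show "csqrt x \<in> Qbar" if "x \<in> Qbar" using that by (auto simp: Qbar_def)
  show "x \<in> Qbar" if "x \<in> \<rat>" using that by (auto simp: Qbar_def rat_imp_algebraic)
qed

lemma Qbar_0 [simp]: "0 \<in> Qbar" and Qbar_1 [simp]: "1 \<in> Qbar"
  by (simp_all add: Qbar_Rats)

lemmas Qbar_intros = Qbar_add Qbar_mult Qbar_uminus Qbar_diff Qbar_divide Qbar_power Qbar_csqrt Qbar_0 Qbar_1

subsection \<open>Quadratic maps in homogeneous coordinates\<close>

text \<open>With both forms homogeneous of degree 2, one formula serves at infinity as well, without
  regard to the actual degrees.\<close>

definition quad :: "'a::field \<Rightarrow> 'a \<Rightarrow> 'a \<Rightarrow> 'a \<Rightarrow> 'a \<Rightarrow> 'a \<Rightarrow> 'a P1 \<Rightarrow> 'a P1" where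
  "quad a b c d e f P =
    (let (x, y) = hcoords P in proj (a * x^2 + b * x * y + c * y^2) (d * x^2 + e * x * y + f * y^2))"

text \<open>The resultant of the two binary forms, written in the 2 by 2 minors of the coefficients.
  It is also a quarter of the discriminant of the form whose zeros are the critical points.\<close>

definition quad_res :: "'a::field \<Rightarrow> 'a \<Rightarrow> 'a \<Rightarrow> 'a \<Rightarrow> 'a \<Rightarrow> 'a \<Rightarrow> 'a" where
  "quad_res a b c d e f = (a * f - c * d)^2 - (a * e - b * d) * (b * f - c * e)"

lemma P1_cases_proj:
  obtains x y where "(x, y) \<noteq> (0, 0)" "P = proj x y"
proof (cases P)
  case (Fin z)
  then show ?thesis using that[of z 1] by (simp add: proj_def)
next
  case Infty
  then show ?thesis using that[of 1 0] by (simp add: proj_def)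
qed

lemma proj_eq_iff:
  "(x, y) \<noteq> (0, 0) \<Longrightarrow> (u, v) \<noteq> (0, 0) \<Longrightarrow> proj x y = proj u v \<longleftrightarrow> x * v = u * y"
  by (auto simp: proj_def field_simps)

lemma proj_scale: "k \<noteq> 0 \<Longrightarrow> proj (k * x) (k * y) = proj x y"
  by (auto simp: proj_def)

lemma moebius_proj:
  assumes "(x, y) \<noteq> (0, 0)"
  shows "moebius a b c d (proj x y) = proj (a * x + b * y) (c * x + d * y)"
proof (cases "y = 0")
  case True
  then show ?thesis using assms proj_scale[of x a c] by (simp add: moebius_def proj_def mult.commute)
next
  case False
  have "proj (a * (x / y) + b) (c * (x / y) + d) = proj (y * (a * (x / y) + b)) (y * (c * (x / y) + d))"
    using False proj_scale by metis
  also have "\<dots> = proj (a * x + b * y) (c * x + d * y)"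
    using False by (simp add: algebra_simps)
  finally have "proj (a * (x / y) + b) (c * (x / y) + d) = proj (a * x + b * y) (c * x + d * y)" .
  moreover have "proj x y = Fin (x / y)" using False by (simp add: proj_def)
  ultimately show ?thesis by (simp add: moebius_def)
qed

lemma quad_proj:
  assumes "(x, y) \<noteq> (0, 0)"
  shows "quad a b c d e f (proj x y) =
    proj (a * x^2 + b * x * y + c * y^2) (d * x^2 + e * x * y + f * y^2)"
proof (cases "y = 0")
  case True
  then show ?thesis using assms proj_scale[of "x^2" a d] by (simp add: quad_def proj_def mult.commute)
next
  case False
  define z where "z = x / y"
  have x: "x = y * z" using False by (simp add: z_def)
  have "proj (a * x^2 + b * x * y + c * y^2) (d * x^2 + e * x * y + f * y^2) =
    proj (y^2 * (a * z^2 + b * z + c)) (y^2 * (d * z^2 + e * z + f))"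
    by (simp add: x power2_eq_square algebra_simps)
  also have "\<dots> = proj (a * z^2 + b * z + c) (d * z^2 + e * z + f)"
    using False proj_scale[of "y^2"] by simp
  finally show ?thesis using False by (simp add: quad_def proj_def[of x y] z_def)
qed

lemma quad_nz:
  assumes "quad_res a b c d e f \<noteq> 0" "(x, y) \<noteq> (0, 0)"
  shows "(a * x^2 + b * x * y + c * y^2, d * x^2 + e * x * y + f * y^2) \<noteq> (0, 0)"
proof
  assume "(a * x^2 + b * x * y + c * y^2, d * x^2 + e * x * y + f * y^2) = (0, 0)"
  then have F: "a * x^2 + b * x * y + c * y^2 = 0" and G: "d * x^2 + e * x * y + f * y^2 = 0" by auto
  let ?A = "a * f - c * d" and ?B = "a * e - b * d" and ?C = "b * f - c * e"
  \<comment> \<open>Elimination of the \<open>x^2\<close> terms gives the first equation,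
    elimination of the \<open>y^2\<close> terms the second.\<close>
  have 1: "y * (?B * x + ?A * y) = 0"
    using F G by algebra
  have 2: "x * (?A * x + ?C * y) = 0"
    using F G by algebra
  show False
  proof (cases "x = 0 \<or> y = 0")
    case True
    then show ?thesis using assms F G by (auto simp: quad_res_def)
  next
    case False
    then have "?B * x + ?A * y = 0" "?A * x + ?C * y = 0" using 1 2 by auto
    then have "x * (?A^2 - ?B * ?C) = 0" by algebra
    then show ?thesis using False assms by (simp add: quad_res_def)
  qed
qed

lemma quad_scale: "k \<noteq> 0 \<Longrightarrow> quad (k*a) (k*b) (k*c) (k*d) (k*e) (k*f) = quad a b c d e f"
  using proj_scale[of k] by (auto simp: quad_def fun_eq_iff Let_def split: prod.splits)
     (metis (no_types, opaque_lifting) distrib_left mult.assoc)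

lemma poly_degree_le_2:
  fixes p :: "'a::comm_ring_1 poly"
  assumes "degree p \<le> 2"
  shows "poly p z = coeff p 2 * z^2 + coeff p 1 * z + coeff p 0"
proof -
  have "p = [:coeff p 0, coeff p 1, coeff p 2:]"
    using assms by (intro poly_eqI) (auto simp: coeff_pCons coeff_eq_0 numeral_2_eq_2 split: nat.splits)
  then have "poly p z = poly [:coeff p 0, coeff p 1, coeff p 2:] z" by simp
  then show ?thesis by (simp add: algebra_simps power2_eq_square)
qed

lemma ratmap_quad:
  assumes "max (degree p) (degree q) = 2"
  shows "ratmap p q = quad (coeff p 2) (coeff p 1) (coeff p 0) (coeff q 2) (coeff q 1) (coeff q 0)"
proof
  fix P
  show "ratmap p q P = quad (coeff p 2) (coeff p 1) (coeff p 0) (coeff q 2) (coeff q 1) (coeff q 0) P"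
    using assms by (cases P) (auto simp: quad_def poly_degree_le_2 Let_def)
qed

lemma quadratic_splits:
  fixes a b c :: complex
  assumes "a \<noteq> 0"
  obtains r s where "\<And>z. a * z^2 + b * z + c = a * (z - r) * (z - s)" "b = - a * (r + s)" "c = a * r * s"
proof -
  define D where "D = csqrt (b^2 - 4 * a * c)"
  have D: "D^2 = b^2 - 4 * a * c" by (simp add: D_def)
  define r s where "r = (- b + D) / (2 * a)" and "s = (- b - D) / (2 * a)"
  have rs: "r + s = - b / a" using assms by (simp add: r_def s_def field_simps)
  have "r * s = (b^2 - D^2) / (4 * a^2)"
    using assms by (simp add: r_def s_def field_simps power2_eq_square)
  then have "r * s = (4 * a * c) / (4 * a^2)" by (simp only: D) (simp add: algebra_simps)
  then have rs': "r * s = c / a" using assms by (simp add: power2_eq_square)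
  have "b = - a * (r + s)" "c = a * (r * s)" using assms by (simp_all add: rs rs')
  then show ?thesis
    by (intro that[of r s], algebra) simp_all
qed

text \<open>The hypothesis excludes a common zero at infinity. For finite ones, the resultant is
  \<open>a^2\<close> times the product of the values of the second form at the two roots of the
  first.\<close>

lemma quad_res_nz_iff:
  fixes a b c d e f :: complex
  assumes "a \<noteq> 0 \<or> d \<noteq> 0"
  shows "quad_res a b c d e f \<noteq> 0 \<longleftrightarrow> (\<forall>z. a * z^2 + b * z + c \<noteq> 0 \<or> d * z^2 + e * z + f \<noteq> 0)"
proof
  show "\<forall>z. a * z^2 + b * z + c \<noteq> 0 \<or> d * z^2 + e * z + f \<noteq> 0" if "quad_res a b c d e f \<noteq> 0"
    using quad_nz[OF that, of _ 1] by auto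
next
  have main: "quad_res a b c d e f \<noteq> 0"
    if "a \<noteq> 0" "\<forall>z. a * z^2 + b * z + c \<noteq> 0 \<or> d * z^2 + e * z + f \<noteq> 0" for a b c d e f :: complex
  proof -
    obtain r s where rs: "\<And>z. a * z^2 + b * z + c = a * (z - r) * (z - s)" "b = - a * (r + s)" "c = a * r * s"
      using quadratic_splits[OF \<open>a \<noteq> 0\<close>] by blast
    have "quad_res a b c d e f = a^2 * (d * r^2 + e * r + f) * (d * s^2 + e * s + f)"
      unfolding quad_res_def rs(2,3) by algebra
    moreover have "d * r^2 + e * r + f \<noteq> 0" "d * s^2 + e * s + f \<noteq> 0"
      using that(2)[rule_format, of r] that(2)[rule_format, of s] by (simp_all add: rs(1))
    ultimately show ?thesis using that(1) by simp
  qed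
  assume nz: "\<forall>z. a * z^2 + b * z + c \<noteq> 0 \<or> d * z^2 + e * z + f \<noteq> 0"
  show "quad_res a b c d e f \<noteq> 0"
  proof (cases "a = 0")
    case True
    then have "d \<noteq> 0" using assms by auto
    then have "quad_res d e f a b c \<noteq> 0" using main[of d e f a b c] nz by auto
    moreover have "quad_res d e f a b c = quad_res a b c d e f"
      unfolding quad_res_def by algebra
    ultimately show ?thesis by simp
  qed (use main nz in auto)
qed

lemma coprime_iff_no_common_root:
  fixes p q :: "complex poly"
  assumes "p \<noteq> 0 \<or> q \<noteq> 0"
  shows "coprime p q \<longleftrightarrow> (\<forall>z. poly p z \<noteq> 0 \<or> poly q z \<noteq> 0)"
proof
  assume cop: "coprime p q"
  show "\<forall>z. poly p z \<noteq> 0 \<or> poly q z \<noteq> 0"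
  proof (rule ccontr)
    assume "\<not> (\<forall>z. poly p z \<noteq> 0 \<or> poly q z \<noteq> 0)"
    then obtain z where "[:-z, 1:] dvd p" "[:-z, 1:] dvd q" by (auto simp: poly_eq_0_iff_dvd)
    then have "is_unit [:-z, 1:]" using cop by (meson coprime_common_divisor)
    then show False by (simp add: is_unit_iff_degree)
  qed
next
  assume nz: "\<forall>z. poly p z \<noteq> 0 \<or> poly q z \<noteq> 0"
  show "coprime p q"
  proof (rule coprimeI)
    fix c assume c: "c dvd p" "c dvd q"
    then have "c \<noteq> 0" using assms by auto
    have "degree c = 0"
    proof (rule ccontr)
      assume "degree c \<noteq> 0"
      then obtain z where "poly c z = 0"
        using alg_closed_imp_poly_has_root[of c] by auto
      then show False using nz c by (metis dvdE mult_eq_0_iff poly_mult)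
    qed
    then show "is_unit c" using \<open>c \<noteq> 0\<close> by (simp add: is_unit_iff_degree)
  qed
qed

lemma rational_map_2_iff:
  fixes \<phi> :: "complex P1 \<Rightarrow> complex P1"
  assumes "0 \<in> K"
  shows "rational_map K 2 \<phi> \<longleftrightarrow>
    (\<exists>a b c d e f. {a, b, c, d, e, f} \<subseteq> K \<and> quad_res a b c d e f \<noteq> 0 \<and> \<phi> = quad a b c d e f)"
proof
  assume "rational_map K 2 \<phi>"
  then obtain p q where pq: "coprime p q" "\<And>i. coeff p i \<in> K" "\<And>i. coeff q i \<in> K"
    "max (degree p) (degree q) = 2" "\<phi> = ratmap p q"
    by (auto simp: rational_map_def)
  have "coeff p 2 \<noteq> 0 \<or> coeff q 2 \<noteq> 0"
    using pq(4) by (metis leading_coeff_0_iff max_def zero_neq_numeral degree_0)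
  moreover have "\<forall>z. poly p z \<noteq> 0 \<or> poly q z \<noteq> 0"
    using pq(1) coprime_iff_no_common_root by (metis coprime_0_left_iff is_unit_iff_degree degree_0 pq(4) max_def zero_neq_numeral)
  ultimately have "quad_res (coeff p 2) (coeff p 1) (coeff p 0) (coeff q 2) (coeff q 1) (coeff q 0) \<noteq> 0"
    using quad_res_nz_iff poly_degree_le_2 pq(4) by (metis max.cobounded1 max.cobounded2)
  then show "\<exists>a b c d e f. {a, b, c, d, e, f} \<subseteq> K \<and> quad_res a b c d e f \<noteq> 0 \<and> \<phi> = quad a b c d e f"
    using ratmap_quad[OF pq(4)] pq by blast
next
  assume "\<exists>a b c d e f. {a, b, c, d, e, f} \<subseteq> K \<and> quad_res a b c d e f \<noteq> 0 \<and> \<phi> = quad a b c d e f"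
  then obtain a b c d e f where K: "{a, b, c, d, e, f} \<subseteq> K" and res: "quad_res a b c d e f \<noteq> 0"
    and \<phi>: "\<phi> = quad a b c d e f" by blast
  define p q where "p = [:c, b, a:]" and "q = [:f, e, d:]"
  have ad: "a \<noteq> 0 \<or> d \<noteq> 0" using res by (auto simp: quad_res_def)
  then have deg: "max (degree p) (degree q) = 2" by (auto simp: p_def q_def)
  have "p \<noteq> 0 \<or> q \<noteq> 0" using ad by (auto simp: p_def q_def)
  then have "coprime p q"
    using res quad_res_nz_iff[OF ad, of b c e f]
    by (auto simp: coprime_iff_no_common_root p_def q_def algebra_simps power2_eq_square)
  moreover have "\<forall>i. coeff p i \<in> K" "\<forall>i. coeff q i \<in> K"
    using K assms by (auto simp: p_def q_def coeff_pCons split: nat.splits)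
  moreover have "\<phi> = ratmap p q"
    using ratmap_quad[OF deg] by (simp add: \<phi> p_def q_def numeral_2_eq_2)
  ultimately show "rational_map K 2 \<phi>" using deg unfolding rational_map_def by blast
qed

subsection \<open>Critical points as points of injectivity\<close>

text \<open>In degree 2 a point is ramified exactly if it is alone in its fiber. This description
  mentions no coefficients and is carried along by every bijection.\<close>

definition crit :: "('a P1 \<Rightarrow> 'a P1) \<Rightarrow> 'a P1 \<Rightarrow> bool" where
  "crit \<phi> P \<longleftrightarrow> (\<forall>Q. \<phi> Q = \<phi> P \<longrightarrow> Q = P)"

text \<open>The roots of \<open>p\<close> are cancelled one at a time: each of them is no root of
  \<open>q\<close>, hence a root of \<open>r\<close>.\<close>

lemma dvd_mult_no_common_root:
  fixes p q r :: "complex poly"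
  assumes "p \<noteq> 0" "\<And>z. poly p z \<noteq> 0 \<or> poly q z \<noteq> 0" "p dvd q * r"
  shows "p dvd r"
  using assms
proof (induction "degree p" arbitrary: p r)
  case 0
  then show ?case by (metis is_unit_iff_degree unit_imp_dvd)
next
  case (Suc n)
  then obtain z where "poly p z = 0" using alg_closed_imp_poly_has_root[of p] by auto
  then obtain p1 where p1: "p = [:-z, 1:] * p1" by (auto simp: poly_eq_0_iff_dvd)
  then have "p1 \<noteq> 0" using Suc.prems by auto
  have "poly (q * r) z = 0" using Suc.prems(3) \<open>poly p z = 0\<close> by (metis dvdE mult_zero_left poly_mult)
  then have "poly r z = 0" using Suc.prems(2)[of z] \<open>poly p z = 0\<close> by simp
  then obtain r1 where r1: "r = [:-z, 1:] * r1" by (auto simp: poly_eq_0_iff_dvd)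
  have "[:-z, 1:] * p1 dvd [:-z, 1:] * (q * r1)" using Suc.prems(3) by (simp only: p1 r1 mult_ac)
  then have "p1 dvd q * r1" by (subst (asm) dvd_mult_cancel_left) simp
  moreover have "degree ([:-z, 1:] * p1) = 1 + degree p1"
    using \<open>p1 \<noteq> 0\<close> by (subst degree_mult_eq) auto
  then have "n = degree p1" using Suc.hyps(2) by (simp only: p1)
  moreover have "poly p1 w \<noteq> 0 \<or> poly q w \<noteq> 0" for w using Suc.prems(2)[of w] by (auto simp: p1)
  ultimately have "p1 dvd r1" using Suc.hyps(1) \<open>p1 \<noteq> 0\<close> by blast
  then show ?case by (simp only: p1 r1 mult_dvd_mono dvd_refl)
qed

text \<open>\<open>critical_point\<close> allows any representation of the map by a coprime pair;
  this lemma makes the degree independent of the choice.\<close>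

lemma ratmap_eq_ratmap_degree:
  fixes p q p' q' :: "complex poly"
  assumes "coprime p q" "coprime p' q'" "ratmap p q = ratmap p' q'"
  shows "max (degree p) (degree q) = max (degree p') (degree q')"
proof -
  have nz: "(poly p z, poly q z) \<noteq> (0, 0)" if "coprime p q" for p q :: "complex poly" and z
    using that coprime_iff_no_common_root[of p q] by (cases "p = 0 \<and> q = 0") auto
  have "poly p z * poly q' z = poly p' z * poly q z" for z
    using fun_cong[OF assms(3), of "Fin z"] nz[OF assms(1)] nz[OF assms(2)] by (simp add: proj_eq_iff)
  then have "poly (p * q') = poly (p' * q)" by (simp add: fun_eq_iff)
  then have eq: "p * q' = p' * q" by (simp add: poly_eq_poly_eq_iff)
  have dvd: "p dvd p'" if "coprime p q" "p * q' = p' * q" for p q p' q' :: "complex poly"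
  proof (cases "p = 0")
    case True
    then have "q \<noteq> 0" using that(1) by auto
    then show ?thesis using that(2) True by simp
  next
    case False
    then show ?thesis
      using dvd_mult_no_common_root[of p q p'] coprime_iff_no_common_root[of p q] that by (metis dvd_triv_left mult.commute)
  qed
  have "p dvd p'" "p' dvd p" using dvd[of p q q' p'] dvd[of p' q' q p] assms(1,2) eq by simp_all
  moreover have "q dvd q'" "q' dvd q"
    using dvd[of q p p' q'] dvd[of q' p' p q] assms(1,2) eq by (simp_all add: coprime_commute mult.commute)
  moreover have "degree r = degree s" if "r dvd s" "s dvd r" for r s :: "complex poly"
    using that dvd_imp_degree_le[of r s] dvd_imp_degree_le[of s r] by (cases "r = 0 \<or> s = 0") auto
  ultimately have "degree p = degree p'" "degree q = degree q'" by blast+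
  then show ?thesis by simp
qed

lemma hcoords_proj: "proj (fst (hcoords P)) (snd (hcoords P)) = P" "hcoords P \<noteq> (0, 0)"
  by (cases P; simp add: proj_def)+

lemma order_linear: "order z [:-s, 1:] = (if s = z then 1 else 0)" for z s :: complex
  using order_power_n_n[of z 1] by (auto simp: order_0I)

text \<open>The fiber through \<open>P\<close> is the zero set of a nonzero binary quadratic form,
  dehomogenised to \<open>g\<close>. It has two zeros with multiplicity, so multiplicity 2 at
  \<open>P\<close> leaves no room for another point. At infinity multiplicity 2 means that
  \<open>g\<close> is constant.\<close>

lemma ram_index_ge_2_iff:
  fixes p q :: "complex poly"
  assumes deg: "max (degree p) (degree q) = 2" and cop: "coprime p q"
  shows "ram_index p q P \<ge> 2 \<longleftrightarrow> crit (ratmap p q) P"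
proof -
  define a b where "a = fst (hcoords (ratmap p q P))" and "b = snd (hcoords (ratmap p q P))"
  define g where "g = smult b p - smult a q"
  have ab: "proj a b = ratmap p q P" "(a, b) \<noteq> (0, 0)"
    using hcoords_proj[of "ratmap p q P"] by (auto simp: a_def b_def prod_eq_iff)
  have degg: "degree g \<le> 2"
    using deg degree_diff_le_max[of "smult b p" "smult a q"] degree_smult_le[of b p] degree_smult_le[of a q]
    unfolding g_def by linarith
  define F where "F x y = coeff p 2 * x^2 + coeff p 1 * x * y + coeff p 0 * y^2" for x y
  define G where "G x y = coeff q 2 * x^2 + coeff q 1 * x * y + coeff q 0 * y^2" for x y
  have ad: "coeff p 2 \<noteq> 0 \<or> coeff q 2 \<noteq> 0"
  proof -
    have "degree p = 2 \<or> degree q = 2" using deg by (auto simp: max_def split: if_splits)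
    moreover have "coeff r 2 \<noteq> 0" if "degree r = 2" for r :: "complex poly"
      using that leading_coeff_0_iff[of r] by auto
    ultimately show ?thesis by blast
  qed
  have "\<forall>z. poly p z \<noteq> 0 \<or> poly q z \<noteq> 0"
  proof -
    have "p \<noteq> 0 \<or> q \<noteq> 0" using ad by auto
    then show ?thesis using cop coprime_iff_no_common_root by blast
  qed
  then have res: "quad_res (coeff p 2) (coeff p 1) (coeff p 0) (coeff q 2) (coeff q 1) (coeff q 0) \<noteq> 0"
    unfolding quad_res_nz_iff[OF ad] using deg by (simp add: poly_degree_le_2 max_def split: if_splits)
  have fiber: "ratmap p q (proj x y) = ratmap p q P \<longleftrightarrow> coeff g 2 * x^2 + coeff g 1 * x * y + coeff g 0 * y^2 = 0"
    if "(x, y) \<noteq> (0, 0)" for x y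
  proof -
    have "ratmap p q (proj x y) = proj (F x y) (G x y)" "(F x y, G x y) \<noteq> (0, 0)"
      using that ratmap_quad[OF deg] quad_proj quad_nz[OF res that] by (simp_all add: F_def G_def)
    then have "ratmap p q (proj x y) = ratmap p q P \<longleftrightarrow> F x y * b = a * G x y"
      using ab by (metis proj_eq_iff)
    also have "\<dots> \<longleftrightarrow> coeff g 2 * x^2 + coeff g 1 * x * y + coeff g 0 * y^2 = 0"
      by (auto simp: g_def F_def G_def algebra_simps)
    finally show ?thesis .
  qed
  have fib_fin: "ratmap p q (Fin z) = ratmap p q P \<longleftrightarrow> poly g z = 0" for z
    using fiber[of z 1] degg by (simp add: proj_def poly_degree_le_2)
  have fib_inf: "ratmap p q Infty = ratmap p q P \<longleftrightarrow> coeff g 2 = 0"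
    using fiber[of 1 0] by (simp add: proj_def)
  \<comment> \<open>Otherwise the coefficient rows of \<open>p\<close> and \<open>q\<close> would be
    proportional and the resultant would vanish.\<close>
  have "g \<noteq> 0"
  proof
    assume "g = 0"
    then have *: "b * coeff p i = a * coeff q i" for i
      by (metis coeff_diff coeff_smult coeff_0 eq_iff_diff_eq_0 g_def)
    have "a^2 * quad_res (coeff p 2) (coeff p 1) (coeff p 0) (coeff q 2) (coeff q 1) (coeff q 0) = 0"
      "b^2 * quad_res (coeff p 2) (coeff p 1) (coeff p 0) (coeff q 2) (coeff q 1) (coeff q 0) = 0"
      unfolding quad_res_def using *[of 0] *[of 1] *[of 2] by algebra+
    then show False using res ab by auto
  qed
  have ram: "ram_index p q P = (case P of Fin z \<Rightarrow> order z g | Infty \<Rightarrow> 2 - degree g)"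
    by (simp add: ram_index_def a_def b_def g_def deg Let_def case_prod_unfold cong: P1.case_cong)
  show ?thesis
  proof (cases P)
    case (Fin z)
    then have z: "poly g z = 0" using fib_fin[of z] by simp
    have ramF: "ram_index p q P = order z g" unfolding ram using Fin by simp
    show ?thesis
    proof (cases "coeff g 2 = 0")
      case True
      have "degree g \<le> 1"
        using degg True by (metis One_nat_def Suc_1 le_SucE leading_coeff_0_iff degree_0 zero_le_one)
      then have "order z g \<le> 1" using order_degree[OF \<open>g \<noteq> 0\<close>] le_trans by blast
      moreover have "\<not> crit (ratmap p q) P"
        unfolding crit_def using True fib_inf Fin by (metis P1.distinct(1))
      ultimately show ?thesis unfolding ramF by linarith
    next
      case False
      obtain r s where rs: "\<And>z. coeff g 2 * z^2 + coeff g 1 * z + coeff g 0 = coeff g 2 * (z - r) * (z - s)"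
        using quadratic_splits[OF False, of "coeff g 1" "coeff g 0"] by blast
      have pg: "poly g w = coeff g 2 * (w - r) * (w - s)" for w
        using rs[of w] degg by (simp add: poly_degree_le_2)
      then have "poly g = poly (smult (coeff g 2) ([:-r, 1:] * [:-s, 1:]))"
        by (auto simp: fun_eq_iff algebra_simps)
      then have g: "g = smult (coeff g 2) ([:-r, 1:] * [:-s, 1:])" by (simp only: poly_eq_poly_eq_iff)
      have "order z g = order z ([:-r, 1:] * [:-s, 1:])"
        by (subst g, rule order_smult) (rule False)
      also have "\<dots> = order z [:-r, 1:] + order z [:-s, 1:]"
        by (rule order_mult) (simp add: \<open>g \<noteq> 0\<close>)
      finally have "order z g \<ge> 2 \<longleftrightarrow> r = z \<and> s = z" by (simp add: order_linear)
      moreover have "crit (ratmap p q) P \<longleftrightarrow> (\<forall>w. poly g w = 0 \<longrightarrow> w = z)"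
        unfolding crit_def using fib_fin fib_inf False Fin by (metis P1.exhaust P1.inject)
      moreover have "\<dots> \<longleftrightarrow> r = z \<and> s = z" using False z by (auto simp: pg)
      ultimately show ?thesis unfolding ramF by blast
    qed
  next
    case Infty
    then have c2: "coeff g 2 = 0" using fib_inf by simp
    have c: "crit (ratmap p q) P \<longleftrightarrow> (\<forall>w. poly g w \<noteq> 0)"
      unfolding crit_def using fib_fin Infty by (metis P1.exhaust P1.distinct(1))
    have "degree g = 0 \<longleftrightarrow> (\<forall>w. poly g w \<noteq> 0)"
    proof
      assume "degree g = 0"
      then show "\<forall>w. poly g w \<noteq> 0" using \<open>g \<noteq> 0\<close> by (metis degree_eq_zeroE pCons_eq_0_iff poly_pCons mult_zero_right poly_0 add.right_neutral)
    next
      assume "\<forall>w. poly g w \<noteq> 0"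
      then show "degree g = 0" using alg_closed_imp_poly_has_root[of g] by auto
    qed
    moreover have "2 - degree g \<ge> 2 \<longleftrightarrow> degree g = 0" by auto
    moreover have "ram_index p q P = 2 - degree g" unfolding ram using Infty by simp
    ultimately show ?thesis unfolding c by metis
  qed
qed

lemma critical_point_iff_crit:
  assumes "rational_map UNIV 2 (\<phi> :: complex P1 \<Rightarrow> complex P1)"
  shows "critical_point \<phi> P \<longleftrightarrow> crit \<phi> P"
proof -
  obtain p q where pq: "coprime p q" "max (degree p) (degree q) = 2" "\<phi> = ratmap p q"
    using assms by (auto simp: rational_map_def)
  show ?thesis
  proof
    assume "critical_point \<phi> P"
    then obtain r s where rs: "coprime r s" "\<phi> = ratmap r s" "ram_index r s P \<ge> 2"
      by (auto simp: critical_point_def)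
    have "max (degree r) (degree s) = max (degree p) (degree q)"
      by (rule ratmap_eq_ratmap_degree[OF rs(1) pq(1)]) (simp only: rs(2)[symmetric] pq(3)[symmetric])
    then have "max (degree r) (degree s) = 2" by (simp only: pq(2))
    from ram_index_ge_2_iff[OF this rs(1), of P] rs(3) show "crit \<phi> P" by (simp only: rs(2))
  next
    assume "crit \<phi> P"
    then show "critical_point \<phi> P"
      unfolding critical_point_def
      by (intro exI[of _ p] exI[of _ q] conjI pq(1,3)) (simp only: ram_index_ge_2_iff[OF pq(2,1)] pq(3))
  qed
qed

lemma PCF_iff_crit:
  assumes "rational_map UNIV 2 (\<phi> :: complex P1 \<Rightarrow> complex P1)"
  shows "PCF \<phi> \<longleftrightarrow> (\<forall>P. crit \<phi> P \<longrightarrow> finite (range (\<lambda>n. (\<phi> ^^ n) P)))"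
proof -
  have "{(\<phi> ^^ n) P |n. True} = range (\<lambda>n. (\<phi> ^^ n) P)" for P by auto
  then show ?thesis unfolding PCF_def critical_point_iff_crit[OF assms] by (simp only:)
qed

subsection \<open>Conjugation\<close>

lemma moebius_comp:
  assumes "a * d - b * c \<noteq> 0"
  shows "moebius a' b' c' d' (moebius a b c d P) =
    moebius (a' * a + b' * c) (a' * b + b' * d) (c' * a + d' * c) (c' * b + d' * d) P"
proof -
  obtain x y where xy: "(x, y) \<noteq> (0, 0)" "P = proj x y" by (rule P1_cases_proj)
  have "(a * x + b * y, c * x + d * y) \<noteq> (0, 0)"
  proof
    assume "(a * x + b * y, c * x + d * y) = (0, 0)"
    then have "(a * d - b * c) * x = 0" "(a * d - b * c) * y = 0" by simp_all algebra+
    then show False using assms xy by simp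
  qed
  then show ?thesis using xy by (simp add: moebius_proj algebra_simps)
qed

lemma moebius_scalar: "k \<noteq> 0 \<Longrightarrow> moebius k 0 0 k P = P"
proof -
  assume "k \<noteq> 0"
  obtain x y where xy: "(x, y) \<noteq> (0, 0)" "P = proj x y" by (rule P1_cases_proj)
  then show ?thesis using proj_scale[OF \<open>k \<noteq> 0\<close>] by (simp add: moebius_proj)
qed

lemma moebius_inverse:
  assumes "a * d - b * c \<noteq> 0"
  shows "moebius d (- b) (- c) a (moebius a b c d P) = P" "moebius a b c d (moebius d (- b) (- c) a P) = P"
proof -
  have "moebius d (- b) (- c) a (moebius a b c d P) = moebius (a * d - b * c) 0 0 (a * d - b * c) P"
    using assms by (simp add: moebius_comp algebra_simps)
  then show "moebius d (- b) (- c) a (moebius a b c d P) = P" using assms by (simp add: moebius_scalar)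
  have "d * a - (- b) * (- c) \<noteq> 0" using assms by (simp add: algebra_simps)
  then have "moebius a b c d (moebius d (- b) (- c) a P) = moebius (a * d - b * c) 0 0 (a * d - b * c) P"
    by (subst moebius_comp) (simp_all add: algebra_simps)
  then show "moebius a b c d (moebius d (- b) (- c) a P) = P" using assms by (simp add: moebius_scalar)
qed

lemma bij_moebius: "a * d - b * c \<noteq> 0 \<Longrightarrow> bij (moebius a b c d)"
  by (rule o_bij[of "moebius d (- b) (- c) a"]) (auto simp: fun_eq_iff moebius_inverse)

lemma conjugate_over_iff:
  "conjugate_over K \<phi> \<psi> \<longleftrightarrow> (\<exists>a b c d. {a, b, c, d} \<subseteq> K \<and> a * d - b * c \<noteq> 0 \<and>
     (\<forall>P. \<psi> (moebius a b c d P) = moebius a b c d (\<phi> P)))"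
proof -
  have *: "\<psi> = conj_by f \<phi> \<longleftrightarrow> (\<forall>P. \<psi> (f P) = f (\<phi> P))" if "bij f" for f
  proof
    assume "\<psi> = conj_by f \<phi>"
    then show "\<forall>P. \<psi> (f P) = f (\<phi> P)" using that by (simp add: conj_by_def bij_is_inj)
  next
    assume *: "\<forall>P. \<psi> (f P) = f (\<phi> P)"
    show "\<psi> = conj_by f \<phi>"
    proof
      fix P
      have "\<psi> P = \<psi> (f (inv f P))" using that by (simp add: bij_is_surj surj_f_inv_f)
      then show "\<psi> P = conj_by f \<phi> P" using * by (simp add: conj_by_def)
    qed
  qed
  have "conjugate_over K \<phi> \<psi> \<longleftrightarrow> (\<exists>a b c d. {a, b, c, d} \<subseteq> K \<and> a * d - b * c \<noteq> 0 \<and>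
      \<psi> = conj_by (moebius a b c d) \<phi>)"
  proof
    assume "\<exists>a b c d. {a, b, c, d} \<subseteq> K \<and> a * d - b * c \<noteq> 0 \<and> \<psi> = conj_by (moebius a b c d) \<phi>"
    then obtain a b c d where abcd: "{a, b, c, d} \<subseteq> K" "a * d - b * c \<noteq> 0"
      "\<psi> = conj_by (moebius a b c d) \<phi>" by (elim exE conjE)
    have "moebius a b c d \<in> PGL2 K"
      unfolding PGL2_def mem_Collect_eq using abcd(1,2)
      by (intro exI[of _ a] exI[of _ b] exI[of _ c] exI[of _ d]) simp
    then show "conjugate_over K \<phi> \<psi>" unfolding conjugate_over_def using abcd(3) by (intro bexI[of _ "moebius a b c d"])
  qed (auto simp: conjugate_over_def PGL2_def)
  also have "\<dots> \<longleftrightarrow> (\<exists>a b c d. {a, b, c, d} \<subseteq> K \<and> a * d - b * c \<noteq> 0 \<and>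
     (\<forall>P. \<psi> (moebius a b c d P) = moebius a b c d (\<phi> P)))"
    by (intro ex_cong1 conj_cong refl *[OF bij_moebius])
  finally show ?thesis .
qed

lemma conjugate_refl: "conjugate_over Qbar \<phi> \<phi>"
  unfolding conjugate_over_iff
  by (intro exI[of _ 1] exI[of _ 0]) (simp add: moebius_scalar)

lemma conjugate_sym:
  assumes "conjugate_over Qbar \<phi> \<psi>"
  shows "conjugate_over Qbar \<psi> \<phi>"
proof -
  obtain a b c d where abcd: "{a, b, c, d} \<subseteq> Qbar" "a * d - b * c \<noteq> 0"
    "\<And>P. \<psi> (moebius a b c d P) = moebius a b c d (\<phi> P)"
    using assms by (auto simp: conjugate_over_iff)
  have "\<phi> (moebius d (- b) (- c) a P) = moebius d (- b) (- c) a (\<psi> P)" for P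
    using abcd(3)[of "moebius d (- b) (- c) a P"] moebius_inverse[OF abcd(2)] by metis
  then show ?thesis
    unfolding conjugate_over_iff using abcd
    by (intro exI[of _ d] exI[of _ "- b"] exI[of _ "- c"] exI[of _ a]) (auto simp: Qbar_uminus algebra_simps)
qed

lemma conjugate_trans:
  assumes "conjugate_over Qbar \<phi> \<psi>" "conjugate_over Qbar \<psi> \<omega>"
  shows "conjugate_over Qbar \<phi> \<omega>"
proof -
  obtain a b c d where 1: "{a, b, c, d} \<subseteq> Qbar" "a * d - b * c \<noteq> 0"
    "\<And>P. \<psi> (moebius a b c d P) = moebius a b c d (\<phi> P)"
    using assms(1) by (auto simp: conjugate_over_iff)
  obtain a' b' c' d' where 2: "{a', b', c', d'} \<subseteq> Qbar" "a' * d' - b' * c' \<noteq> 0"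
    "\<And>P. \<omega> (moebius a' b' c' d' P) = moebius a' b' c' d' (\<psi> P)"
    using assms(2) by (auto simp: conjugate_over_iff)
  let ?A = "a' * a + b' * c" and ?B = "a' * b + b' * d" and ?C = "c' * a + d' * c" and ?D = "c' * b + d' * d"
  have "\<omega> (moebius ?A ?B ?C ?D P) = moebius ?A ?B ?C ?D (\<phi> P)" for P
    using 1(3) 2(3) by (simp flip: moebius_comp[OF 1(2)])
  moreover have "?A * ?D - ?B * ?C = (a * d - b * c) * (a' * d' - b' * c')" by algebra
  moreover have "{?A, ?B, ?C, ?D} \<subseteq> Qbar" using 1(1) 2(1) by (auto intro!: Qbar_intros)
  ultimately show ?thesis
    unfolding conjugate_over_iff using 1(2) 2(2)
    by (intro exI[of _ ?A] exI[of _ ?B] exI[of _ ?C] exI[of _ ?D]) auto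
qed

text \<open>Conjugacy is reduced to two identities of quadratic forms; \<open>k\<close> is the
  common factor that projective coordinates leave free.\<close>

lemma conjugate_quadI:
  assumes res: "quad_res a b c d e f \<noteq> 0" and Q: "{\<alpha>, \<beta>, \<gamma>, \<delta>} \<subseteq> Qbar"
    and det: "\<alpha> * \<delta> - \<beta> * \<gamma> \<noteq> 0" and k: "k \<noteq> 0"
    and F: "\<And>x y. a' * (\<alpha> * x + \<beta> * y)^2 + b' * (\<alpha> * x + \<beta> * y) * (\<gamma> * x + \<delta> * y) + c' * (\<gamma> * x + \<delta> * y)^2 =
      k * (\<alpha> * (a * x^2 + b * x * y + c * y^2) + \<beta> * (d * x^2 + e * x * y + f * y^2))"
    and G: "\<And>x y. d' * (\<alpha> * x + \<beta> * y)^2 + e' * (\<alpha> * x + \<beta> * y) * (\<gamma> * x + \<delta> * y) + f' * (\<gamma> * x + \<delta> * y)^2 =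
      k * (\<gamma> * (a * x^2 + b * x * y + c * y^2) + \<delta> * (d * x^2 + e * x * y + f * y^2))"
  shows "conjugate_over Qbar (quad a b c d e f) (quad a' b' c' d' e' f')"
proof -
  have "quad a' b' c' d' e' f' (moebius \<alpha> \<beta> \<gamma> \<delta> P) = moebius \<alpha> \<beta> \<gamma> \<delta> (quad a b c d e f P)" for P
  proof -
    obtain x y where xy: "(x, y) \<noteq> (0, 0)" "P = proj x y" by (rule P1_cases_proj)
    have nz: "(\<alpha> * x + \<beta> * y, \<gamma> * x + \<delta> * y) \<noteq> (0, 0)"
    proof
      assume "(\<alpha> * x + \<beta> * y, \<gamma> * x + \<delta> * y) = (0, 0)"
      then have "(\<alpha> * \<delta> - \<beta> * \<gamma>) * x = 0" "(\<alpha> * \<delta> - \<beta> * \<gamma>) * y = 0" by simp_all algebra+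
      then show False using det xy by simp
    qed
    show ?thesis
      unfolding xy(2) moebius_proj[OF xy(1)] quad_proj[OF xy(1)] quad_proj[OF nz]
        moebius_proj[OF quad_nz[OF res xy(1)]] F G proj_scale[OF k] ..
  qed
  then show ?thesis
    unfolding conjugate_over_iff using Q det
    by (intro exI[of _ \<alpha>] exI[of _ \<beta>] exI[of _ \<gamma>] exI[of _ \<delta>]) (intro conjI allI)
qed

definition fin_crit :: "('a P1 \<Rightarrow> 'a P1) \<Rightarrow> bool" where
  "fin_crit \<phi> \<longleftrightarrow> (\<forall>P. crit \<phi> P \<longrightarrow> finite (range (\<lambda>n. (\<phi> ^^ n) P)))"

lemma conjugate_portrait:
  assumes "conjugate_over K \<phi> \<psi>"
  obtains f where "bij f" "\<And>n P. (\<psi> ^^ n) (f P) = f ((\<phi> ^^ n) P)" "\<And>P. crit \<psi> (f P) \<longleftrightarrow> crit \<phi> P"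
proof -
  obtain a b c d where abcd: "a * d - b * c \<noteq> 0" "\<forall>P. \<psi> (moebius a b c d P) = moebius a b c d (\<phi> P)"
    using assms unfolding conjugate_over_iff by blast
  define f where "f = moebius a b c d"
  have f: "bij f" "\<And>P. \<psi> (f P) = f (\<phi> P)"
    using bij_moebius[OF abcd(1)] abcd(2) by (simp_all add: f_def)
  have "(\<psi> ^^ n) (f P) = f ((\<phi> ^^ n) P)" for n P
    using f(2) by (induction n) auto
  moreover have "crit \<psi> (f P) \<longleftrightarrow> crit \<phi> P" for P
    unfolding crit_def using f by (metis bij_pointE)
  ultimately show ?thesis using that f(1) by blast
qed

lemma fin_crit_conjugate:
  assumes "conjugate_over K \<phi> \<psi>" "fin_crit \<phi>"
  shows "fin_crit \<psi>"
proof -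
  obtain f where f: "bij f" "\<And>n P. (\<psi> ^^ n) (f P) = f ((\<phi> ^^ n) P)" "\<And>P. crit \<psi> (f P) \<longleftrightarrow> crit \<phi> P"
    using conjugate_portrait[OF assms(1)] by blast
  show ?thesis
    unfolding fin_crit_def
  proof safe
    fix P assume "crit \<psi> P"
    obtain Q where "P = f Q" using f(1) by (metis bij_pointE)
    then have "range (\<lambda>n. (\<psi> ^^ n) P) = f ` range (\<lambda>n. (\<phi> ^^ n) Q)"
      using f(2) by auto
    then show "finite (range (\<lambda>n. (\<psi> ^^ n) P))"
      using assms(2) \<open>crit \<psi> P\<close> f(3) \<open>P = f Q\<close> by (auto simp: fin_crit_def)
  qed
qed

subsection \<open>The normal form \<open>z \<mapsto> \<mu> (z + 1/z + \<beta>)\<close>\<close>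

definition Phi :: "complex \<Rightarrow> complex \<Rightarrow> complex P1 \<Rightarrow> complex P1" where
  "Phi \<mu> \<beta> = quad \<mu> (\<mu> * \<beta>) \<mu> 0 1 0"

text \<open>\<open>s3\<close> and \<open>s2\<close> play the role of the third and second elementary symmetric functions of the
  multipliers of the three fixed points; the first one is then \<open>s3 + 2\<close>.  A fixed point of
  multiplier \<open>\<kappa> \<noteq> 0\<close> is moved to infinity.\<close>

definition has_invariants :: "(complex P1 \<Rightarrow> complex P1) \<Rightarrow> complex \<Rightarrow> complex \<Rightarrow> bool" where
  "has_invariants \<phi> s2 s3 \<longleftrightarrow> (\<forall>\<kappa> \<beta>. \<kappa> \<noteq> 0 \<longrightarrow> \<kappa>^3 - (s3 + 2) * \<kappa>^2 + s2 * \<kappa> - s3 = 0 \<longrightarrow>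
     \<beta>^2 = (\<kappa> - 2)^2 - s3 * \<kappa> \<longrightarrow> conjugate_over Qbar \<phi> (Phi (1 / \<kappa>) \<beta>))"

lemma has_invariants_conjugate:
  "conjugate_over Qbar \<phi> \<psi> \<Longrightarrow> has_invariants \<psi> s2 s3 \<Longrightarrow> has_invariants \<phi> s2 s3"
  unfolding has_invariants_def using conjugate_trans by blast

lemma cubic_splits:
  fixes a b c :: complex
  obtains r s t where "\<And>z. z^3 + a * z^2 + b * z + c = (z - r) * (z - s) * (z - t)"
    "a = - (r + s + t)" "b = r * s + r * t + s * t" "c = - (r * s * t)"
proof -
  have "\<exists>r. poly [:c, b, a, 1:] r = 0" by (rule alg_closed_imp_poly_has_root) simp
  then obtain r where r: "poly [:c, b, a, 1:] r = 0" ..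
  obtain s t where st: "a + r = - 1 * (s + t)" "b + a * r + r^2 = 1 * s * t"
    by (rule quadratic_splits[OF one_neq_zero, of "a + r" "b + a * r + r^2"]) (rule that)
  have a: "a = - (r + s + t)" using st(1) by (simp add: algebra_simps eq_neg_iff_add_eq_0)
  have b: "b = r * s + r * t + s * t" using st(2) a by algebra
  have c: "c = - (r * s * t)" using r a b by simp algebra
  show ?thesis by (rule that[OF _ a b c]) (unfold a b c, algebra)
qed

text \<open>The map fixes \<open>r\<close> with multiplier \<kappa>. The coordinate change sends
  \<open>r\<close> to infinity and the other preimage \<open>[s : r]\<close> of \<open>r\<close> to
  0, and its scale \<open>k\<close> puts the critical points at 1 and -1. The fraction in the
  hypothesis on \<beta> is the product \<open>s3\<close> of the multipliers: for
  \<open>Phi (1 / \<kappa>) \<beta>\<close> this product is given by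
  \<open>\<beta>^2 = (\<kappa> - 2)^2 - s3 * \<kappa>\<close>.\<close>

lemma conjugate_Phi_fixed_point:
  assumes "quad_res 0 a b 1 e f \<noteq> 0" and K: "{a, e, f, r} \<subseteq> Qbar"
    and b: "b = r^3 + e * r^2 + (f - a) * r"
    and \<kappa>: "\<kappa> * (r^2 + e * r + f) = a - e * r - 2 * r^2" "\<kappa> \<noteq> 0"
    and \<beta>: "\<beta>^2 = (\<kappa> - 2)^2 - \<kappa> * (b*e^3 - 4*b*e*f - 8*b^2 + 4*a*f^2 - a*e^2*f + 6*a*b*e - 4*a^2*f + a^3)
              / quad_res 0 a b 1 e f"
  shows "conjugate_over Qbar (quad 0 a b 1 e f) (Phi (1 / \<kappa>) \<beta>)"
proof -
  define Q D R where "Q = r^2 + e * r + f" and "D = a - e * r - 2 * r^2" and "R = quad_res 0 a b 1 e f"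
  \<comment> \<open>\<open>T\<close> is chosen as the mixed coefficient in the identity
    \<open>id\<close> below, which rewrites the numerator in the new coordinates.\<close>
  define s T where "s = a - e * r - r^2" and "T = r * a - 2 * r * s - s * e - 2 * r * Q"
  have R: "R = b^2 - a * b * e + a^2 * f" unfolding R_def quad_res_def by algebra
  have "R \<noteq> 0" using assms(1) by (simp add: R_def)
  have "Q \<noteq> 0"
  proof
    assume "Q = 0"
    then have "0 * r^2 + a * r * 1 + b * 1^2 = 0" "1 * r^2 + e * r * 1 + f * 1^2 = 0"
      using b by (simp_all add: Q_def) algebra
    then show False using quad_nz[OF assms(1), of r 1] by simp
  qed
  have \<kappa>Q: "\<kappa> * Q = D" using \<kappa> by (simp add: Q_def D_def)
  then have "D \<noteq> 0" using \<kappa> \<open>Q \<noteq> 0\<close> by auto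
  define P3 where "P3 = b*e^3 - 4*b*e*f - 8*b^2 + 4*a*f^2 - a*e^2*f + 6*a*b*e - 4*a^2*f + a^3"
  have key: "T^2 * Q^2 = (D - 2 * Q)^2 * R - P3 * D * Q"
    unfolding T_def D_def R P3_def s_def Q_def b by algebra
  have "R * \<beta>^2 = (\<kappa> - 2)^2 * R - P3 * \<kappa>"
    using \<beta> \<open>R \<noteq> 0\<close> unfolding R_def[symmetric] P3_def[symmetric] by (simp add: field_simps)
  then have "Q^2 * (R * \<beta>^2) = T^2 * Q^2"
    using key \<kappa>Q by algebra
  then have RT: "R * \<beta>^2 = T^2" using \<open>Q \<noteq> 0\<close> by simp
  have RQ: "R \<in> Qbar" "T \<in> Qbar" "Q \<in> Qbar" "s \<in> Qbar" "r \<in> Qbar"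
  proof -
    have "a \<in> Qbar" "e \<in> Qbar" "f \<in> Qbar" "r \<in> Qbar" "2 \<in> Qbar" using K by (simp_all add: Qbar_Rats)
    then show "R \<in> Qbar" "T \<in> Qbar" "Q \<in> Qbar" "s \<in> Qbar" "r \<in> Qbar"
      unfolding R T_def s_def Q_def by (simp_all only: b Qbar_intros)
  qed
  \<comment> \<open>The resultant has two square roots; the given sign of \<beta> decides between
    them unless \<beta> vanishes.\<close>
  obtain \<rho> where \<rho>: "\<rho>^2 = R" "\<rho> * \<beta> = T" "\<rho> \<in> Qbar"
  proof (cases "T = 0")
    case True
    then have "\<beta> = 0" using RT \<open>R \<noteq> 0\<close> by simp
    then show ?thesis using that[of "csqrt R"] True RQ by (auto intro: Qbar_intros)
  next
    case False
    then have "\<beta> \<noteq> 0" using RT by auto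
    have sq: "(T / \<beta>)^2 = R" using RT \<open>\<beta> \<noteq> 0\<close> by (simp add: power_divide field_simps)
    then have "T / \<beta> = csqrt R \<or> T / \<beta> = - csqrt R"
      by (metis power2_csqrt power2_eq_iff)
    then have "T / \<beta> \<in> Qbar" by (elim disjE) (simp_all only: Qbar_intros RQ)
    then show ?thesis using that[of "T / \<beta>"] sq \<open>\<beta> \<noteq> 0\<close> by simp
  qed
  then have "\<rho> \<noteq> 0" using \<open>R \<noteq> 0\<close> by auto
  define k where "k = Q / \<rho>"
  have "k \<noteq> 0" using \<open>Q \<noteq> 0\<close> \<open>\<rho> \<noteq> 0\<close> by (simp add: k_def)
  have kR: "k^2 * R = Q^2" and kT: "k * \<beta> * R = T * Q"
    using \<rho> \<open>\<rho> \<noteq> 0\<close> by (auto simp: k_def power2_eq_square field_simps)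
  show ?thesis
    unfolding Phi_def
  proof (rule conjugate_quadI[where \<alpha> = "k * r" and \<beta> = "- (k * s)" and \<gamma> = 1 and \<delta> = "- r" and k = "- k"])
    show "{k * r, - (k * s), 1, - r} \<subseteq> Qbar"
      using RQ \<rho> by (auto simp: k_def intro!: Qbar_intros)
    have "k * r * - r - - (k * s) * 1 = k * D" unfolding D_def s_def by algebra
    then show "k * r * - r - - (k * s) * 1 \<noteq> 0" using \<open>k \<noteq> 0\<close> \<open>D \<noteq> 0\<close> by simp
    show "0 * (k * r * x + - (k * s) * y)\<^sup>2 + 1 * (k * r * x + - (k * s) * y) * (1 * x + - r * y) +
           0 * (1 * x + - r * y)\<^sup>2 =
           - k * (1 * (0 * x\<^sup>2 + a * x * y + b * y\<^sup>2) + - r * (1 * x\<^sup>2 + e * x * y + f * y\<^sup>2))" for x y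
      unfolding b s_def by algebra
    fix x y
    define i where "i = 1 / \<kappa>"
    define A B F G where "A = r * x - s * y" and "B = x - r * y" and "F = a * x * y + b * y^2"
      and "G = x^2 + e * x * y + f * y^2"
    have id: "Q^2 * A^2 + T * Q * A * B + R * B^2 = - Q * D * (r * F - s * G)"
      unfolding A_def B_def F_def G_def R T_def D_def s_def Q_def b by algebra
    have "R * (k^2 * A^2 + \<beta> * k * A * B + B^2) = R * (- \<kappa> * k^2 * (r * F - s * G))"
      using id kR kT \<kappa>Q by algebra
    then have "k^2 * A^2 + \<beta> * k * A * B + B^2 = - \<kappa> * k^2 * (r * F - s * G)"
      by (rule mult_left_cancel[OF \<open>R \<noteq> 0\<close>, THEN iffD1])
    then have "1 / \<kappa> * (k^2 * A^2 + \<beta> * k * A * B + B^2) = - (k^2 * (r * F - s * G))"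
      using \<kappa>(2) by simp
    then show "1 / \<kappa> * (k * r * x + - (k * s) * y)\<^sup>2 +
           1 / \<kappa> * \<beta> * (k * r * x + - (k * s) * y) * (1 * x + - r * y) +
           1 / \<kappa> * (1 * x + - r * y)\<^sup>2 =
           - k * (k * r * (0 * x\<^sup>2 + a * x * y + b * y\<^sup>2) + - (k * s) * (1 * x\<^sup>2 + e * x * y + f * y\<^sup>2))"
      unfolding A_def B_def F_def G_def i_def[symmetric] by algebra
  qed (use assms(1) \<open>k \<noteq> 0\<close> in auto)
qed

text \<open>The right-hand sides arise from the symmetric functions of the multipliers
  \<open>1 - (u - v) (u - w) / (a + v w)\<close> of the fixed points \<open>u\<close>, \<open>v\<close>, \<open>w\<close>, whose denominators multiply to the
  resultant.\<close>

lemma has_invariants_quad: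
  assumes res: "quad_res 0 a b 1 e f \<noteq> 0" and K: "{a, b, e, f} \<subseteq> \<rat>"
    and s2: "s2 * quad_res 0 a b 1 e f = 4*f^3 - e^2*f^2 + 10*b*e*f - 2*b*e^3 + 12*b^2 - 4*a*f^2
               - 7*a*b*e + 5*a^2*f - a^2*e^2 - 2*a^3"
    and s3: "s3 * quad_res 0 a b 1 e f = b*e^3 - 4*b*e*f - 8*b^2 + 4*a*f^2 - a*e^2*f + 6*a*b*e
               - 4*a^2*f + a^3"
  shows "has_invariants (quad 0 a b 1 e f) s2 s3"
  unfolding has_invariants_def
proof (intro allI impI)
  fix \<kappa> \<beta> assume \<kappa>: "\<kappa> \<noteq> 0" "\<kappa>^3 - (s3 + 2) * \<kappa>^2 + s2 * \<kappa> - s3 = 0" and \<beta>: "\<beta>^2 = (\<kappa> - 2)^2 - s3 * \<kappa>"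
  obtain u v w where uvw: "\<And>z. z^3 + e * z^2 + (f - a) * z + - b = (z - u) * (z - v) * (z - w)"
    "e = - (u + v + w)" "f - a = u * v + u * w + v * w" "- b = - (u * v * w)"
    using cubic_splits[of e "f - a" "- b"] by blast
  have f: "f = a + (u * v + u * w + v * w)" and b: "b = u * v * w"
    using uvw by (simp_all add: algebra_simps)
  have R: "quad_res 0 a b 1 e f = (a + v * w) * (a + u * w) * (a + u * v)"
    unfolding quad_res_def b f uvw(2) by algebra
  have "quad_res 0 a b 1 e f * (\<kappa>^3 - (s3 + 2) * \<kappa>^2 + s2 * \<kappa> - s3) =
    quad_res 0 a b 1 e f * \<kappa>^3 - (s3 * quad_res 0 a b 1 e f + 2 * quad_res 0 a b 1 e f) * \<kappa>^2
      + s2 * quad_res 0 a b 1 e f * \<kappa> - s3 * quad_res 0 a b 1 e f" by algebra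
  also have "\<dots> = (\<kappa> * (a + v * w) - (a + v * w - (u - v) * (u - w))) *
    (\<kappa> * (a + u * w) - (a + u * w - (v - u) * (v - w))) *
    (\<kappa> * (a + u * v) - (a + u * v - (w - u) * (w - v)))"
    unfolding s2 s3 unfolding R unfolding b f uvw(2) by algebra
  finally have "(\<kappa> * (a + v * w) - (a + v * w - (u - v) * (u - w))) *
    (\<kappa> * (a + u * w) - (a + u * w - (v - u) * (v - w))) *
    (\<kappa> * (a + u * v) - (a + u * v - (w - u) * (w - v))) = 0"
    using \<kappa>(2) by simp
  then obtain r where r: "r = u \<or> r = v \<or> r = w" and \<kappa>r: "\<kappa> * (r^2 + e * r + f) = a - e * r - 2 * r^2"
  proof (elim mult_eq_0_iff[THEN iffD1, THEN disjE])
    assume *: "\<kappa> * (a + v * w) - (a + v * w - (u - v) * (u - w)) = 0"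
    have "\<kappa> * (u^2 + e * u + f) = a - e * u - 2 * u^2"
      using * unfolding f uvw(2) by algebra
    then show ?thesis using that by blast
  next
    assume *: "\<kappa> * (a + u * w) - (a + u * w - (v - u) * (v - w)) = 0"
    have "\<kappa> * (v^2 + e * v + f) = a - e * v - 2 * v^2"
      using * unfolding f uvw(2) by algebra
    then show ?thesis using that by blast
  next
    assume *: "\<kappa> * (a + u * v) - (a + u * v - (w - u) * (w - v)) = 0"
    have "\<kappa> * (w^2 + e * w + f) = a - e * w - 2 * w^2"
      using * unfolding f uvw(2) by algebra
    then show ?thesis using that by blast
  qed
  have root: "r^3 + e * r^2 + (f - a) * r + - b = 0" unfolding uvw(1) using r by auto
  then have "poly [:- b, f - a, e, 1:] r = 0"
    by (simp add: algebra_simps power2_eq_square power3_eq_cube)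
  moreover have "\<forall>i. coeff [:- b, f - a, e, 1:] i \<in> \<rat>"
    using K by (auto simp: coeff_pCons split: nat.splits)
  moreover have "[:- b, f - a, e, 1:] \<noteq> 0" by simp
  ultimately have "r \<in> Qbar" by (auto simp: Qbar_def algebraic_altdef)
  moreover have "{a, e, f} \<subseteq> Qbar" using K by (auto simp: Qbar_Rats)
  moreover have "b = r^3 + e * r^2 + (f - a) * r" using root by algebra
  moreover have "s3 = (b*e^3 - 4*b*e*f - 8*b^2 + 4*a*f^2 - a*e^2*f + 6*a*b*e - 4*a^2*f + a^3)
      / quad_res 0 a b 1 e f"
    using s3 res by (simp add: field_simps)
  ultimately show "conjugate_over Qbar (quad 0 a b 1 e f) (Phi (1 / \<kappa>) \<beta>)"
    using \<beta> \<kappa>r \<kappa>(1) by (intro conjugate_Phi_fixed_point[OF res, of r]) (auto simp: mult.commute)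
qed

section \<open>Reduction of rational maps to the form with infinity mapped to 0\<close>

lemma conjugate_quad_denominator:
  assumes "quad_res a b c d e f \<noteq> 0" "{a, b, c, d, e, f} \<subseteq> \<rat>" "d \<noteq> 0"
  shows "\<exists>a' b' e' f'. {a', b', e', f'} \<subseteq> \<rat> \<and> quad_res 0 a' b' 1 e' f' \<noteq> 0 \<and>
    conjugate_over Qbar (quad a b c d e f) (quad 0 a' b' 1 e' f')"
proof (intro exI conjI)
  let ?a = "b * d - a * e" and ?b = "a * (b * d - a * e) + d * (c * d - a * f)"
  let ?e = "2 * a + e" and ?f = "a^2 + e * a + f * d"
  show "{?a, ?b, ?e, ?f} \<subseteq> \<rat>"
    using assms(2) by (auto intro!: Rats_add Rats_mult Rats_diff)
  have "quad_res 0 ?a ?b 1 ?e ?f = d^2 * quad_res a b c d e f"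
    unfolding quad_res_def by algebra
  then show "quad_res 0 ?a ?b 1 ?e ?f \<noteq> 0" using assms by simp
  show "conjugate_over Qbar (quad a b c d e f) (quad 0 ?a ?b 1 ?e ?f)"
  \<comment> \<open>The map \<open>z -> d * z - a\<close> takes the image \<open>a / d\<close> of
    infinity to 0, so the numerator loses its square term.\<close>
  proof (rule conjugate_quadI[where \<alpha> = d and \<beta> = "- a" and \<gamma> = 0 and \<delta> = 1 and k = d])
    show "{d, - a, 0, 1} \<subseteq> Qbar" using assms by (auto intro!: Qbar_intros Qbar_Rats)
  qed (use assms in \<open>auto, algebra+\<close>)
qed

text \<open>If infinity is fixed, a rational point \<open>x0\<close> that is not fixed is first
  moved to infinity by \<open>z -> 1 / (z - x0)\<close>.\<close>

lemma conjugate_rational_quad: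
  assumes "quad_res a b c d e f \<noteq> 0" "{a, b, c, d, e, f} \<subseteq> \<rat>"
  shows "\<exists>a' b' e' f'. {a', b', e', f'} \<subseteq> \<rat> \<and> quad_res 0 a' b' 1 e' f' \<noteq> 0 \<and>
    conjugate_over Qbar (quad a b c d e f) (quad 0 a' b' 1 e' f')"
proof (cases "d = 0")
  case False
  then show ?thesis by (rule conjugate_quad_denominator[OF assms])
next
  case d: True
  obtain x0 where x0: "x0 \<in> \<rat>" "a * x0^2 + b * x0 + c - x0 * (e * x0 + f) \<noteq> 0"
  proof -
    \<comment> \<open>A fixed point equation of degree at most 2 with three zeros vanishes
      identically; numerator and denominator then have a common zero.\<close>
    have "\<exists>x0 \<in> {0, 1, -1}. a * x0^2 + b * x0 + c - x0 * (e * x0 + f) \<noteq> 0"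
    proof (rule ccontr)
      assume "\<not> ?thesis"
      then have *: "c = 0" "a + b = e + f" "a + f = b + e" by (auto simp: algebra_simps)
      have "2 * (a - e) = 0" "2 * (b - f) = 0" using *(2,3) by algebra+
      then have "a = e" "b = f" by simp_all
      moreover note *
      ultimately show False using assms(1) d by (simp add: quad_res_def power2_eq_square algebra_simps)
    qed
    then obtain x where "x \<in> {0, 1, -1}" "a * x^2 + b * x + c - x * (e * x + f) \<noteq> 0" ..
    moreover from this have "x \<in> \<rat>" by auto
    ultimately show ?thesis by (intro that)
  qed
  let ?a = "e * x0 + f" and ?b = "e"
  let ?d = "a * x0^2 + b * x0 + c - x0 * (e * x0 + f)" and ?e = "2 * a * x0 + b - x0 * e"
  have "quad_res ?a ?b 0 ?d ?e a = quad_res a b c d e f"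
    unfolding quad_res_def d by algebra
  moreover have "{?a, ?b, 0, ?d, ?e, a} \<subseteq> \<rat>"
    using assms(2) x0(1) by (auto intro!: Rats_add Rats_mult Rats_diff Rats_power)
  ultimately obtain a' b' e' f' where *: "{a', b', e', f'} \<subseteq> \<rat>" "quad_res 0 a' b' 1 e' f' \<noteq> 0"
    "conjugate_over Qbar (quad ?a ?b 0 ?d ?e a) (quad 0 a' b' 1 e' f')"
    using conjugate_quad_denominator[of ?a ?b 0 ?d ?e a] assms(1) x0(2) by metis
  have "conjugate_over Qbar (quad a b c d e f) (quad ?a ?b 0 ?d ?e a)"
  proof (rule conjugate_quadI[where \<alpha> = 0 and \<beta> = 1 and \<gamma> = 1 and \<delta> = "- x0" and k = 1])
    show "{0, 1, 1, - x0} \<subseteq> Qbar" using x0 by (auto intro!: Qbar_intros Qbar_Rats)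
  qed (use assms(1) in simp, simp, simp, unfold d, algebra+)
  from conjugate_trans[OF this *(3)] *(1,2) show ?thesis by (intro exI conjI)
qed

theorem rational_has_invariants:
  assumes "rational_map \<rat> 2 \<phi>"
  obtains s2 s3 where "s2 \<in> \<rat>" "s3 \<in> \<rat>" "has_invariants \<phi> s2 s3"
proof -
  obtain a b c d e f where *: "{a, b, c, d, e, f} \<subseteq> \<rat>" "quad_res a b c d e f \<noteq> 0" "\<phi> = quad a b c d e f"
    using assms rational_map_2_iff[of \<rat> \<phi>] by auto
  obtain a' b' e' f' where 1: "{a', b', e', f'} \<subseteq> \<rat>" "quad_res 0 a' b' 1 e' f' \<noteq> 0"
    "conjugate_over Qbar \<phi> (quad 0 a' b' 1 e' f')"
    using conjugate_rational_quad[OF *(2,1)] *(3) by blast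
  let ?R = "quad_res 0 a' b' 1 e' f'"
  let ?s2 = "(4*f'^3 - e'^2*f'^2 + 10*b'*e'*f' - 2*b'*e'^3 + 12*b'^2 - 4*a'*f'^2
               - 7*a'*b'*e' + 5*a'^2*f' - a'^2*e'^2 - 2*a'^3) / ?R"
  let ?s3 = "(b'*e'^3 - 4*b'*e'*f' - 8*b'^2 + 4*a'*f'^2 - a'*e'^2*f' + 6*a'*b'*e'
               - 4*a'^2*f' + a'^3) / ?R"
  have "?R \<in> \<rat>" using 1(1) by (auto simp: quad_res_def intro!: Rats_add Rats_mult Rats_diff Rats_power)
  then have "?s2 \<in> \<rat>" "?s3 \<in> \<rat>"
    using 1(1) by (auto intro!: Rats_add Rats_mult Rats_diff Rats_power Rats_divide)
  moreover have "has_invariants (quad 0 a' b' 1 e' f') ?s2 ?s3"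
    using 1 by (intro has_invariants_quad) auto
  ultimately show ?thesis using that 1(3) has_invariants_conjugate by blast
qed

text \<open>The three roots have product \<open>s3\<close> and sum \<open>s3 + 2\<close>, so not all
  of them vanish. A nonzero one gives a normal form common to both maps.\<close>

lemma conjugate_same_invariants:
  assumes "has_invariants \<phi> s2 s3" "has_invariants \<psi> s2 s3"
  shows "conjugate_over Qbar \<phi> \<psi>"
proof -
  obtain u v w where uvw: "\<And>z. z^3 + (- (s3 + 2)) * z^2 + s2 * z + (- s3) = (z - u) * (z - v) * (z - w)"
    "- (s3 + 2) = - (u + v + w)" "s2 = u * v + u * w + v * w" "- s3 = - (u * v * w)"
    using cubic_splits[of "- (s3 + 2)" s2 "- s3"] by blast
  have "\<not> (u = 0 \<and> v = 0 \<and> w = 0)" using uvw by auto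
  then obtain \<kappa> where "\<kappa> \<noteq> 0" "\<kappa> = u \<or> \<kappa> = v \<or> \<kappa> = w" by blast
  moreover from this have "\<kappa>^3 + (- (s3 + 2)) * \<kappa>^2 + s2 * \<kappa> + (- s3) = 0" unfolding uvw(1) by auto
  then have "\<kappa>^3 - (s3 + 2) * \<kappa>^2 + s2 * \<kappa> - s3 = 0" by (simp add: algebra_simps)
  moreover have "(csqrt ((\<kappa> - 2)^2 - s3 * \<kappa>))^2 = (\<kappa> - 2)^2 - s3 * \<kappa>" by simp
  ultimately show ?thesis
    using assms conjugate_sym conjugate_trans unfolding has_invariants_def by blast
qed

subsection \<open>Dynamics of the normal form\<close>

lemma Phi_simps:
  assumes "\<mu> \<noteq> 0"
  shows "Phi \<mu> \<beta> Infty = Infty" "Phi \<mu> \<beta> (Fin 0) = Infty"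
    "z \<noteq> 0 \<Longrightarrow> Phi \<mu> \<beta> (Fin z) = Fin (\<mu> * (z + 1 / z + \<beta>))"
proof -
  show "Phi \<mu> \<beta> Infty = Infty" "Phi \<mu> \<beta> (Fin 0) = Infty" using assms by (simp_all add: Phi_def quad_def proj_def)
  assume "z \<noteq> 0"
  then have "Phi \<mu> \<beta> (Fin z) = Fin ((\<mu> * z^2 + \<mu> * \<beta> * z + \<mu>) / z)"
    by (simp add: Phi_def quad_def proj_def)
  also have "(\<mu> * z^2 + \<mu> * \<beta> * z + \<mu>) / z = \<mu> * (z + 1 / z + \<beta>)"
    using \<open>z \<noteq> 0\<close> by (simp add: power2_eq_square add_divide_distrib distrib_left)
  finally show "Phi \<mu> \<beta> (Fin z) = Fin (\<mu> * (z + 1 / z + \<beta>))" .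
qed

text \<open>The fibers are the orbits of \<open>z -> 1 / z\<close>, which exchanges 0 and infinity
  and fixes only 1 and -1.\<close>

lemma crit_Phi:
  assumes "\<mu> \<noteq> 0"
  shows "crit (Phi \<mu> \<beta>) P \<longleftrightarrow> P = Fin 1 \<or> P = Fin (- 1)"
proof -
  have eq: "Phi \<mu> \<beta> (Fin w) = Phi \<mu> \<beta> (Fin z) \<longleftrightarrow> w = z \<or> w * z = 1" if "w \<noteq> 0" "z \<noteq> 0" for w z
  proof -
    have "w + 1 / w - (z + 1 / z) = (w - z) * (w * z - 1) / (w * z)"
      using that by (simp add: field_simps)
    then have "w + 1 / w = z + 1 / z \<longleftrightarrow> w = z \<or> w * z = 1"
      using that by (metis divide_eq_0_iff eq_iff_diff_eq_0 mult_eq_0_iff)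
    then show ?thesis using that assms by (simp add: Phi_simps)
  qed
  show ?thesis
  proof (cases P)
    case Infty
    then have "\<not> crit (Phi \<mu> \<beta>) P"
      using assms Phi_simps(1,2) unfolding crit_def by (metis P1.distinct(1))
    then show ?thesis using Infty by simp
  next
    case (Fin z)
    show ?thesis
    proof (cases "z = 0")
      case True
      then have "\<not> crit (Phi \<mu> \<beta>) P"
        using assms Phi_simps(1,2) Fin unfolding crit_def by (metis P1.distinct(1))
      then show ?thesis using Fin True by simp
    next
      case False
      have "crit (Phi \<mu> \<beta>) (Fin z) \<longleftrightarrow> (\<forall>w. w \<noteq> 0 \<longrightarrow> w = z \<or> w * z = 1 \<longrightarrow> w = z)"
      proof
        assume *: "crit (Phi \<mu> \<beta>) (Fin z)"
        show "\<forall>w. w \<noteq> 0 \<longrightarrow> w = z \<or> w * z = 1 \<longrightarrow> w = z"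
          using * eq[OF _ False] unfolding crit_def by (metis P1.inject)
      next
        assume *: "\<forall>w. w \<noteq> 0 \<longrightarrow> w = z \<or> w * z = 1 \<longrightarrow> w = z"
        show "crit (Phi \<mu> \<beta>) (Fin z)"
          unfolding crit_def
        proof (intro allI impI)
          fix Q assume Q: "Phi \<mu> \<beta> Q = Phi \<mu> \<beta> (Fin z)"
          have "Phi \<mu> \<beta> (Fin z) \<noteq> Infty" using assms False by (simp add: Phi_simps)
          then obtain w where "Q = Fin w" "w \<noteq> 0"
            using Q assms Phi_simps(1,2) by (cases Q) fastforce+
          then show "Q = Fin z" using * Q eq[OF _ False] by blast
        qed
      qed
      also have "\<dots> \<longleftrightarrow> z^2 = 1"
      proof
        assume "\<forall>w. w \<noteq> 0 \<longrightarrow> w = z \<or> w * z = 1 \<longrightarrow> w = z"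
        from this[rule_format, of "1 / z"] False show "z^2 = 1" by (simp add: power2_eq_square field_simps)
      next
        assume "z^2 = 1"
        then have "w = z" if "w * z = 1" for w using that by algebra
        then show "\<forall>w. w \<noteq> 0 \<longrightarrow> w = z \<or> w * z = 1 \<longrightarrow> w = z" by blast
      qed
      also have "\<dots> \<longleftrightarrow> z = 1 \<or> z = - 1" by (rule power2_eq_1_iff)
      finally show ?thesis using Fin by simp
    qed
  qed
qed

text \<open>This follows the map only as long as 0 is avoided: here \<open>1 / 0 = 0\<close>,
  whereas the map sends 0 to infinity.\<close>

fun Phi_orbit :: "complex \<Rightarrow> complex \<Rightarrow> complex \<Rightarrow> nat \<Rightarrow> complex" where
  "Phi_orbit \<mu> \<beta> z 0 = z"
| "Phi_orbit \<mu> \<beta> z (Suc n) = \<mu> * (Phi_orbit \<mu> \<beta> z n + 1 / Phi_orbit \<mu> \<beta> z n + \<beta>)"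

lemma Phi_funpow:
  assumes "\<mu> \<noteq> 0" "\<And>k. k < n \<Longrightarrow> Phi_orbit \<mu> \<beta> z k \<noteq> 0"
  shows "(Phi \<mu> \<beta> ^^ n) (Fin z) = Fin (Phi_orbit \<mu> \<beta> z n)"
  using assms(2)
proof (induction n)
  case (Suc n)
  then show ?case using Phi_simps(3)[OF assms(1)] by simp
qed simp

lemma Phi_orbit_eq_collision:
  assumes "fin_crit (Phi \<mu> \<beta>)" "\<mu> \<noteq> 0" "z = 1 \<or> z = - 1" "\<And>k. Phi_orbit \<mu> \<beta> z k \<noteq> 0"
  obtains i j where "i < j" "Phi_orbit \<mu> \<beta> z i = Phi_orbit \<mu> \<beta> z j"
proof -
  have "finite (range (\<lambda>n. (Phi \<mu> \<beta> ^^ n) (Fin z)))"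
    using assms by (auto simp: fin_crit_def crit_Phi)
  then have "\<not> inj (\<lambda>n. (Phi \<mu> \<beta> ^^ n) (Fin z))"
    using finite_imageD infinite_UNIV_nat by blast
  then obtain i j where "i \<noteq> j" "(Phi \<mu> \<beta> ^^ i) (Fin z) = (Phi \<mu> \<beta> ^^ j) (Fin z)"
    by (auto simp: inj_on_def)
  then have "i \<noteq> j" "Phi_orbit \<mu> \<beta> z i = Phi_orbit \<mu> \<beta> z j"
    using Phi_funpow[OF assms(2,4)] by simp_all
  then show ?thesis using that[of i j] that[of j i] by (metis linorder_neqE_nat)
qed

subsection \<open>Valuation rings of the complex numbers above a prime\<close>

definition complex_subring :: "complex set \<Rightarrow> bool" where
  "complex_subring R \<longleftrightarrow> 1 \<in> R \<and> (\<forall>x\<in>R. \<forall>y\<in>R. x + y \<in> R \<and> x * y \<in> R) \<and> (\<forall>x\<in>R. - x \<in> R)"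

lemma complex_subringD:
  assumes "complex_subring R"
  shows "1 \<in> R" "0 \<in> R" "x \<in> R \<Longrightarrow> y \<in> R \<Longrightarrow> x + y \<in> R" "x \<in> R \<Longrightarrow> y \<in> R \<Longrightarrow> x * y \<in> R"
    "x \<in> R \<Longrightarrow> - x \<in> R" "x \<in> R \<Longrightarrow> y \<in> R \<Longrightarrow> x - y \<in> R" "of_nat n \<in> R" "x \<in> R \<Longrightarrow> x ^ n \<in> R" "of_int k \<in> R"
proof -
  show one: "1 \<in> R" and add: "x \<in> R \<Longrightarrow> y \<in> R \<Longrightarrow> x + y \<in> R" and mult: "x \<in> R \<Longrightarrow> y \<in> R \<Longrightarrow> x * y \<in> R"
    and minus: "x \<in> R \<Longrightarrow> - x \<in> R" for x y
    using assms by (auto simp: complex_subring_def)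
  show zero: "0 \<in> R" using add[OF one minus[OF one]] by simp
  show "x \<in> R \<Longrightarrow> y \<in> R \<Longrightarrow> x - y \<in> R" using add[of x "- y"] minus by simp
  show nat: "of_nat n \<in> R" for n by (induction n) (auto intro: zero one add)
  show "x \<in> R \<Longrightarrow> x ^ n \<in> R" by (induction n) (auto intro: one mult)
  show "of_int k \<in> R" by (cases k) (auto intro: minus nat simp flip: of_nat_Suc)
qed

definition adjoin :: "complex set \<Rightarrow> complex \<Rightarrow> complex set" where
  "adjoin R x = {poly q x |q. \<forall>i. coeff q i \<in> R}"

lemma adjoin_subring:
  assumes R: "complex_subring R"
  shows "complex_subring (adjoin R x)" "R \<subseteq> adjoin R x" "x \<in> adjoin R x"
proof -
  have "poly p x + poly q x \<in> adjoin R x" "poly p x * poly q x \<in> adjoin R x" "- poly p x \<in> adjoin R x"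
    if "\<forall>i. coeff p i \<in> R" "\<forall>i. coeff q i \<in> R" for p q
  proof -
    have "coeff (p + q) i \<in> R" "coeff (- p) i \<in> R" for i
      using that complex_subringD[OF R] by auto
    moreover have "coeff (p * q) i \<in> R" for i
    proof -
      have "(\<Sum>k\<in>A. coeff p k * coeff q (i - k)) \<in> R" if "finite A" for A :: "nat set"
        using that \<open>\<forall>i. coeff p i \<in> R\<close> \<open>\<forall>i. coeff q i \<in> R\<close>
        by (induction A rule: finite_induct) (auto intro!: complex_subringD[OF R])
      then show ?thesis by (simp add: coeff_mult)
    qed
    ultimately have "poly (p + q) x \<in> adjoin R x" "poly (p * q) x \<in> adjoin R x" "poly (- p) x \<in> adjoin R x"
      unfolding adjoin_def by blast+
    then show "poly p x + poly q x \<in> adjoin R x" "poly p x * poly q x \<in> adjoin R x" "- poly p x \<in> adjoin R x"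
      by simp_all
  qed
  moreover have const: "c \<in> adjoin R x" if "c \<in> R" for c
    unfolding adjoin_def mem_Collect_eq
    using that complex_subringD(2)[OF R] by (intro exI[of _ "[:c:]"]) (auto simp: coeff_pCons split: nat.splits)
  ultimately show "complex_subring (adjoin R x)"
    using complex_subringD(1)[OF R] unfolding complex_subring_def adjoin_def by blast
  show "R \<subseteq> adjoin R x" using const by blast
  show "x \<in> adjoin R x"
    unfolding adjoin_def mem_Collect_eq
    using complex_subringD(1,2)[OF R] by (intro exI[of _ "[:0, 1:]"]) (auto simp: coeff_pCons split: nat.splits)
qed

text \<open>The descent in Chevalley's extension theorem.\<close>

lemma adjoin_descent:
  fixes q r :: "complex poly"
  assumes R: "complex_subring R" and x: "x \<noteq> 0"
    and q: "\<And>i. coeff q i \<in> R" "poly q x = 1 / of_nat p"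
    and r: "\<And>i. coeff r i \<in> R" "poly r (1 / x) = 1 / of_nat p"
    and deg: "degree r \<le> degree q" "0 < degree q" and p: "p > 0"
  obtains q' where "\<And>i. coeff q' i \<in> R" "poly q' x = 1 / of_nat p" "degree q' < degree q"
proof -
  define n m where "n = degree q" and "m = degree r"
  define c where "c = 1 - of_nat p * coeff r 0"
  have c: "c \<in> R" unfolding c_def by (intro complex_subringD[OF R] r(1))
  define s where "s = (\<Sum>j=1..m. monom (coeff r j) (n - j))"
  \<comment> \<open>The relation \<open>r\<close>, multiplied by \<open>x ^ n\<close>, says that
    \<open>c * x ^ n\<close> equals \<open>p\<close> times the value of \<open>s\<close>, whose
    degree is below \<open>n\<close>. In \<open>c * q\<close> the top term is replaced accordingly;
    adding \<open>coeff r 0\<close> restores the value, as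
    \<open>coeff r 0 + c / p = 1 / p\<close>.\<close>
  define q' where "q' = [:coeff r 0:] + smult c (q - monom (coeff q n) n) + smult (coeff q n * of_nat p) s"
  have sR: "coeff s i \<in> R" for i
  proof -
    have "(\<Sum>j\<in>A. coeff (monom (coeff r j) (n - j)) i) \<in> R" if "finite A" for A
      using that r(1) complex_subringD(2,3)[OF R] by (induction A rule: finite_induct) auto
    then show ?thesis by (simp add: s_def coeff_sum)
  qed
  have "coeff q' i \<in> R" for i
  proof -
    have "coeff [:coeff r 0:] i \<in> R" "(if n = i then coeff q n else 0) \<in> R"
      using q(1) r(1) complex_subringD(2)[OF R] by (auto simp: coeff_pCons split: nat.splits)
    then show ?thesis
      unfolding q'_def coeff_add coeff_smult coeff_diff coeff_monom
      by (intro complex_subringD(3,4,6,7)[OF R] q(1) c sR)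
  qed
  moreover have "degree q' < n"
  proof -
    have "coeff s i = 0" if "i \<ge> n" for i
      using that deg(2) by (auto simp: s_def coeff_sum n_def intro!: sum.neutral)
    then have "coeff q' i = 0" if "i \<ge> n" for i
      using that deg(2) by (cases "i = n") (auto simp: q'_def coeff_pCons n_def coeff_eq_0 split: nat.splits)
    then show ?thesis using deg(2) by (metis le_degree leading_coeff_0_iff n_def not_le degree_0)
  qed
  moreover have "poly q' x = 1 / of_nat p"
  proof -
    have "x ^ n / of_nat p = x ^ n * (\<Sum>j\<le>m. coeff r j * (1 / x) ^ j)"
      using r(2) by (simp add: poly_altdef m_def)
    also have "\<dots> = (\<Sum>j\<le>m. coeff r j * x ^ (n - j))"
      using x deg(1) by (auto simp: sum_distrib_left n_def m_def power_diff field_simps intro!: sum.cong)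
    also have "\<dots> = coeff r 0 * x ^ n + poly s x"
      by (simp add: s_def poly_sum poly_monom sum.atMost_shift sum.atLeast1_atMost_eq)
    finally have "of_nat p * (x ^ n / of_nat p) = of_nat p * (coeff r 0 * x ^ n + poly s x)" by simp
    then have s: "x ^ n * c = of_nat p * poly s x"
      using p by (simp add: c_def algebra_simps)
    have "poly q' x = coeff r 0 + c * (1 / of_nat p - coeff q n * x ^ n) + coeff q n * (of_nat p * poly s x)"
      by (simp add: q'_def q(2) poly_monom mult.assoc)
    also have "\<dots> = coeff r 0 + c / of_nat p" by (simp add: algebra_simps flip: s)
    also have "\<dots> = 1 / of_nat p" using p by (simp add: c_def field_simps)
    finally show ?thesis .
  qed
  ultimately show ?thesis using that n_def by blast
qed

text \<open>A valuation is given by its ring alone, and sizes are compared through quotients. Since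
  \<open>V\<close> lives in the whole of C, all roots of all polynomials are measured at
  once.\<close>

locale valuation_ring =
  fixes V :: "complex set" and p :: nat
  assumes subring: "complex_subring V"
    and total: "x \<in> V \<or> 1 / x \<in> V"
    and p_nonunit: "1 / of_nat p \<notin> V"

text \<open>Zorn's lemma gives a subring maximal among those without \<open>1 / p\<close>. If it
  contained neither \<open>x\<close> nor \<open>1 / x\<close>, adjoining either would produce
  \<open>1 / p\<close>, and two such expressions of least degree contradict the descent.\<close>

lemma valuation_ring_exists:
  assumes "p \<ge> 2"
  obtains V where "valuation_ring V p"
proof -
  define A where "A = {R. complex_subring R \<and> 1 / of_nat p \<notin> R}"
  have "1 / of_nat p \<notin> (\<int> :: complex set)"
  proof
    assume "1 / of_nat p \<in> (\<int> :: complex set)"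
    then obtain k where "1 / of_nat p = (of_int k :: complex)" by (auto elim: Ints_cases)
    then have "(1 :: complex) = of_int (k * int p)" using assms by (simp add: field_simps)
    then have "k * int p = 1" by (metis of_int_eq_1_iff)
    then have "int p dvd 1" by (metis dvd_triv_right)
    then show False using assms by simp
  qed
  then have "\<int> \<in> A" by (auto simp: A_def complex_subring_def)
  moreover have "\<Union> C \<in> A" if "C \<noteq> {}" "subset.chain A C" for C
  proof -
    have C: "R \<in> A" if "R \<in> C" for R using that \<open>subset.chain A C\<close> by (auto simp: subset.chain_def)
    have two: "\<exists>R\<in>C. x \<in> R \<and> y \<in> R" if "x \<in> \<Union> C" "y \<in> \<Union> C" for x y
      using that \<open>subset.chain A C\<close> unfolding subset.chain_def by blast
    have "complex_subring (\<Union> C)"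
      unfolding complex_subring_def
    proof (intro conjI ballI)
      show "1 \<in> \<Union> C" using \<open>C \<noteq> {}\<close> C complex_subringD(1) by (auto simp: A_def)
    next
      fix x y assume "x \<in> \<Union> C" "y \<in> \<Union> C"
      then obtain R where R: "R \<in> C" "x \<in> R" "y \<in> R" using two by blast
      then have "complex_subring R" using C by (simp add: A_def)
      then have "x + y \<in> R" "x * y \<in> R" using R(2,3) by (simp_all add: complex_subringD(3,4))
      then show "x + y \<in> \<Union> C" "x * y \<in> \<Union> C" using R(1) by blast+
    next
      fix x assume "x \<in> \<Union> C"
      then obtain R where R: "R \<in> C" "x \<in> R" by blast
      then have "complex_subring R" using C by (simp add: A_def)
      then have "- x \<in> R" using R(2) by (simp add: complex_subringD(5))
      then show "- x \<in> \<Union> C" using R(1) by blast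
    qed
    moreover have "1 / of_nat p \<notin> \<Union> C" using C by (auto simp: A_def)
    ultimately show ?thesis by (simp add: A_def)
  qed
  ultimately obtain V where V: "V \<in> A" "\<And>X. X \<in> A \<Longrightarrow> V \<subseteq> X \<Longrightarrow> X = V"
    using subset_Zorn_nonempty[of A] by blast
  then have sub: "complex_subring V" and np: "1 / of_nat p \<notin> V" by (auto simp: A_def)
  have "x \<in> V \<or> 1 / x \<in> V" for x
  proof (rule ccontr)
    assume *: "\<not> (x \<in> V \<or> 1 / x \<in> V)"
    then have "x \<noteq> 0" using complex_subringD(2)[OF sub] by auto
    define P where "P y n \<longleftrightarrow> (\<exists>q. (\<forall>i. coeff q i \<in> V) \<and> poly q y = 1 / of_nat p \<and> degree q = n)" for y n
    have ex: "\<exists>n. P y n" if "y \<notin> V" for y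
    proof -
      have "adjoin V y \<notin> A" using V(2)[of "adjoin V y"] adjoin_subring[OF sub] that by blast
      then have "1 / of_nat p \<in> adjoin V y" using adjoin_subring[OF sub] by (auto simp: A_def)
      then show ?thesis by (auto simp: adjoin_def P_def)
    qed
    define n m where "n = (LEAST n. P x n)" and "m = (LEAST n. P (1 / x) n)"
    have n: "P x n" "\<And>k. P x k \<Longrightarrow> n \<le> k" using ex[of x] * by (auto simp: n_def intro: LeastI_ex Least_le)
    have m: "P (1 / x) m" "\<And>k. P (1 / x) k \<Longrightarrow> m \<le> k" using ex[of "1 / x"] * by (auto simp: m_def intro: LeastI_ex Least_le)
    \<comment> \<open>An expression of degree 0 would put \<open>1 / p\<close> into
      \<open>V\<close>; the descent requires a positive degree.\<close>
    have pos: "k > 0" if "P y k" for y k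
    proof (rule ccontr)
      assume "\<not> k > 0"
      moreover obtain q where q: "\<forall>i. coeff q i \<in> V" "poly q y = 1 / of_nat p" "degree q = k"
        using \<open>P y k\<close> unfolding P_def by blast
      ultimately have "degree q = 0" by simp
      then have "poly q y = coeff q 0" by (metis degree_eq_zeroE poly_const_conv coeff_pCons_0)
      then show False using q np by metis
    qed
    obtain q where q: "\<And>i. coeff q i \<in> V" "poly q x = 1 / of_nat p" "degree q = n" using n(1) by (auto simp: P_def)
    obtain r where r: "\<And>i. coeff r i \<in> V" "poly r (1 / x) = 1 / of_nat p" "degree r = m" using m(1) by (auto simp: P_def)
    show False
    proof (cases "m \<le> n")
      case True
      obtain q' where "\<And>i. coeff q' i \<in> V" "poly q' x = 1 / of_nat p" "degree q' < degree q"
        using adjoin_descent[OF sub \<open>x \<noteq> 0\<close> q(1,2) r(1,2)] True q(3) r(3) pos[OF n(1)] assms by auto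
      then show False using n(2)[of "degree q'"] q(3) by (auto simp: P_def)
    next
      case False
      have "1 / x \<noteq> 0" "poly q (1 / (1 / x)) = 1 / of_nat p" using \<open>x \<noteq> 0\<close> q by auto
      then obtain q' where "\<And>i. coeff q' i \<in> V" "poly q' (1 / x) = 1 / of_nat p" "degree q' < degree r"
        using adjoin_descent[OF sub _ r(1,2) q(1)] False q(3) r(3) pos[OF m(1)] assms by auto
      then show False using m(2)[of "degree q'"] r(3) by (auto simp: P_def)
    qed
  qed
  then have "valuation_ring V p" using sub np by unfold_locales auto
  then show ?thesis using that by blast
qed

section \<open>Arithmetic of the maximal ideal\<close>

context valuation_ring
begin

lemmas V_closed = complex_subringD[OF subring]

definition M :: "complex set" where
  "M = {x \<in> V. x = 0 \<or> 1 / x \<notin> V}"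

lemma M_subset_V: "x \<in> M \<Longrightarrow> x \<in> V"
  by (simp add: M_def)

lemma inverse_in_M: "x \<notin> V \<Longrightarrow> 1 / x \<in> M"
  using total[of x] by (auto simp: M_def)

lemma unitD: "x \<in> V \<Longrightarrow> x \<notin> M \<Longrightarrow> x \<noteq> 0 \<and> 1 / x \<in> V"
  by (auto simp: M_def)

lemma one_notin_M: "1 \<notin> M"
  using V_closed(1) by (simp add: M_def)

lemma zero_in_M: "0 \<in> M"
  using V_closed(2) by (simp add: M_def)

lemma M_mult: "x \<in> M \<Longrightarrow> y \<in> V \<Longrightarrow> x * y \<in> M"
  using V_closed(4)[of y "1 / (x * y)"] V_closed(4)[of x y] by (auto simp: M_def)

lemma M_mult': "x \<in> V \<Longrightarrow> y \<in> M \<Longrightarrow> x * y \<in> M"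
  using M_mult[of y x] by (simp add: mult.commute)

text \<open>Divisibility in \<open>V\<close> is total, so one summand is a multiple of the
  other.\<close>

lemma M_add:
  assumes "x \<in> M" "y \<in> M"
  shows "x + y \<in> M"
proof -
  have *: "x + y \<in> M" if "x \<in> M" "y \<in> M" "x / y \<in> V" for x y
  proof (cases "y = 0")
    case False
    then have "x + y = y * (1 + x / y)" by (simp add: field_simps)
    then show ?thesis using that M_mult[of y "1 + x / y"] V_closed(1,3) by simp
  qed (use that in simp)
  have "x / y \<in> V \<or> y / x \<in> V" using total[of "x / y"] by simp
  then show ?thesis using *[of x y] *[of y x] assms by (auto simp: add.commute)
qed

lemma M_minus: "x \<in> M \<Longrightarrow> - x \<in> M"
  using M_mult[of x "- 1"] V_closed(1,5) by simp

lemma M_diff: "x \<in> M \<Longrightarrow> y \<in> M \<Longrightarrow> x - y \<in> M"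
  using M_add[of x "- y"] M_minus by simp

lemma M_prime: "x \<in> V \<Longrightarrow> y \<in> V \<Longrightarrow> x * y \<in> M \<Longrightarrow> x \<in> M \<or> y \<in> M"
  using V_closed(4)[of "1 / x" "1 / y"] by (auto simp: M_def)

lemma one_plus_M: "x \<in> M \<Longrightarrow> 1 + x \<in> V \<and> 1 + x \<notin> M"
  using M_diff[of "1 + x" x] one_notin_M V_closed(1,3) M_subset_V by auto

lemma unit_cong: "x - y \<in> M \<Longrightarrow> x \<notin> M \<Longrightarrow> y \<notin> M"
  using M_add[of "x - y" y] by auto

lemma notin_V_mult: "x \<notin> V \<Longrightarrow> y \<in> V \<Longrightarrow> y \<notin> M \<Longrightarrow> x * y \<notin> V"
  using unitD[of y] V_closed(4)[of "x * y" "1 / y"] by auto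

lemma notin_V_mult': "x \<notin> V \<Longrightarrow> y \<notin> V \<Longrightarrow> x * y \<notin> V"
  using inverse_in_M[of y] M_subset_V[of "1 / y"] V_closed(4)[of "x * y" "1 / y"] V_closed(2)
  by (cases "y = 0") auto

lemma p_in_M: "of_nat p \<in> M"
  using p_nonunit V_closed(7) by (auto simp: M_def)

lemma of_int_in_M_iff:
  assumes "prime p"
  shows "of_int k \<in> M \<longleftrightarrow> int p dvd k"
proof
  assume "int p dvd k"
  then obtain l where "k = int p * l" by blast
  then show "of_int k \<in> M" using M_mult[OF p_in_M V_closed(9)] by simp
next
  assume k: "of_int k \<in> M"
  show "int p dvd k"
  proof (rule ccontr)
    assume "\<not> int p dvd k"
    then have "coprime (int p) k" using assms by (simp add: prime_imp_coprime)
    then obtain u v where "u * int p + v * k = 1" using bezout_int[of "int p" k] by auto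
    then have "(1 :: complex) = of_int u * of_nat p + of_int v * of_int k"
      by (metis of_int_1 of_int_add of_int_mult of_int_of_nat_eq)
    moreover have "of_int u * of_nat p + of_int v * of_int k \<in> M"
      by (intro M_add M_mult' V_closed(9) p_in_M k)
    ultimately show False using one_notin_M by simp
  qed
qed

text \<open>Far out, and beyond the size of \<beta>, the map multiplies \<open>z\<close> by \<mu>
  times the unit \<open>1 + 1 / z^2 + \<beta> / z\<close>. So every step enlarges the point by a
  factor outside \<open>V\<close> and preserves both conditions.\<close>

lemma Phi_escape:
  assumes "\<mu> \<notin> V" "z \<notin> V" "\<beta> / z \<in> M"
  shows "Phi_orbit \<mu> \<beta> z k \<notin> V \<and> \<beta> / Phi_orbit \<mu> \<beta> z k \<in> M \<and>
    Phi_orbit \<mu> \<beta> z (Suc k) / Phi_orbit \<mu> \<beta> z k \<notin> V"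
proof -
  have step: "\<mu> * (x + 1 / x + \<beta>) \<notin> V" "\<beta> / (\<mu> * (x + 1 / x + \<beta>)) \<in> M" "\<mu> * (x + 1 / x + \<beta>) / x \<notin> V"
    if x: "x \<notin> V" "\<beta> / x \<in> M" for x
  proof -
    define u where "u = 1 + ((1 / x)^2 + \<beta> / x)"
    have "x \<noteq> 0" using x V_closed(2) by auto
    have "(1 / x)^2 + \<beta> / x \<in> M"
      using M_add[OF M_mult[OF inverse_in_M[OF x(1)] M_subset_V[OF inverse_in_M[OF x(1)]]] x(2)]
      by (simp add: power2_eq_square)
    then have u: "u \<in> V" "u \<notin> M" using one_plus_M by (auto simp: u_def)
    have eq: "\<mu> * (x + 1 / x + \<beta>) = x * (\<mu> * u)"
      using \<open>x \<noteq> 0\<close> by (simp add: u_def field_simps power2_eq_square)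
    have mu: "\<mu> * u \<notin> V" using notin_V_mult[OF assms(1)] u by simp
    show "\<mu> * (x + 1 / x + \<beta>) / x \<notin> V" using mu \<open>x \<noteq> 0\<close> by (simp add: eq)
    show "\<mu> * (x + 1 / x + \<beta>) \<notin> V" using notin_V_mult'[OF x(1) mu] by (simp add: eq)
    show "\<beta> / (\<mu> * (x + 1 / x + \<beta>)) \<in> M"
      using M_mult[OF x(2) M_subset_V[OF inverse_in_M[OF mu]]] by (simp add: eq)
  qed
  have "Phi_orbit \<mu> \<beta> z k \<notin> V \<and> \<beta> / Phi_orbit \<mu> \<beta> z k \<in> M" for k
    using assms by (induction k) (auto dest: step)
  then show ?thesis using step(3) by auto
qed

text \<open>The growth factors multiply to a quotient outside \<open>V\<close>, which is therefore
  not 1.\<close>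

lemma Phi_escape_neq:
  assumes "\<mu> \<notin> V" "z \<notin> V" "\<beta> / z \<in> M" "i < j"
  shows "Phi_orbit \<mu> \<beta> z i \<noteq> Phi_orbit \<mu> \<beta> z j"
proof -
  let ?x = "Phi_orbit \<mu> \<beta> z"
  have x: "?x k \<notin> V" "?x (Suc k) / ?x k \<notin> V" for k using Phi_escape[OF assms(1-3), of k] by auto
  have nz: "?x k \<noteq> 0" for k using x(1)[of k] V_closed(2) by auto
  have "?x (i + Suc n) / ?x i \<notin> V" for n
  proof (induction n)
    case (Suc n)
    then show ?case using notin_V_mult'[OF Suc x(2)[of "i + Suc n"]] nz by (simp del: Phi_orbit.simps(2))
  qed (use x in simp)
  from this[of "j - Suc i"] have "?x j / ?x i \<notin> V" using assms(4) by simp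
  then show ?thesis using nz V_closed(1) by (metis divide_self)
qed

text \<open>One critical value is large enough to escape. If \<beta> is in \<open>V\<close>, the
  critical values differ by \<open>4 * \<mu>\<close>, so they are not both in \<open>V\<close>. If
  \<beta> is not in \<open>V\<close>, it dominates 2, and \<open>\<mu> * (2 + \<beta>)\<close> is
  \<beta> times a number outside \<open>V\<close>.\<close>

theorem four_multiplier_inverse_in_V:
  assumes "fin_crit (Phi \<mu> \<beta>)" "\<mu> \<noteq> 0"
  shows "4 * \<mu> \<in> V"
proof (rule ccontr)
  assume notin: "4 * \<mu> \<notin> V"
  have two: "2 \<in> V" and four: "4 \<in> V" using V_closed(7)[of 2] V_closed(7)[of 4] by simp_all
  have mu: "\<mu> \<notin> V" using notin V_closed(4)[OF four] by blast
  obtain c where c: "c = 1 \<or> c = - 1" and z: "\<mu> * (2 * c + \<beta>) \<notin> V" "\<beta> / (\<mu> * (2 * c + \<beta>)) \<in> M"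
  proof (cases "\<beta> \<in> V")
    case True
    have "4 * \<mu> = \<mu> * (2 * 1 + \<beta>) - \<mu> * (2 * (- 1) + \<beta>)" by (simp add: algebra_simps)
    then obtain c where "c = 1 \<or> c = - 1" "\<mu> * (2 * c + \<beta>) \<notin> V"
      using notin V_closed(6) by metis
    moreover from this(2) have "\<beta> / (\<mu> * (2 * c + \<beta>)) \<in> M"
      using M_mult'[OF True inverse_in_M] by simp
    ultimately show ?thesis using that by blast
  next
    case False
    define u where "u = 1 + 2 * (1 / \<beta>)"
    have u: "u \<in> V" "u \<notin> M" using one_plus_M[OF M_mult'[OF two inverse_in_M[OF False]]] by (auto simp: u_def)
    have "\<beta> \<noteq> 0" using False V_closed(2) by auto
    then have eq: "\<mu> * (2 * 1 + \<beta>) = \<beta> * (\<mu> * u)" by (simp add: u_def field_simps)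
    have m: "\<mu> * u \<notin> V" using notin_V_mult[OF mu] u by simp
    show ?thesis
    proof (rule that[of 1])
      show "\<mu> * (2 * 1 + \<beta>) \<notin> V" unfolding eq using notin_V_mult'[OF False m] .
      show "\<beta> / (\<mu> * (2 * 1 + \<beta>)) \<in> M" unfolding eq using inverse_in_M[OF m] \<open>\<beta> \<noteq> 0\<close> by simp
    qed simp
  qed
  \<comment> \<open>\<open>?y\<close> starts at the critical value, one step behind
    \<open>?x\<close>; the critical point \<open>c\<close> itself lies in \<open>V\<close> and is
    treated apart.\<close>
  let ?x = "Phi_orbit \<mu> \<beta> c" and ?y = "Phi_orbit \<mu> \<beta> (\<mu> * (2 * c + \<beta>))"
  have xy: "?x (Suc k) = ?y k" for k using c by (induction k) auto
  have y: "?y k \<notin> V" for k using Phi_escape[OF mu z] by blast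
  have nz: "?x k \<noteq> 0" for k
  proof (cases k)
    case (Suc n)
    then have "?x k = ?y n" using xy by metis
    then show ?thesis using y[of n] V_closed(2) by metis
  qed (use c in auto)
  obtain i j where ij: "i < j" "?x i = ?x j"
    using Phi_orbit_eq_collision[OF assms c nz] by blast
  then obtain j' where j: "j = Suc j'" by (cases j) auto
  show False
  proof (cases i)
    case 0
    then have "?y j' = c" using ij by (simp add: j xy del: Phi_orbit.simps(2))
    then show False using y[of j'] c V_closed(1,5) by auto
  next
    case (Suc i')
    then show False using ij Phi_escape_neq[OF mu z, of i' j'] by (simp add: j xy del: Phi_orbit.simps(2))
  qed
qed

end

text \<open>A prime dividing the denominator \<open>b\<close> would put \<open>b\<close>, and with
  it \<open>a = x * b\<close>, into the maximal ideal and so divide the numerator too.\<close>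

lemma Rats_integral:
  fixes x :: complex
  assumes "x \<in> \<rat>" "\<And>p V. prime p \<Longrightarrow> valuation_ring V p \<Longrightarrow> x \<in> V"
  obtains k where "x = of_int k"
proof -
  obtain q where q: "x = of_rat q" using assms(1) by (auto elim: Rats_cases)
  obtain a b where ab: "quotient_of q = (a, b)" by fastforce
  then have b: "b > 0" "coprime a b" "q = of_int a / of_int b"
    by (auto simp: quotient_of_denom_pos quotient_of_coprime quotient_of_div)
  have xb: "x * of_int b = of_int a" using b by (simp add: q of_rat_divide)
  have "b = 1"
  proof (rule ccontr)
    assume "b \<noteq> 1"
    then have "nat b \<noteq> 1" using b(1) by simp
    then obtain p where p: "prime p" "p dvd nat b" using prime_factor_nat by blast
    obtain V where "valuation_ring V p" using valuation_ring_exists[of p] p(1) prime_ge_2_nat by blast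
    then interpret valuation_ring V p .
    have "int p dvd b" using p(2) b(1) by (metis int_dvd_int_iff int_nat_eq less_imp_le)
    then have "of_int b \<in> M" using of_int_in_M_iff[OF p(1)] by blast
    then have "of_int a \<in> M" using M_mult'[OF assms(2)[OF p(1) \<open>valuation_ring V p\<close>]] xb by metis
    then have "int p dvd a" using of_int_in_M_iff[OF p(1)] by blast
    then show False using \<open>int p dvd b\<close> b(2) p(1)
      by (metis coprime_common_divisor not_prime_unit prime_int_nat_transfer prime_nat_int_transfer)
  qed
  then show ?thesis using that b by (simp add: q)
qed

subsection \<open>Attracting fixed points\<close>

text \<open>If \<open>|\<mu>| > 1\<close>, infinity is attracting.  All inverse branches of the iterates that fix infinity are
  defined on one disc around it and omit the two critical points, so Landau's theorem bounds their
  derivatives \<open>\<mu>\<^sup>n\<close>.\<close>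

theorem multiplier_inverse_norm_le_1:
  assumes fc: "fin_crit (Phi \<mu> \<beta>)" and \<mu>0: "\<mu> \<noteq> 0"
  shows "norm \<mu> \<le> 1"
proof (rule ccontr)
  assume "\<not> norm \<mu> \<le> 1"
  then have \<mu>: "norm \<mu> > 1" by simp
  \<comment> \<open>The coordinate \<open>u = 1 / z\<close> around infinity, in which the attracting
    fixed point is 0.\<close>
  define P :: "complex \<Rightarrow> complex P1" where "P u = (if u = 0 then Infty else Fin (1 / u))" for u
  define S where "S = (\<Union>c\<in>{1, - 1}. range (\<lambda>n. (Phi \<mu> \<beta> ^^ n) (Fin c)))"
  have S_step: "(Phi \<mu> \<beta> ^^ n) X \<in> S" if "X \<in> S" for X n
  proof -
    obtain c m where "c \<in> {1, - 1}" "X = (Phi \<mu> \<beta> ^^ m) (Fin c)" using \<open>X \<in> S\<close> by (auto simp: S_def)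
    then have "(Phi \<mu> \<beta> ^^ n) X = (Phi \<mu> \<beta> ^^ (n + m)) (Fin c)" by (simp add: funpow_add)
    then show ?thesis using \<open>c \<in> {1, - 1}\<close> unfolding S_def by blast
  qed
  have S_crit: "Fin c \<in> S" if "c = 1 \<or> c = - 1" for c
    using that unfolding S_def by (intro UN_I[of c] range_eqI[of _ _ 0]) auto
  have "finite S" using fc crit_Phi[OF \<mu>0] by (auto simp: S_def fin_crit_def)
  have inj: "inj P" by (auto simp: inj_on_def P_def split: if_splits)
  have "finite (P -` S)" using finite_vimageI[OF \<open>finite S\<close> inj] .
  then obtain \<rho> where \<rho>: "\<rho> > 0" "\<And>u. u \<in> P -` S \<Longrightarrow> u \<noteq> 0 \<Longrightarrow> \<rho> \<le> dist 0 u"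
    using finite_set_avoid[of "P -` S" 0] by auto
  have Fin_P: "P u = Fin (1 / u)" if "u \<noteq> 0" for u using that by (simp add: P_def)
  \<comment> \<open>In the coordinate at infinity the map is
    \<open>w = u / (\<mu> * (1 + \<beta> * u + u^2))\<close>, so that inverse branches have
    derivative \<mu> at 0.\<close>
  have lift: "Phi \<mu> \<beta> (P u) = P w" if rel: "u = w * \<mu> * (1 + \<beta> * u + u^2)" for u w
  proof (cases "u = 0")
    case True
    then show ?thesis using rel \<mu>0 Phi_simps(1)[OF \<mu>0] by (simp add: P_def)
  next
    case False
    then have nz: "w \<noteq> 0" "1 + \<beta> * u + u^2 \<noteq> 0" using rel by auto
    have "1 / u + 1 / (1 / u) + \<beta> = (1 + \<beta> * u + u^2) / u"
      using False by (simp add: field_simps power2_eq_square)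
    then have "Phi \<mu> \<beta> (P u) = Fin (\<mu> * ((1 + \<beta> * u + u^2) / u))"
      using False Phi_simps(3)[OF \<mu>0, of "1 / u"] by (simp add: P_def)
    also have "\<mu> * ((1 + \<beta> * u + u^2) / u) = 1 / w"
      using nz False rel by (simp add: field_simps)
    finally show ?thesis using nz(1) by (simp add: P_def)
  qed
  define H where "H n h \<longleftrightarrow> h holomorphic_on ball 0 \<rho> \<and> h 0 = 0 \<and> deriv h 0 = \<mu> ^ n \<and>
     (\<forall>w\<in>ball 0 \<rho>. (Phi \<mu> \<beta> ^^ n) (P (h w)) = P w)" for n h
  have omit: "P (h w) \<notin> S \<or> w = 0" if "H n h" "w \<in> ball 0 \<rho>" for n h w
  proof (rule ccontr)
    assume *: "\<not> (P (h w) \<notin> S \<or> w = 0)"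
    then have "P w \<in> S" using S_step[of "P (h w)" n] that by (simp add: H_def)
    then show False using \<rho>(2)[of w] * that(2) by auto
  qed
  have omit_crit: "h w \<noteq> c" if "H n h" "w \<in> ball 0 \<rho>" "c = 1 \<or> c = - 1" for n h w c
  proof
    assume "h w = c"
    then have "P (h w) = Fin c" using that(3) by (auto simp: P_def)
    then have "w = 0" using omit[OF that(1,2)] S_crit[OF that(3)] by auto
    then show False using that(1,3) \<open>h w = c\<close> by (auto simp: H_def)
  qed
  have omit_crit_value: "1 - h w * (\<mu> * (\<beta> + 2 * c)) \<noteq> 0"
    if "H n h" "w \<in> ball 0 \<rho>" "c = 1 \<or> c = - 1" for n h w c
  proof
    assume *: "1 - h w * (\<mu> * (\<beta> + 2 * c)) = 0"
    then have "h w \<noteq> 0" by auto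
    then have "P (h w) = Fin (\<mu> * (\<beta> + 2 * c))" using * by (simp add: P_def field_simps)
    also have "\<dots> = Phi \<mu> \<beta> (Fin c)" using Phi_simps(3)[OF \<mu>0, of c] that(3) by (auto simp: algebra_simps)
    also have "\<dots> \<in> S" using S_step[OF S_crit[OF that(3)], of 1] by simp
    finally have "w = 0" using omit[OF that(1,2)] by simp
    then show False using that(1) \<open>h w \<noteq> 0\<close> by (simp add: H_def)
  qed
  have "\<exists>h. H n h" for n
  proof (induction n)
    case 0
    have "H 0 (\<lambda>w. w)" by (simp add: H_def)
    then show ?case by blast
  next
    case (Suc n)
    then obtain h where h: "H n h" by blast
    then have hol: "h holomorphic_on ball 0 \<rho>" and h0: "h 0 = 0" and dh: "deriv h 0 = \<mu> ^ n"
      and Ph: "\<And>w. w \<in> ball 0 \<rho> \<Longrightarrow> (Phi \<mu> \<beta> ^^ n) (P (h w)) = P w" by (auto simp: H_def)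
    have zero_in: "(0::complex) \<in> ball 0 \<rho>" using \<rho>(1) by simp
    \<comment> \<open>The discriminant of the quadratic equation
      \<open>u = h w * \<mu> * (1 + \<beta> * u + u^2)\<close> for the next inverse branch. It
      vanishes only where \<open>P (h w)\<close> is one of the critical values
      \<open>\<mu> * (\<beta> + 2)\<close> and \<open>\<mu> * (\<beta> - 2)\<close>.\<close>
    define g where "g w = (1 - h w * (\<mu> * (\<beta> + 2 * 1))) * (1 - h w * (\<mu> * (\<beta> + 2 * (- 1))))" for w
    have "g holomorphic_on ball 0 \<rho>" unfolding g_def by (intro holomorphic_intros hol)
    moreover have "g w \<noteq> 0" if "w \<in> ball 0 \<rho>" for w
      using omit_crit_value[OF h that] unfolding g_def by (metis mult_eq_0_iff)
    moreover have "contractible (ball (0::complex) \<rho>)" by (simp add: convex_imp_contractible)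
    ultimately obtain s0 where s0: "s0 holomorphic_on ball 0 \<rho>" "\<And>w. w \<in> ball 0 \<rho> \<Longrightarrow> g w = (s0 w)^2"
      using contractible_imp_holomorphic_sqrt by metis
    have "(s0 0)^2 = 1" using s0(2)[OF zero_in] h0 by (simp add: g_def)
    \<comment> \<open>Since \<open>s0 0\<close> is 1 or -1, this normalises the square root to 1 at
      0 and thereby selects the branch that fixes infinity.\<close>
    define s where "s w = s0 0 * s0 w" for w
    have s: "s holomorphic_on ball 0 \<rho>" "s 0 = 1" "\<And>w. w \<in> ball 0 \<rho> \<Longrightarrow> (s w)^2 = g w"
      unfolding s_def using s0 \<open>(s0 0)^2 = 1\<close>
      by (intro holomorphic_intros, auto simp: power_mult_distrib power2_eq_square[of "s0 0"])
    define D where "D w = 1 - h w * \<mu> * \<beta> + s w" for w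
    have holD: "D holomorphic_on ball 0 \<rho>" unfolding D_def by (intro holomorphic_intros hol s)
    have D0: "D 0 = 2" by (simp add: D_def h0 s)
    have D: "D w \<noteq> 0" if w: "w \<in> ball 0 \<rho>" for w
    proof
      assume "D w = 0"
      then have "4 * (h w * \<mu>)^2 = 0" using s(3)[OF w] unfolding D_def g_def by algebra
      then have "h w = 0" using \<mu>0 by simp
      moreover have "(Phi \<mu> \<beta> ^^ n) Infty = Infty" by (induction n) (auto simp: Phi_simps \<mu>0)
      ultimately have "P w = Infty" using Ph[OF w] by (simp add: P_def)
      then have "w = 0" by (auto simp: P_def split: if_splits)
      then show False using D0 \<open>D w = 0\<close> by simp
    qed
    \<comment> \<open>The small root of the quadratic equation, written with the square root in the
      denominator so that it stays regular where \<open>h w = 0\<close>.\<close>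
    define k where "k w = 2 * \<mu> * h w / D w" for w
    have "k holomorphic_on ball 0 \<rho>" unfolding k_def using D by (intro holomorphic_intros hol holD)
    moreover have "k 0 = 0" by (simp add: k_def h0)
    moreover have "deriv k 0 = \<mu> ^ Suc n"
    proof -
      have "(h has_field_derivative \<mu> ^ n) (at 0)"
        using hol zero_in dh by (metis holomorphic_derivI open_ball)
      moreover have "(D has_field_derivative deriv D 0) (at 0)"
        using holD zero_in by (metis holomorphic_derivI open_ball)
      ultimately have "(k has_field_derivative ((2 * \<mu> * \<mu> ^ n) * D 0 - (2 * \<mu> * h 0) * deriv D 0) / (D 0 * D 0)) (at 0)"
        unfolding k_def using D0 by (auto intro!: derivative_eq_intros)
      then show ?thesis by (simp add: D0 h0 DERIV_imp_deriv)
    qed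
    moreover have "(Phi \<mu> \<beta> ^^ Suc n) (P (k w)) = P w" if w: "w \<in> ball 0 \<rho>" for w
    proof -
      have kD: "k w * D w = 2 * \<mu> * h w" using D[OF w] by (simp add: k_def)
      have "D w ^ 2 * k w = D w ^ 2 * (h w * \<mu> * (1 + \<beta> * k w + (k w)^2))"
        using kD s(3)[OF w] unfolding D_def g_def by algebra
      then have "k w = h w * \<mu> * (1 + \<beta> * k w + (k w)^2)" using D[OF w] by simp
      then have "Phi \<mu> \<beta> (P (k w)) = P (h w)" by (rule lift)
      then show ?thesis using Ph[OF w] by (simp add: funpow_swap1)
    qed
    ultimately have "H (Suc n) k" by (simp add: H_def)
    then show ?case by blast
  qed
  then obtain h where h: "\<And>n. H n (h n)" by metis
  obtain R where R: "\<And>z. 0 < R z"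
    "\<And>f. f holomorphic_on cball 0 (R (f 0)) \<Longrightarrow> (\<And>z. norm z \<le> R (f 0) \<Longrightarrow> f z \<noteq> 0 \<and> f z \<noteq> 1) \<Longrightarrow>
      norm (deriv f 0) < 1"
    using Landau_Picard by metis
  define r where "r = R (1 / 2)"
  have "r > 0" using R(1) by (simp add: r_def)
  have bound: "norm \<mu> ^ n * (\<rho> / (4 * r)) < 1" for n
  proof -
    \<comment> \<open>The factor 2 maps the closed disc of Landau's radius \<open>r\<close> into the
      open disc of radius \<rho>.\<close>
    define a where "a = complex_of_real (\<rho> / (2 * r))"
    \<comment> \<open>The omitted values -1 and 1 become 0 and 1. The value at 0 is
      \<open>1 / 2\<close> for every \<open>n\<close>, so that one radius serves all
      iterates.\<close>
    define F where "F z = (1 + h n (a * z)) / 2" for z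
    have hol: "h n holomorphic_on ball 0 \<rho>" and h0: "h n 0 = 0" and dh: "deriv (h n) 0 = \<mu> ^ n"
      using h[of n] by (auto simp: H_def)
    have F0: "F 0 = 1 / 2" by (simp add: F_def h0)
    have in_ball: "a * z \<in> ball 0 \<rho>" if "norm z \<le> r" for z
    proof -
      have "norm (a * z) \<le> \<rho> / (2 * r) * r"
        using that \<rho>(1) \<open>r > 0\<close> unfolding a_def norm_mult norm_of_real by (intro mult_mono) auto
      also have "\<dots> < \<rho>" using \<rho>(1) \<open>r > 0\<close> by simp
      finally show ?thesis by simp
    qed
    have "(*) a ` cball 0 r \<subseteq> ball 0 \<rho>" using in_ball by (auto simp del: mem_ball)
    then have "(\<lambda>z. h n (a * z)) holomorphic_on cball 0 r"
      using holomorphic_on_compose_gen[of "\<lambda>z. a * z" "cball 0 r" "h n" "ball 0 \<rho>"] hol in_ball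
      by (auto simp: o_def intro!: holomorphic_intros)
    then have "F holomorphic_on cball 0 r" unfolding F_def by (intro holomorphic_intros) auto
    moreover have "F z \<noteq> 0 \<and> F z \<noteq> 1" if "norm z \<le> r" for z
      using omit_crit[OF h in_ball[OF that], where c = 1] omit_crit[OF h in_ball[OF that], where c = "- 1"]
      by (auto simp: F_def add_eq_0_iff)
    ultimately have "norm (deriv F 0) < 1" using R(2)[of F] by (simp add: F0 r_def)
    moreover have "deriv F 0 = \<mu> ^ n * a / 2"
    proof -
      have "(h n has_field_derivative \<mu> ^ n) (at (a * 0))"
        using hol \<rho>(1) dh by (metis holomorphic_derivI open_ball centre_in_ball mult_zero_right)
      then have "((\<lambda>z. h n (a * z)) has_field_derivative \<mu> ^ n * a) (at 0)"
        by (rule DERIV_chain2) (auto intro!: derivative_eq_intros)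
      then have "(F has_field_derivative \<mu> ^ n * a / 2) (at 0)"
        unfolding F_def by (auto intro!: derivative_eq_intros)
      then show ?thesis by (rule DERIV_imp_deriv)
    qed
    ultimately show ?thesis
      using \<rho>(1) \<open>r > 0\<close> by (simp add: a_def norm_mult norm_power norm_divide field_simps)
  qed
  obtain n where "4 * r / \<rho> < norm \<mu> ^ n" using real_arch_pow[OF \<mu>] by blast
  then have "norm \<mu> ^ n * (\<rho> / (4 * r)) > 1" using \<rho>(1) \<open>r > 0\<close> by (simp add: field_simps)
  then show False using bound[of n] by simp
qed

subsection \<open>Critical points that are periodic modulo a prime\<close>

context valuation_ring
begin

definition unit :: "complex \<Rightarrow> bool" where
  "unit x \<longleftrightarrow> x \<in> V \<and> x \<notin> M"

definition cg :: "complex \<Rightarrow> complex \<Rightarrow> bool" where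
  "cg x y \<longleftrightarrow> x - y \<in> M"

lemma cg_refl: "cg x x" using zero_in_M by (simp add: cg_def)

lemma cg_sym: "cg x y \<Longrightarrow> cg y x" using M_minus[of "x - y"] by (simp add: cg_def)

lemma cg_trans: "cg x y \<Longrightarrow> cg y z \<Longrightarrow> cg x z" using M_add[of "x - y" "y - z"] by (simp add: cg_def)

lemma cg_add: "cg x y \<Longrightarrow> cg u v \<Longrightarrow> cg (x + u) (y + v)"
  using M_add[of "x - y" "u - v"] by (simp add: cg_def algebra_simps)

lemma cg_diff: "cg x y \<Longrightarrow> cg u v \<Longrightarrow> cg (x - u) (y - v)"
  using M_diff[of "x - y" "u - v"] by (simp add: cg_def algebra_simps)

lemma cg_V: "cg x y \<Longrightarrow> y \<in> V \<Longrightarrow> x \<in> V"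
  using V_closed(3)[of "x - y" y] M_subset_V by (auto simp: cg_def)

lemma cg_mult: "cg x y \<Longrightarrow> cg u v \<Longrightarrow> x \<in> V \<Longrightarrow> v \<in> V \<Longrightarrow> cg (x * u) (y * v)"
  using M_add[OF M_mult'[of x "u - v"] M_mult[of "x - y" v]] by (simp add: cg_def algebra_simps)

lemma unit_cg: "unit x \<Longrightarrow> cg y x \<Longrightarrow> unit y"
  unfolding unit_def using cg_V[of y x] cg_sym[of y x] unit_cong[of x y] by (auto simp: cg_def)

lemma unit_nz: "unit x \<Longrightarrow> x \<noteq> 0" using zero_in_M by (auto simp: unit_def)

lemma unit_inverse: "unit x \<Longrightarrow> 1 / x \<in> V" using unitD by (auto simp: unit_def)

lemma unit_mult: "unit x \<Longrightarrow> unit y \<Longrightarrow> unit (x * y)"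
  unfolding unit_def using V_closed(4) M_prime by blast

lemma unit_mult_D: "unit (x * y) \<Longrightarrow> x \<in> V \<Longrightarrow> y \<in> V \<Longrightarrow> unit x"
  unfolding unit_def using M_mult by blast

lemma unit_cancel: "x * y \<in> M \<Longrightarrow> unit y \<Longrightarrow> x \<in> M"
  using M_mult[of "x * y" "1 / y"] unit_inverse[of y] unit_nz[of y] by simp

lemma Phi_orbit_diff:
  assumes "Phi_orbit \<mu> \<beta> z i \<noteq> 0" "Phi_orbit \<mu> \<beta> w j \<noteq> 0"
  shows "Phi_orbit \<mu> \<beta> z (Suc i) - Phi_orbit \<mu> \<beta> w (Suc j) =
    \<mu> * (Phi_orbit \<mu> \<beta> z i - Phi_orbit \<mu> \<beta> w j) * (1 - 1 / (Phi_orbit \<mu> \<beta> z i * Phi_orbit \<mu> \<beta> w j))"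
  using assms by (simp add: field_simps)

text \<open>If the critical point 1 is periodic modulo the maximal ideal, then its finite orbit is periodic:
  the points of the orbit that reduce to 1 are \<open>1 + t + t\<^sup>2 v\<close> for a fixed \<open>t\<close>, hence no two of them
  are exchanged by the deck transformation \<open>z \<mapsto> 1/z\<close> of the double cover.\<close>

theorem residually_periodic_imp_periodic:
  assumes fc: "fin_crit (Phi \<mu> \<beta>)" and \<mu>: "unit \<mu>" and two: "unit 2"
    and n: "n > 0" and x: "\<And>k. x k = Phi_orbit \<mu> \<beta> 1 k"
    and units: "\<And>k. k < n \<Longrightarrow> unit (x k)" and per: "cg (x n) 1"
    and n1: "\<And>k. 0 < k \<Longrightarrow> k < n \<Longrightarrow> \<not> cg (x k) 1"
    and m1: "\<And>k. 0 < k \<Longrightarrow> k < n \<Longrightarrow> cg (x k) (- 1) \<Longrightarrow> k = 1 \<and> x 1 = - 1"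
  shows "x n = 1"
proof (rule ccontr)
  assume "x n \<noteq> 1"
  have \<mu>0: "\<mu> \<noteq> 0" and \<mu>V: "\<mu> \<in> V" using \<mu> unit_nz by (auto simp: unit_def)
  have x0: "x 0 = 1" by (simp add: x)
  have one: "unit 1" using V_closed(1) one_notin_M by (simp add: unit_def)
  have diff: "x (Suc i) - x (Suc j) = \<mu> * (x i - x j) * (1 - 1 / (x i * x j))" if "unit (x i)" "unit (x j)" for i j
    using Phi_orbit_diff unit_nz[OF that(1)] unit_nz[OF that(2)] by (simp only: x)
  have lip: "\<mu> * (1 - 1 / (x i * x j)) \<in> V" if "unit (x i)" "unit (x j)" for i j
    by (intro V_closed \<mu>V unit_inverse unit_mult that)
  \<comment> \<open>Difference quotients of the map at units lie in \<open>V\<close>, so congruences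
    persist and the reduced orbit is purely periodic with period dividing \<open>n\<close>.\<close>
  have main: "unit (x k) \<and> unit (x (k + n)) \<and> cg (x (k + n)) (x k)" for k
  proof (induction k rule: less_induct)
    case (less k)
    show ?case
    proof (cases k)
      case 0
      then show ?thesis using one per x0 unit_cg by auto
    next
      case (Suc k')
      have k': "unit (x k')" "unit (x (k' + n))" "cg (x (k' + n)) (x k')" using less[of k'] Suc by auto
      have uk: "unit (x k)"
      proof (cases "k < n")
        case False
        then show ?thesis using less[of "k - n"] n by auto
      qed (use units in auto)
      have "x (k + n) - x k = (x (k' + n) - x k') * (\<mu> * (1 - 1 / (x (k' + n) * x k')))"
        using diff[OF k'(2,1)] Suc by (simp add: mult_ac)
      then have "cg (x (k + n)) (x k)" using M_mult[OF k'(3)[unfolded cg_def] lip[OF k'(2,1)]] by (simp add: cg_def)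
      then show ?thesis using uk unit_cg by blast
    qed
  qed
  have U: "unit (x k)" for k using main by blast
  have cgn: "cg (x (k + q * n)) (x k)" for k q
  proof (induction q)
    case (Suc q)
    have "cg (x (k + q * n + n)) (x (k + q * n))" using main by blast
    then show ?case using Suc cg_trans by (simp add: add.assoc add.commute[of n])
  qed (simp add: cg_refl)
  define t where "t = x n - 1"
  have t: "t \<in> M" "t \<noteq> 0" "t \<in> V" using per \<open>x n \<noteq> 1\<close> M_subset_V by (auto simp: t_def cg_def)
  \<comment> \<open>For a difference from the critical point, the last factor of \<open>diff\<close>
    is small as well: the displacement enters squared.\<close>
  have first: "x (Suc (q * n)) - x 1 = (x (q * n) - 1)^2 * (\<mu> / x (q * n))" for q
  proof -
    have "x (q * n) \<noteq> 0" using U unit_nz by blast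
    then show ?thesis using diff[OF U U, of "q * n" 0] by (simp add: x0 field_simps power2_eq_square)
  qed
  have square: "\<exists>v\<in>V. x (q * n + Suc j) - x (Suc j) = (x (q * n) - 1)^2 * v" for q j
  proof (induction j)
    case 0
    have "\<mu> / x (q * n) \<in> V" using V_closed(4)[OF \<mu>V unit_inverse[OF U]] by simp
    then show ?case using first[of q] by (intro bexI[of _ "\<mu> / x (q * n)"]) simp_all
  next
    case (Suc j)
    then obtain v where v: "v \<in> V" "x (q * n + Suc j) - x (Suc j) = (x (q * n) - 1)^2 * v" by blast
    let ?c = "\<mu> * (1 - 1 / (x (q * n + Suc j) * x (Suc j)))"
    have "x (q * n + Suc (Suc j)) - x (Suc (Suc j)) = (x (q * n) - 1)^2 * (v * ?c)"
      using diff[OF U U, of "q * n + Suc j" "Suc j"] v(2) by (simp add: mult_ac)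
    moreover have "v * ?c \<in> V" using V_closed(4)[OF v(1) lip[OF U U]] .
    ultimately show ?case by blast
  qed
  \<comment> \<open>Since displacements from 1 are squared on the way, every return reproduces the
    displacement \<open>t\<close> of the first one up to order \<open>t^2\<close>.\<close>
  have form: "\<exists>v\<in>V. x (Suc q * n) = 1 + t + t^2 * v" for q
  proof (induction q)
    case 0
    show ?case using V_closed(2) by (intro bexI[of _ 0]) (simp_all add: t_def)
  next
    case (Suc q)
    then obtain v where v: "v \<in> V" "x (Suc q * n) = 1 + t + t^2 * v" by blast
    obtain w where w: "w \<in> V" "x (Suc q * n + n) - x n = (x (Suc q * n) - 1)^2 * w"
      using square[of "Suc q" "n - 1"] n by auto
    have "x (Suc (Suc q) * n) = 1 + t + t^2 * ((1 + t * v)^2 * w)"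
    proof -
      have idx: "Suc (Suc q) * n = Suc q * n + n" by simp
      have xn: "x n = 1 + t" by (simp add: t_def)
      have "x (Suc (Suc q) * n) = (x (Suc q * n) - 1)^2 * w + x n"
        unfolding idx using w(2) by (simp only: diff_eq_eq)
      then show ?thesis unfolding v(2) xn by (simp add: power2_eq_square algebra_simps)
    qed
    moreover have "(1 + t * v)^2 * w \<in> V" by (intro V_closed t v w)
    ultimately show ?case by blast
  qed
  \<comment> \<open>The same expansion one step after a return; it is used when the critical value
    is the other critical point.\<close>
  have form': "\<exists>w\<in>V. x (Suc (Suc q * n)) - x 1 = \<mu> * t^2 * (1 + t * w)" for q
  proof -
    obtain v where v: "v \<in> V" "x (Suc q * n) = 1 + t + t^2 * v" using form by blast
    define y where "y = x (Suc q * n)"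
    have vy: "y = 1 + t + t^2 * v" using v(2) by (simp only: y_def)
    have y: "y \<noteq> 0" "1 / y \<in> V" using U unit_nz unit_inverse unfolding y_def by blast+
    let ?w = "(2 * v + t * v^2 - 1 - t * v) * (1 / y)"
    have "(1 + t * v)^2 = y + t * (2 * v + t * v^2 - 1 - t * v)"
      unfolding vy by (simp add: power2_eq_square algebra_simps)
    also have "\<dots> = y * (1 + t * ?w)" using y(1) by (simp add: distrib_left)
    finally have 1: "(1 + t * v)^2 = y * (1 + t * ?w)" .
    have 2: "(y - 1)^2 = t^2 * (1 + t * v)^2" unfolding vy by (simp add: power2_eq_square algebra_simps)
    have "x (Suc (Suc q * n)) - x 1 = (y - 1)^2 * (\<mu> / y)" using first[of "Suc q"] by (simp only: y_def)
    also have "\<dots> = \<mu> * t^2 * (1 + t * ?w)" unfolding 2 1 using y(1) by simp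
    finally have "x (Suc (Suc q * n)) - x 1 = \<mu> * t^2 * (1 + t * ?w)" .
    moreover have "2 \<in> V" using two by (simp add: unit_def)
    then have "?w \<in> V" by (intro V_closed t v y)
    ultimately show ?thesis by blast
  qed
  have contra: "2 + t * u \<noteq> 0" if "u \<in> V" for u
  proof
    assume "2 + t * u = 0"
    then have "2 = t * (- u)" by (simp add: eq_neg_iff_add_eq_0)
    then have "2 \<in> M" using M_mult[OF t(1) V_closed(5)[OF that]] by simp
    then show False using two by (simp add: unit_def)
  qed
  have nz: "Phi_orbit \<mu> \<beta> 1 k \<noteq> 0" for k using U[of k] unit_nz by (simp add: x)
  obtain i' j' where "i' < j'" "x i' = x j'"
    unfolding x by (rule Phi_orbit_eq_collision[OF fc \<mu>0 _ nz]) auto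
  then have ex: "\<exists>i. \<exists>j>i. x i = x j" by blast
  define i where "i = (LEAST i. \<exists>j>i. x i = x j)"
  obtain j where ij: "i < j" "x i = x j" using LeastI_ex[OF ex] by (auto simp: i_def)
  have least: "\<not> (\<exists>j>l. x l = x j)" if "l < i" for l using not_less_Least[of l] that by (auto simp: i_def)
  define d where "d = j - i"
  have d: "d > 0" using ij by (simp add: d_def)
  have shift: "x (i + l + d) = x (i + l)" for l
  proof (induction l)
    case (Suc l)
    have "x (Suc m) = \<mu> * (x m + 1 / x m + \<beta>)" for m by (simp add: x)
    then show ?case using Suc by simp
  qed (use ij in \<open>simp add: d_def\<close>)
  have shift': "x (i + l * d) = x i" for l
  proof (induction l)
    case (Suc l)
    then show ?case using shift[of "l * d"] by (simp add: add_ac)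
  qed simp
  show False
  proof (cases i)
    \<comment> \<open>A purely periodic orbit would hit 1 exactly at return number \<open>d\<close>,
      but the displacement there is \<open>t\<close> times a unit.\<close>
    case 0
    obtain d' where d': "d = Suc d'" using d by (cases d) auto
    obtain v where v: "v \<in> V" "x (d * n) = 1 + t + t^2 * v" using form[of d'] d' by blast
    have "x (n * d) = 1" using shift'[of n] 0 x0 by simp
    then have "t * (1 + t * v) = 0" using v(2) by (simp add: mult.commute algebra_simps power2_eq_square)
    then have "1 + t * v = 0" using t(2) by simp
    then show False using one_plus_M[OF M_mult[OF t(1) v(1)]] zero_in_M by simp
  next
    case (Suc k)
    \<comment> \<open>\<open>a\<close> is the last point before the cycle, and \<open>b\<close> lies
      on the cycle and has the same image, so \<open>a * b = 1\<close>. The shift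
      \<open>n * d\<close> is a multiple of the true period \<open>d\<close> and of
      \<open>n\<close>, whence \<open>a\<close> and \<open>b\<close> are congruent and
      \<open>a\<close> reduces to 1 or -1.\<close>
    define a b where "a = x k" and "b = x (k + n * d)"
    have "k < i" "k + n * d > k" using Suc n d by auto
    then have neq: "a \<noteq> b" using least[of k] unfolding a_def b_def by blast
    have "x (Suc k) = x (Suc (k + n * d))" using shift'[of n] Suc by simp
    then have "\<mu> * (a - b) * (1 - 1 / (a * b)) = 0" using diff[OF U U, of k "k + n * d"] by (simp add: a_def b_def)
    moreover have "a \<noteq> 0" "b \<noteq> 0" using U unit_nz by (auto simp: a_def b_def)
    ultimately have ab: "a * b = 1" using neq \<mu>0 by simp
    define r q where "r = k mod n" and "q = k div n"
    have k: "k = r + q * n" by (simp add: r_def q_def)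
    have "r < n" using n by (simp add: r_def)
    have k2: "k + n * d = r + (q + d) * n" using k by (simp add: algebra_simps)
    have cga: "cg a (x r)" "cg b (x r)" using cgn[of r q] cgn[of r "q + d"] by (simp_all add: a_def b_def k2 flip: k)
    have "cg (a * a) (a * b)"
      using cg_mult[OF cg_refl cg_trans[OF cga(1) cg_sym[OF cga(2)]], of a] U[of k] U[of "k + n * d"]
      by (simp add: a_def b_def unit_def)
    then have "(a - 1) * (a - (- 1)) \<in> M" by (simp add: cg_def ab algebra_simps)
    moreover have "a - 1 \<in> V" "a - (- 1) \<in> V" using U[of k] V_closed(1,3,5,6) by (auto simp: a_def unit_def)
    ultimately have "cg a 1 \<or> cg a (- 1)" unfolding cg_def by (intro M_prime)
    then have r1: "cg (x r) 1 \<or> cg (x r) (- 1)" using cga cg_trans cg_sym by blast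
    show False
    proof (cases "r = 0")
      case True
      show False
      proof (cases q)
        case 0
        then have "a = 1" using True k by (simp add: a_def x0)
        then show False using ab neq by simp
      next
        case (Suc q')
        obtain v where v: "v \<in> V" "a = 1 + t + t^2 * v" using form[of q'] Suc True k by (auto simp: a_def)
        have "k + n * d = Suc (q' + d) * n" using k2 True Suc by simp
        then obtain w where w: "w \<in> V" "b = 1 + t + t^2 * w" using form[of "q' + d"] by (auto simp: b_def)
        let ?u = "1 + v + w + t * v + t * w + t * t * v * w"
        have "t * (2 + t * ?u) = 0"
          using ab unfolding v(2) w(2) by (simp add: power2_eq_square algebra_simps)
        then have "2 + t * ?u = 0" using t(2) by simp
        moreover have "?u \<in> V" by (intro V_closed t v w)
        ultimately show False using contra by blast
      qed
    next
      case False
      then have r: "r = 1" "x 1 = - 1" using n1[of r] m1[of r] \<open>r < n\<close> r1 by auto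
      show False
      proof (cases q)
        case 0
        then have "a = - 1" using r k by (simp add: a_def)
        then show False using ab neq by (simp add: minus_equation_iff)
      next
        case (Suc q')
        have "k = Suc (Suc q' * n)" using r k Suc by simp
        then obtain v where v: "v \<in> V" "a - x 1 = \<mu> * t^2 * (1 + t * v)" using form'[of q'] by (auto simp: a_def)
        have "k + n * d = Suc (Suc (q' + d) * n)" using k2 r Suc by simp
        then obtain w where w: "w \<in> V" "b - x 1 = \<mu> * t^2 * (1 + t * w)" using form'[of "q' + d"] by (auto simp: b_def)
        let ?u = "v + w - \<mu> * t * (1 + t * v) * (1 + t * w)"
        have "a = - 1 + \<mu> * t^2 * (1 + t * v)" "b = - 1 + \<mu> * t^2 * (1 + t * w)"
          using v(2) w(2) r(2) by (simp_all add: diff_eq_eq)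
        with ab have "\<mu> * t^2 * (2 + t * ?u) = 0" by (simp add: power2_eq_square algebra_simps)
        then have "2 + t * ?u = 0" using t(2) \<mu>0 by simp
        moreover have "?u \<in> V" by (intro V_closed \<mu>V t v w)
        ultimately show False using contra by blast
      qed
    qed
  qed
qed

end

text \<open>A point \<open>X/Y\<close> modulo \<open>p\<close> is represented by a pair of integers, and \<open>\<nu>\<close> stands for \<open>4 \<mu>\<close>.
  The flag allows the first point to be the other critical point.\<close>

definition mod_step :: "int \<Rightarrow> int \<Rightarrow> int \<Rightarrow> int \<Rightarrow> int \<Rightarrow> int \<times> int" where
  "mod_step p \<nu> b X Y = (\<nu> * (X * X + b * X * Y + Y * Y) mod p, 4 * X * Y mod p)"

fun mod_returns :: "int \<Rightarrow> int \<Rightarrow> int \<Rightarrow> bool \<Rightarrow> nat \<Rightarrow> int \<Rightarrow> int \<Rightarrow> bool" where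
  "mod_returns p \<nu> b ex 0 X Y \<longleftrightarrow> (X - Y) mod p = 0"
| "mod_returns p \<nu> b ex (Suc n) X Y \<longleftrightarrow> X mod p \<noteq> 0 \<and> (X - Y) mod p \<noteq> 0 \<and> (ex \<or> (X + Y) mod p \<noteq> 0) \<and>
     (case mod_step p \<nu> b X Y of (X', Y') \<Rightarrow> mod_returns p \<nu> b False n X' Y')"

fun mod_avoids :: "int \<Rightarrow> int \<Rightarrow> int \<Rightarrow> nat \<Rightarrow> int \<Rightarrow> int \<Rightarrow> bool" where
  "mod_avoids p \<nu> b 0 X Y \<longleftrightarrow> (X - Y) mod p \<noteq> 0"
| "mod_avoids p \<nu> b (Suc n) X Y \<longleftrightarrow> X mod p \<noteq> 0 \<and>
     (case mod_step p \<nu> b X Y of (X', Y') \<Rightarrow> mod_avoids p \<nu> b n X' Y')"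

section \<open>Soundness of orbit computations modulo p\<close>

locale Phi_mod = valuation_ring +
  fixes \<mu> \<beta> :: complex and \<nu> b :: int
  assumes p: "prime p" "p > 2" and \<nu>: "cg (4 * \<mu>) (of_int \<nu>)" "\<not> int p dvd \<nu>"
    and b: "cg \<beta> (of_int b)"
begin

definition x :: "nat \<Rightarrow> complex" where "x k = Phi_orbit \<mu> \<beta> 1 k"

lemma unit_of_int: "unit (of_int k) \<longleftrightarrow> \<not> int p dvd k"
  using of_int_in_M_iff[OF p(1)] V_closed(9) by (simp add: unit_def)

lemma cg_of_int: "cg (of_int k) (of_int l) \<longleftrightarrow> int p dvd k - l"
  unfolding cg_def using of_int_in_M_iff[OF p(1), of "k - l"] by simp

lemma unit_2: "unit 2"
proof -
  have "\<not> int p dvd 2" using p by (auto dest: zdvd_imp_le)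
  then show ?thesis using unit_of_int[of 2] by simp
qed

lemma unit_4: "unit 4" using unit_mult[OF unit_2 unit_2] by simp

lemma unit_\<mu>: "unit \<mu>"
proof -
  have "unit (4 * \<mu>)" using unit_cg[OF _ \<nu>(1)] unit_of_int \<nu>(2) by blast
  moreover have "\<mu> = (4 * \<mu>) * (1 / 4)" by simp
  then have "\<mu> \<in> V" using \<open>unit (4 * \<mu>)\<close> unit_inverse[OF unit_4] V_closed(4) by (metis unit_def)
  ultimately show ?thesis using unit_mult_D[of \<mu> 4] unit_4 by (simp add: mult.commute unit_def)
qed

definition point :: "nat \<Rightarrow> int \<Rightarrow> int \<Rightarrow> bool" where
  "point k X Y \<longleftrightarrow> x k \<in> V \<and> \<not> int p dvd Y \<and> cg (x k * of_int Y) (of_int X)"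

lemma point_cg_of_int:
  assumes "point k X Y"
  shows "cg (x k) (of_int c) \<longleftrightarrow> (X - c * Y) mod int p = 0"
proof -
  have pt: "x k \<in> V" "unit (of_int Y)" "cg (x k * of_int Y) (of_int X)"
    using assms unit_of_int by (auto simp: point_def)
  have "cg (x k) (of_int c) \<longleftrightarrow> cg (x k * of_int Y) (of_int c * of_int Y)"
  proof
    assume "cg (x k) (of_int c)"
    then show "cg (x k * of_int Y) (of_int c * of_int Y)"
      by (intro cg_mult cg_refl pt V_closed)
  next
    assume "cg (x k * of_int Y) (of_int c * of_int Y)"
    then show "cg (x k) (of_int c)"
      using unit_cancel[OF _ pt(2)] by (simp add: cg_def left_diff_distrib)
  qed
  also have "\<dots> \<longleftrightarrow> cg (of_int X) (of_int (c * Y))" using pt(3) cg_trans cg_sym by (metis of_int_mult)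
  also have "\<dots> \<longleftrightarrow> int p dvd X - c * Y" by (rule cg_of_int)
  finally show ?thesis by (simp add: dvd_eq_mod_eq_0)
qed

lemma point_step:
  assumes "point k X Y" "X mod int p \<noteq> 0" "mod_step (int p) \<nu> b X Y = (X', Y')"
  shows "unit (x k)" "point (Suc k) X' Y'"
proof -
  have pt: "x k \<in> V" "unit (of_int Y)" "cg (x k * of_int Y) (of_int X)"
    using assms(1) unit_of_int by (auto simp: point_def)
  have X: "unit (of_int X)" using assms(2) unit_of_int by (simp add: dvd_eq_mod_eq_0)
  have \<beta>V: "\<beta> \<in> V" using cg_V[OF b V_closed(9)] .
  have "unit (x k * of_int Y)" using unit_cg[OF X pt(3)] .
  then show ux: "unit (x k)" using unit_mult_D pt(1) V_closed(9) by blast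
  have \<mu>V: "\<mu> \<in> V" "4 * \<mu> \<in> V" using unit_\<mu> unit_4 V_closed(4) by (auto simp: unit_def)
  have eq: "x (Suc k) = \<mu> * (x k + 1 / x k + \<beta>)" by (simp add: x_def)
  have xV: "x (Suc k) \<in> V" unfolding eq using unit_inverse[OF ux] \<beta>V \<mu>V pt(1) by (intro V_closed)
  have Y': "cg (of_int (4 * X * Y)) (of_int Y')" and X': "cg (of_int (\<nu> * (X * X + b * X * Y + Y * Y))) (of_int X')"
    using assms(3) unfolding cg_of_int by (auto simp: mod_step_def)
  have e1: "x (Suc k) * (4 * (x k * of_int Y) * of_int Y) =
    4 * \<mu> * ((x k * of_int Y) * (x k * of_int Y) + \<beta> * (x k * of_int Y) * of_int Y + of_int Y * of_int Y)"
    using unit_nz[OF ux] by (simp add: eq field_simps)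
  have e2: "cg (x (Suc k) * (4 * (x k * of_int Y) * of_int Y)) (x (Suc k) * (4 * of_int X * of_int Y))"
    using unit_4 by (intro cg_mult cg_refl pt xV V_closed) (auto simp: unit_def)
  have e3: "cg (4 * \<mu> * ((x k * of_int Y) * (x k * of_int Y) + \<beta> * (x k * of_int Y) * of_int Y + of_int Y * of_int Y))
    (of_int \<nu> * (of_int X * of_int X + of_int b * of_int X * of_int Y + of_int Y * of_int Y))"
    by (intro cg_mult cg_add cg_refl pt \<nu> b V_closed \<mu>V \<beta>V)
  have "cg (x (Suc k) * of_int (4 * X * Y)) (of_int (\<nu> * (X * X + b * X * Y + Y * Y)))"
    using cg_trans[OF cg_sym[OF e2[unfolded e1]] e3] by simp
  moreover have "cg (x (Suc k) * of_int (4 * X * Y)) (x (Suc k) * of_int Y')"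
    by (intro cg_mult cg_refl xV Y' V_closed)
  ultimately have "cg (x (Suc k) * of_int Y') (of_int X')" using cg_trans cg_sym X' by blast
  moreover have "unit (of_int (4 * X * Y))" using unit_mult[OF unit_mult[OF unit_4 X] pt(2)] by simp
  then have "\<not> int p dvd Y'" using unit_cg[OF _ cg_sym[OF Y']] unit_of_int by blast
  ultimately show "point (Suc k) X' Y'" using xV by (simp add: point_def)
qed

lemma point_0: "point 0 1 1"
  using p V_closed(1) cg_refl[of 1] by (simp add: point_def x_def)

lemma mod_returns_sound:
  assumes "point k X Y" "mod_returns (int p) \<nu> b ex n X Y"
  shows "cg (x (k + n)) 1 \<and> (\<forall>i<n. unit (x (k + i)) \<and> \<not> cg (x (k + i)) 1 \<and>
    (cg (x (k + i)) (- 1) \<longrightarrow> ex \<and> i = 0))"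
  using assms
proof (induction n arbitrary: k X Y ex)
  case 0
  then show ?case using point_cg_of_int[of k X Y 1] by simp
next
  case (Suc n)
  obtain X' Y' where XY: "mod_step (int p) \<nu> b X Y = (X', Y')" by fastforce
  have pt: "unit (x k)" "point (Suc k) X' Y'" using point_step[OF Suc.prems(1) _ XY] Suc.prems(2) by auto
  have IH: "cg (x (Suc k + n)) 1 \<and> (\<forall>i<n. unit (x (Suc k + i)) \<and> \<not> cg (x (Suc k + i)) 1 \<and>
    (cg (x (Suc k + i)) (- 1) \<longrightarrow> False \<and> i = 0))"
    using Suc.prems(2) XY by (intro Suc.IH[OF pt(2)]) simp
  have k: "\<not> cg (x k) 1" "cg (x k) (- 1) \<longrightarrow> ex"
    using point_cg_of_int[OF Suc.prems(1), of 1] point_cg_of_int[OF Suc.prems(1), of "- 1"] Suc.prems(2) by auto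
  have "unit (x (k + i)) \<and> \<not> cg (x (k + i)) 1 \<and> (cg (x (k + i)) (- 1) \<longrightarrow> ex \<and> i = 0)" if "i < Suc n" for i
  proof (cases i)
    case 0
    then show ?thesis using k pt by simp
  next
    case (Suc j)
    then show ?thesis using IH that by auto
  qed
  then show ?case using IH by simp
qed

lemma mod_avoids_sound:
  assumes "point k X Y" "mod_avoids (int p) \<nu> b n X Y"
  shows "\<not> cg (x (k + n)) 1 \<and> (\<forall>i<n. unit (x (k + i)))"
  using assms
proof (induction n arbitrary: k X Y)
  case 0
  then show ?case using point_cg_of_int[of k X Y 1] by simp
next
  case (Suc n)
  obtain X' Y' where XY: "mod_step (int p) \<nu> b X Y = (X', Y')" by fastforce
  have pt: "unit (x k)" "point (Suc k) X' Y'" using point_step[OF Suc.prems(1) _ XY] Suc.prems(2) by auto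
  have IH: "\<not> cg (x (Suc k + n)) 1 \<and> (\<forall>i<n. unit (x (Suc k + i)))"
    using Suc.IH[OF pt(2)] Suc.prems(2) XY by simp
  have "unit (x (k + i))" if "i < Suc n" for i
    using IH pt that by (cases i) auto
  then show ?case using IH by simp
qed

text \<open>The test starts at the image of 1, as 1 itself would count as a return; \<open>n\<close>
  further steps therefore give the period \<open>Suc n\<close>.\<close>

lemma Phi_periodic_1:
  assumes "fin_crit (Phi \<mu> \<beta>)"
    and "mod_returns (int p) \<nu> b ex n (fst (mod_step (int p) \<nu> b 1 1)) (snd (mod_step (int p) \<nu> b 1 1))"
    and ex: "ex \<Longrightarrow> x 1 = - 1"
  shows "(Phi \<mu> \<beta> ^^ Suc n) (Fin 1) = Fin 1"
proof -
  have "point 1 (fst (mod_step (int p) \<nu> b 1 1)) (snd (mod_step (int p) \<nu> b 1 1))"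
    using point_step(2)[OF point_0, of "fst (mod_step (int p) \<nu> b 1 1)" "snd (mod_step (int p) \<nu> b 1 1)"] p by simp
  note * = mod_returns_sound[OF this assms(2)]
  have u0: "unit (x 0)" using V_closed(1) one_notin_M by (simp add: x_def unit_def)
  have u: "unit (x k)" if "k < Suc n" for k
    using that * u0 by (cases k) auto
  have "x (Suc n) = 1"
  proof (rule residually_periodic_imp_periodic[OF assms(1) unit_\<mu> unit_2 _ x_def u])
    show "cg (x (Suc n)) 1" using * by simp
    show "\<not> cg (x k) 1" if "0 < k" "k < Suc n" for k using * that by (cases k) auto
    show "k = 1 \<and> x 1 = - 1" if "0 < k" "k < Suc n" "cg (x k) (- 1)" for k
      using * that ex by (cases k) auto
  qed simp
  moreover have "(Phi \<mu> \<beta> ^^ Suc n) (Fin 1) = Fin (x (Suc n))"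
    unfolding x_def using u unit_nz by (intro Phi_funpow unit_nz unit_\<mu>) (auto simp: x_def)
  ultimately show ?thesis by simp
qed

lemma Phi_not_periodic_1:
  assumes "mod_avoids (int p) \<nu> b n 1 1"
  shows "(Phi \<mu> \<beta> ^^ n) (Fin 1) \<noteq> Fin 1"
proof -
  note * = mod_avoids_sound[OF point_0 assms]
  have "(Phi \<mu> \<beta> ^^ n) (Fin 1) = Fin (x n)"
    unfolding x_def using * unit_nz by (intro Phi_funpow unit_nz unit_\<mu>) (auto simp: x_def)
  moreover have "x n \<noteq> 1" using * cg_refl[of 1] by auto
  ultimately show ?thesis by simp
qed

end

subsection \<open>Finitely many candidates\<close>

text \<open>For the numbers 4 / \<kappa> the second symmetric function is 16 times the sum of the
  multipliers divided by their product, that is \<open>16 * (s3 + 2) / s3\<close>.\<close>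

lemma fixed_point_multipliers:
  assumes inv: "has_invariants \<phi> s2 s3" and "s3 \<noteq> 0"
  obtains u v w where "u \<noteq> 0" "v \<noteq> 0" "w \<noteq> 0" "u + v + w = 4 * s2 / s3"
    "u * v + u * w + v * w = 16 + 32 / s3" "u * v * w = 64 / s3"
    "\<And>z \<beta>. z \<in> {u, v, w} \<Longrightarrow> \<beta>^2 = (4 / z - 2)^2 - s3 * (4 / z) \<Longrightarrow> conjugate_over Qbar \<phi> (Phi (z / 4) \<beta>)"
proof -
  obtain x y z where xyz: "\<And>t. t^3 + (- (s3 + 2)) * t^2 + s2 * t + (- s3) = (t - x) * (t - y) * (t - z)"
    "- (s3 + 2) = - (x + y + z)" "s2 = x * y + x * z + y * z" "- s3 = - (x * y * z)"
    using cubic_splits[of "- (s3 + 2)" s2 "- s3"] by blast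
  have s: "s3 = x * y * z" "s3 + 2 = x + y + z" using xyz(2,4) by (simp_all only: neg_equal_iff_equal)
  have nz: "x \<noteq> 0" "y \<noteq> 0" "z \<noteq> 0" using \<open>s3 \<noteq> 0\<close> s by auto
  show ?thesis
  proof (rule that[of "4 / x" "4 / y" "4 / z"])
    show "4 / x + 4 / y + 4 / z = 4 * s2 / s3"
      unfolding xyz(3) s(1) using nz by (simp add: field_simps)
    have "4 / x * (4 / y) + 4 / x * (4 / z) + 4 / y * (4 / z) = 16 * (s3 + 2) / s3"
      unfolding s(2) unfolding s(1) using nz by (simp add: field_simps)
    also have "\<dots> = 16 + 32 / s3" using \<open>s3 \<noteq> 0\<close> by (simp add: field_simps)
    finally show "4 / x * (4 / y) + 4 / x * (4 / z) + 4 / y * (4 / z) = 16 + 32 / s3" .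
    show "4 / x * (4 / y) * (4 / z) = 64 / s3" unfolding s(1) by simp
  next
    fix t \<beta> assume t: "t \<in> {4 / x, 4 / y, 4 / z}" and \<beta>: "\<beta>^2 = (4 / t - 2)^2 - s3 * (4 / t)"
    define k where "k = 4 / t"
    have k: "k = x \<or> k = y \<or> k = z" "k \<noteq> 0" using t nz by (auto simp: k_def)
    then have "k^3 + (- (s3 + 2)) * k^2 + s2 * k + (- s3) = 0" unfolding xyz(1) by auto
    then have "k^3 - (s3 + 2) * k^2 + s2 * k - s3 = 0" by (simp add: algebra_simps)
    then have "conjugate_over Qbar \<phi> (Phi (1 / k) \<beta>)"
      using inv k(2) \<beta> unfolding has_invariants_def k_def by blast
    then show "conjugate_over Qbar \<phi> (Phi (t / 4) \<beta>)" by (simp add: k_def)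
  qed (use nz in auto)
qed

lemma real_cubic_roots:
  fixes u v w :: complex
  assumes "u + v + w \<in> \<real>" "u * v + u * w + v * w \<in> \<real>" "u * v * w \<in> \<real>"
  shows "Im u = 0 \<and> Im v = 0 \<and> Im w = 0 \<or> Im u = 0 \<and> w = cnj v \<or> Im v = 0 \<and> w = cnj u \<or> Im w = 0 \<and> v = cnj u"
proof -
  have cnj: "cnj (u + v + w) = u + v + w" "cnj (u * v + u * w + v * w) = u * v + u * w + v * w"
    "cnj (u * v * w) = u * v * w"
    using assms by (simp_all add: Reals_cnj_iff)
  have *: "(cnj z - u) * (cnj z - v) * (cnj z - w) = 0" if "z = u \<or> z = v \<or> z = w" for z
  proof -
    have 1: "cnj ((z - u) * (z - v) * (z - w)) = 0" using that by auto
    have 2: "cnj ((z - u) * (z - v) * (z - w)) =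
      cnj z ^ 3 - cnj (u + v + w) * cnj z ^ 2 + cnj (u * v + u * w + v * w) * cnj z - cnj (u * v * w)"
      by (simp add: power3_eq_cube power2_eq_square algebra_simps)
    have "cnj z ^ 3 - (u + v + w) * cnj z ^ 2 + (u * v + u * w + v * w) * cnj z - u * v * w = 0"
      using 1 unfolding 2 unfolding cnj .
    then show ?thesis by (simp add: power3_eq_cube power2_eq_square algebra_simps)
  qed
  have im: "Im u + Im v + Im w = 0" using assms(1) by (simp add: complex_is_Real_iff)
  have real: "cnj z = z \<longleftrightarrow> Im z = 0" for z by (simp add: complex_eq_iff)
  have "Im u = 0 \<or> v = cnj u \<or> w = cnj u" "Im v = 0 \<or> u = cnj v \<or> w = cnj v"
    using *[of u] *[of v] real[of u] real[of v] by auto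
  moreover have "v = cnj u \<Longrightarrow> Im w = 0" "w = cnj u \<Longrightarrow> Im v = 0" "Im u = 0 \<Longrightarrow> Im v = 0 \<Longrightarrow> Im w = 0"
    "Im u = 0 \<Longrightarrow> u = cnj v \<Longrightarrow> Im v = 0"
    using im by auto
  ultimately show ?thesis by blast
qed

text \<open>For real roots every factor is nonnegative. A pair of conjugate roots turns two factors
  into a squared norm, and in the third product it leaves the factor
  \<open>16 - (norm s)^2\<close>.\<close>

lemma conjugate_roots_inequalities:
  fixes r s t :: complex
  assumes "Im r = 0" "Im s = 0 \<and> Im t = 0 \<or> t = cnj s" "norm r \<le> 4" "norm s \<le> 4" "norm t \<le> 4"
  shows "0 \<le> Re ((4 - r) * ((4 - s) * (4 - t)))" "0 \<le> Re ((4 + r) * ((4 + s) * (4 + t)))"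
    "0 \<le> Re ((16 - r * s) * (16 - r * t) * (16 - s * t))"
proof -
  obtain a where a: "r = of_real a" "\<bar>a\<bar> \<le> 4" using assms(1,3) by (metis complex_is_Real_iff Reals_cases norm_of_real)
  have "0 \<le> Re ((4 - r) * ((4 - s) * (4 - t))) \<and> 0 \<le> Re ((4 + r) * ((4 + s) * (4 + t))) \<and>
    0 \<le> Re ((16 - r * s) * (16 - r * t) * (16 - s * t))"
    using assms(2)
  proof
    assume *: "Im s = 0 \<and> Im t = 0"
    obtain b where b: "s = of_real b" "\<bar>b\<bar> \<le> 4" using * assms(4) by (metis complex_is_Real_iff Reals_cases norm_of_real)
    obtain c where c: "t = of_real c" "\<bar>c\<bar> \<le> 4" using * assms(5) by (metis complex_is_Real_iff Reals_cases norm_of_real)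
    have le: "x * y \<le> 16" if "\<bar>x\<bar> \<le> 4" "\<bar>y\<bar> \<le> 4" for x y :: real
      using mult_mono[OF that] by (simp add: abs_mult[symmetric])
    have "(4 - r) * ((4 - s) * (4 - t)) = of_real ((4 - a) * ((4 - b) * (4 - c)))"
      "(4 + r) * ((4 + s) * (4 + t)) = of_real ((4 + a) * ((4 + b) * (4 + c)))"
      "(16 - r * s) * (16 - r * t) * (16 - s * t) = of_real ((16 - a * b) * (16 - a * c) * (16 - b * c))"
      by (simp_all add: a b c)
    then show ?thesis
      using a(2) b(2) c(2) le[OF a(2) b(2)] le[OF a(2) c(2)] le[OF b(2) c(2)]
      by (simp only: Re_complex_of_real) (auto intro!: mult_nonneg_nonneg)
  next
    assume t: "t = cnj s"
    have "norm s ^ 2 \<le> 4 ^ 2" using assms(4) by (intro power_mono) auto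
    then have le: "(norm s)^2 \<le> 16" by simp
    have 1: "(4 - r) * ((4 - s) * (4 - t)) = of_real ((4 - a) * (norm (4 - s))^2)"
      using complex_norm_square[of "4 - s"] by (simp add: a t)
    have 2: "(4 + r) * ((4 + s) * (4 + t)) = of_real ((4 + a) * (norm (4 + s))^2)"
      using complex_norm_square[of "4 + s"] by (simp add: a t)
    have 3: "(16 - r * s) * (16 - r * t) * (16 - s * t) = of_real ((norm (16 - r * s))^2 * (16 - (norm s)^2))"
      using complex_norm_square[of "16 - r * s"] complex_norm_square[of s] by (simp add: a t)
    show ?thesis unfolding 1 2 3 Re_complex_of_real using a(2) le by (auto intro!: mult_nonneg_nonneg)
  qed
  then show "0 \<le> Re ((4 - r) * ((4 - s) * (4 - t)))" "0 \<le> Re ((4 + r) * ((4 + s) * (4 + t)))"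
    "0 \<le> Re ((16 - r * s) * (16 - r * t) * (16 - s * t))" by auto
qed

text \<open>For the cubic with roots \<open>u\<close>, \<open>v\<close>, \<open>w\<close> and elementary symmetric functions \<open>m\<close>, \<open>16 + h\<close>, \<open>2 h\<close>, the
  three inequalities are, up to positive factors, the signs of \<open>(4 - u) (4 - v) (4 - w)\<close>,
  \<open>(4 + u) (4 + v) (4 + w)\<close> and \<open>(16 - u v) (16 - u w) (16 - v w)\<close>.\<close>

definition candidate :: "int \<Rightarrow> int \<Rightarrow> bool" where
  "candidate h m \<longleftrightarrow> h \<noteq> 0 \<and> 0 \<le> 64 - 8 * m + h \<and> 0 \<le> 64 + 8 * m + 3 * h \<and> h * (64 - 8 * m + h) \<le> 0"

lemma candidate_of_roots:
  fixes u v w :: complex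
  assumes e: "u + v + w = of_int m" "u * v + u * w + v * w = of_int (16 + h)" "u * v * w = of_int (2 * h)"
    and "h \<noteq> 0" and n: "norm u \<le> 4" "norm v \<le> 4" "norm w \<le> 4"
  shows "candidate h m" "\<bar>h\<bar> \<le> 32" "\<bar>m\<bar> \<le> 12"
proof -
  have "norm (u * v * w) \<le> 4 * 4 * 4"
    unfolding norm_mult using n by (intro mult_mono) auto
  then have "\<bar>real_of_int (2 * h)\<bar> \<le> 64" unfolding e(3) norm_of_int by simp
  then show "\<bar>h\<bar> \<le> 32" by linarith
  have "norm (u + v + w) \<le> 4 + 4 + 4" using n by (intro norm_triangle_le add_mono) auto
  then have "\<bar>real_of_int m\<bar> \<le> 12" unfolding e(1) norm_of_int by simp
  then show "\<bar>m\<bar> \<le> 12" by linarith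
  have "Im u = 0 \<and> Im v = 0 \<and> Im w = 0 \<or> Im u = 0 \<and> w = cnj v \<or> Im v = 0 \<and> w = cnj u \<or> Im w = 0 \<and> v = cnj u"
    by (rule real_cubic_roots) (simp_all only: e Reals_of_int)
  then have "0 \<le> Re ((4 - u) * ((4 - v) * (4 - w))) \<and> 0 \<le> Re ((4 + u) * ((4 + v) * (4 + w))) \<and>
    0 \<le> Re ((16 - u * v) * (16 - u * w) * (16 - v * w))"
  proof (elim disjE conjE)
    assume "Im u = 0" "Im v = 0" "Im w = 0"
    then show ?thesis using conjugate_roots_inequalities[of u v w] n by auto
  next
    assume "Im u = 0" "w = cnj v"
    then show ?thesis using conjugate_roots_inequalities[of u v w] n by auto
  next
    assume "Im v = 0" "w = cnj u"
    then show ?thesis using conjugate_roots_inequalities[of v u w] n by (auto simp: mult_ac)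
  next
    assume "Im w = 0" "v = cnj u"
    then show ?thesis using conjugate_roots_inequalities[of w u v] n by (auto simp: mult_ac)
  qed
  moreover have "(4 - u) * ((4 - v) * (4 - w)) = of_int (2 * (64 - 8 * m + h))"
  proof -
    have "(4 - u) * ((4 - v) * (4 - w)) = 64 - 16 * (u + v + w) + 4 * (u * v + u * w + v * w) - u * v * w" by algebra
    then show ?thesis unfolding e by (simp add: algebra_simps)
  qed
  moreover have "(4 + u) * ((4 + v) * (4 + w)) = of_int (2 * (64 + 8 * m + 3 * h))"
  proof -
    have "(4 + u) * ((4 + v) * (4 + w)) = 64 + 16 * (u + v + w) + 4 * (u * v + u * w + v * w) + u * v * w" by algebra
    then show ?thesis unfolding e by (simp add: algebra_simps)
  qed
  moreover have "(16 - u * v) * (16 - u * w) * (16 - v * w) = of_int (- 4 * (h * (64 - 8 * m + h)))"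
  proof -
    have "(16 - u * v) * (16 - u * w) * (16 - v * w) =
      4096 - 256 * (u * v + u * w + v * w) + 16 * (u + v + w) * (u * v * w) - (u * v * w)^2" by algebra
    then show ?thesis unfolding e by (simp add: algebra_simps power2_eq_square)
  qed
  ultimately have *: "0 \<le> real_of_int (2 * (64 - 8 * m + h))" "0 \<le> real_of_int (2 * (64 + 8 * m + 3 * h))"
    "0 \<le> real_of_int (- 4 * (h * (64 - 8 * m + h)))" by (metis Re_complex_of_real of_real_of_int_eq)+
  have "0 \<le> 2 * k \<Longrightarrow> 0 \<le> k" "0 \<le> - 4 * k \<Longrightarrow> k \<le> 0" for k :: int by simp_all
  note ** = this(1)[OF *(1)[unfolded of_int_0_le_iff]] this(1)[OF *(2)[unfolded of_int_0_le_iff]]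
    this(2)[OF *(3)[unfolded of_int_0_le_iff]]
  show "candidate h m" unfolding candidate_def by (intro conjI \<open>h \<noteq> 0\<close> **)
qed

text \<open>Two symmetric functions of the numbers 4 / \<kappa> are rational and lie in every
  valuation ring, so they are integers; the bound 4 on the roots leaves finitely many of
  them.\<close>

lemma finite_multiplier_invariants:
  assumes inv: "has_invariants \<phi> s2 s3" "s2 \<in> \<rat>" "s3 \<in> \<rat>" "s3 \<noteq> 0" and fc: "fin_crit \<phi>"
  obtains h m where "candidate h m" "\<bar>h\<bar> \<le> 32" "\<bar>m\<bar> \<le> 12" "s3 = 32 / of_int h" "s2 = 8 * of_int m / of_int h"
proof -
  obtain u v w where uvw: "u \<noteq> 0" "v \<noteq> 0" "w \<noteq> 0" and e: "u + v + w = 4 * s2 / s3"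
    "u * v + u * w + v * w = 16 + 32 / s3" "u * v * w = 64 / s3"
    and cj: "\<And>z \<beta>. z \<in> {u, v, w} \<Longrightarrow> \<beta>^2 = (4 / z - 2)^2 - s3 * (4 / z) \<Longrightarrow> conjugate_over Qbar \<phi> (Phi (z / 4) \<beta>)"
    using fixed_point_multipliers[OF inv(1,4)] by blast
  have fcz: "\<exists>\<beta>. fin_crit (Phi (z / 4) \<beta>)" if "z \<in> {u, v, w}" for z
    using fin_crit_conjugate[OF cj[OF that, of "csqrt ((4 / z - 2)^2 - s3 * (4 / z))"] fc] by auto
  have nz: "z / 4 \<noteq> 0" if "z \<in> {u, v, w}" for z using uvw that by auto
  have norm: "norm z \<le> 4" if "z \<in> {u, v, w}" for z
    using fcz[OF that] multiplier_inverse_norm_le_1[OF _ nz[OF that]] by (auto simp: norm_divide)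
  have V: "z \<in> V" if "z \<in> {u, v, w}" "valuation_ring V p" for z V p
    using fcz[OF that(1)] valuation_ring.four_multiplier_inverse_in_V[OF that(2) _ nz[OF that(1)]] by auto
  obtain m where m: "4 * s2 / s3 = of_int m"
  proof (rule Rats_integral)
    show "4 * s2 / s3 \<in> \<rat>" using inv by (auto intro!: Rats_divide Rats_mult)
    fix p V assume val: "valuation_ring V p"
    show "4 * s2 / s3 \<in> V" unfolding e(1)[symmetric]
      by (intro complex_subringD[OF valuation_ring.subring[OF val]] V[OF _ val]) auto
  qed
  obtain k where k: "16 + 32 / s3 = of_int k"
  proof (rule Rats_integral)
    show "16 + 32 / s3 \<in> \<rat>" using inv by (auto intro!: Rats_divide Rats_add)
    fix p V assume val: "valuation_ring V p"
    show "16 + 32 / s3 \<in> V" unfolding e(2)[symmetric]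
      by (intro complex_subringD[OF valuation_ring.subring[OF val]] V[OF _ val]) auto
  qed
  define h where "h = k - 16"
  have h: "32 / s3 = of_int h" using k by (simp add: h_def algebra_simps)
  have "h \<noteq> 0" using h inv(4) by auto
  have s3: "s3 = 32 / of_int h" using h inv(4) \<open>h \<noteq> 0\<close> by (simp add: field_simps)
  have "u + v + w = of_int m" "u * v + u * w + v * w = of_int (16 + h)" "u * v * w = of_int (2 * h)"
  proof -
    show "u + v + w = of_int m" using e(1) m by simp
    show "u * v + u * w + v * w = of_int (16 + h)" using e(2) h by simp
    have "u * v * w = 2 * (32 / s3)" using e(3) by simp
    then show "u * v * w = of_int (2 * h)" unfolding h by simp
  qed
  note * = candidate_of_roots[OF this \<open>h \<noteq> 0\<close> norm norm norm]
  have "s2 = 8 * of_int m / of_int h"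
    using m inv(4) \<open>h \<noteq> 0\<close> unfolding s3 by (simp add: field_simps)
  then show ?thesis using that[of h m] * s3 by simp
qed

subsection \<open>Certificates\<close>

text \<open>Conjugation by \<open>z -> - z\<close> changes the sign of \<beta> and exchanges the
  critical points, so a test for the critical point 1 serves for both.\<close>

lemma Phi_uminus:
  assumes "\<mu> \<noteq> 0"
  shows "(Phi \<mu> (- \<beta>) ^^ n) (Fin 1) = Fin 1 \<longleftrightarrow> (Phi \<mu> \<beta> ^^ n) (Fin (- 1)) = Fin (- 1)"
proof -
  define neg :: "complex P1 \<Rightarrow> complex P1" where "neg P = (case P of Fin z \<Rightarrow> Fin (- z) | Infty \<Rightarrow> Infty)" for P
  have step: "Phi \<mu> (- \<beta>) (neg P) = neg (Phi \<mu> \<beta> P)" for P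
  proof (cases P)
    case (Fin z)
    then show ?thesis by (cases "z = 0") (auto simp: neg_def Phi_simps[OF assms] algebra_simps)
  qed (simp add: neg_def Phi_simps[OF assms])
  have "(Phi \<mu> (- \<beta>) ^^ n) (neg P) = neg ((Phi \<mu> \<beta> ^^ n) P)" for P
    by (induction n) (simp_all add: step)
  from this[of "Fin (- 1)"] have "(Phi \<mu> (- \<beta>) ^^ n) (Fin 1) = neg ((Phi \<mu> \<beta> ^^ n) (Fin (- 1)))"
    by (simp add: neg_def)
  moreover have "neg P = Fin 1 \<longleftrightarrow> P = Fin (- 1)" for P
    by (cases P) (simp_all add: neg_def, metis minus_minus)
  ultimately show ?thesis by simp
qed

text \<open>961 is the square of 31, so trial division by the primes below 31 decides primality in
  this range.\<close>

definition small_prime :: "int \<Rightarrow> bool" where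
  "small_prime p \<longleftrightarrow> 2 < p \<and> p < 961 \<and>
     (\<forall>d\<in>set [2, 3, 5, 7, 11, 13, 17, 19, 23, 29]. p = d \<or> p mod d \<noteq> 0)"

lemma small_prime_imp_prime:
  assumes "small_prime p"
  shows "prime (nat p)"
proof (rule ccontr)
  assume np: "\<not> prime (nat p)"
  have "2 < p" "p < 961" using assms unfolding small_prime_def by blast+
  then have p: "nat p > 2" "nat p < 961" by simp_all
  obtain d where d: "prime d" "d dvd nat p" "d * d \<le> nat p"
  proof -
    obtain d where d: "prime d" "d dvd nat p" using prime_factor_nat[of "nat p"] p by auto
    then obtain e where e: "nat p = d * e" by blast
    have "e \<noteq> 1" using np d(1) e by auto
    then obtain f where f: "prime f" "f dvd e" using prime_factor_nat by blast
    have "e > 0" using e p by (cases e) auto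
    then have "f \<le> e" using f(2) by (simp add: dvd_imp_le)
    show ?thesis
    proof (cases "d \<le> f")
      case True
      then show ?thesis using that[OF d] e \<open>f \<le> e\<close> by simp
    next
      case False
      have "f * f \<le> d * e" using False \<open>f \<le> e\<close> by (intro mult_mono) auto
      then show ?thesis using that[of f] f e by simp
    qed
  qed
  have "d < 31"
  proof (rule ccontr)
    assume "\<not> d < 31"
    then have "31 * 31 \<le> d * d" by (intro mult_mono) auto
    then show False using d(3) p by simp
  qed
  have list: "n \<in> {2, 3, 5, 7, 11, 13, 17, 19, 23, 29}" if "prime n" "n < 31" for n :: nat
  proof -
    have "2 dvd n \<longrightarrow> n = 2" "3 dvd n \<longrightarrow> n = 3" "5 dvd n \<longrightarrow> n = 5"
      using primes_dvd_imp_eq[of 2 n] primes_dvd_imp_eq[of 3 n] primes_dvd_imp_eq[of 5 n] that(1) by auto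
    moreover have "n > 1" using that(1) prime_gt_1_nat by blast
    ultimately show ?thesis using that(2) by (simp only: insert_iff empty_iff) presburger
  qed
  have mem: "int d \<in> set [2, 3, 5, 7, 11, 13, 17, 19, 23, 29]" using list[OF d(1) \<open>d < 31\<close>] by auto
  have "int d dvd int (nat p)" using d(2) by (simp only: int_dvd_int_iff)
  then have "p mod int d = 0" using \<open>2 < p\<close> by (simp add: dvd_eq_mod_eq_0)
  moreover have "\<forall>d\<in>set [2, 3, 5, 7, 11, 13, 17, 19, 23, 29]. p = d \<or> p mod d \<noteq> 0"
    using assms unfolding small_prime_def by (elim conjE)
  from bspec[OF this mem] have "p = int d \<or> p mod int d \<noteq> 0" .
  ultimately have "p = int d" by simp
  then show False using d(1) np by simp
qed

text \<open>With \<nu> for 4 \<mu> = 4 / \<kappa> and \<open>b\<close> for \<beta>, the two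
  congruences are the cubic equation of 4 \<mu> and the relation
  \<open>\<beta>^2 = (\<kappa> - 2)^2 - s3 * \<kappa>\<close> multiplied by
  \<open>\<nu>^2 * h\<close>. That \<nu> and \<open>h\<close> are invertible makes \<mu> a unit and
  \<beta> integral.\<close>

definition place :: "int \<Rightarrow> int \<Rightarrow> int \<Rightarrow> int \<Rightarrow> int \<Rightarrow> bool" where
  "place h m p \<nu> b \<longleftrightarrow> small_prime p \<and> h mod p \<noteq> 0 \<and> \<nu> mod p \<noteq> 0 \<and>
     (\<nu> * \<nu> * \<nu> - m * \<nu> * \<nu> + (16 + h) * \<nu> - 2 * h) mod p = 0 \<and>
     (b * b * \<nu> * \<nu> * h - 4 * (4 * h + h * \<nu> * \<nu> - 4 * h * \<nu> - 32 * \<nu>)) mod p = 0"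

text \<open>The product of the differences between \<nu> and the three exact roots lies in the prime
  ideal \<open>M\<close>, so one of the roots reduces to \<nu>. In the same way one of the two
  square roots available for \<beta> reduces to \<open>b\<close>.\<close>

lemma place_reduction:
  assumes inv: "has_invariants \<phi> (8 * of_int m / of_int h) (32 / of_int h)" and fc: "fin_crit \<phi>"
    and pl: "place h m p \<nu> b"
  obtains V \<mu> \<beta> where "Phi_mod V (nat p) \<mu> \<beta> \<nu> b" "conjugate_over Qbar \<phi> (Phi \<mu> \<beta>)"
    "\<mu>^2 * \<beta>^2 * of_int h = (1 - 2 * \<mu>)^2 * of_int h - 32 * \<mu>" "\<mu> \<noteq> 0"
proof -
  have pp: "prime (nat p)" and p2: "p > 2" using pl small_prime_imp_prime by (auto simp: place_def small_prime_def)
  have "nat p \<ge> 2" using p2 by simp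
  then obtain V where V: "valuation_ring V (nat p)" using valuation_ring_exists by blast
  then interpret valuation_ring V "nat p" .
  have int_p: "int (nat p) = p" using p2 by simp
  have "h \<noteq> 0" using pl by (auto simp: place_def)
  have uoi: "unit (of_int k) \<longleftrightarrow> \<not> p dvd k" for k
    using of_int_in_M_iff[OF pp, of k] V_closed(9)[of k] unfolding int_p unit_def by blast
  have Mi: "of_int k \<in> M \<longleftrightarrow> p dvd k" for k using of_int_in_M_iff[OF pp, of k] unfolding int_p .
  define s3 :: complex where "s3 = 32 / of_int h"
  have s3: "s3 \<noteq> 0" using \<open>h \<noteq> 0\<close> by (simp add: s3_def)
  obtain u v w where uvw: "u \<noteq> 0" "v \<noteq> 0" "w \<noteq> 0" and e': "u + v + w = 4 * (8 * of_int m / of_int h) / s3"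
    "u * v + u * w + v * w = 16 + 32 / s3" "u * v * w = 64 / s3"
    and cj: "\<And>z \<beta>. z \<in> {u, v, w} \<Longrightarrow> \<beta>^2 = (4 / z - 2)^2 - s3 * (4 / z) \<Longrightarrow> conjugate_over Qbar \<phi> (Phi (z / 4) \<beta>)"
    using fixed_point_multipliers[OF inv[folded s3_def] s3] by blast
  have e: "u + v + w = of_int m" "u * v + u * w + v * w = 16 + of_int h" "u * v * w = 2 * of_int h"
    using e' \<open>h \<noteq> 0\<close> by (simp_all add: s3_def)
  have zV: "z \<in> V" if "z \<in> {u, v, w}" for z
  proof -
    have "z / 4 \<noteq> 0" using that uvw by auto
    moreover have "fin_crit (Phi (z / 4) (csqrt ((4 / z - 2)^2 - s3 * (4 / z))))"
      using fin_crit_conjugate[OF cj[OF that] fc] by simp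
    ultimately show ?thesis using four_multiplier_inverse_in_V by fastforce
  qed
  have "(of_int \<nu> - u) * (of_int \<nu> - v) * (of_int \<nu> - w) =
    of_int \<nu> * of_int \<nu> * of_int \<nu> - (u + v + w) * of_int \<nu> * of_int \<nu> + (u * v + u * w + v * w) * of_int \<nu> - u * v * w"
    by (simp add: algebra_simps)
  also have "\<dots> = of_int (\<nu> * \<nu> * \<nu> - m * \<nu> * \<nu> + (16 + h) * \<nu> - 2 * h)" unfolding e by simp
  also have "\<dots> \<in> M" unfolding Mi using pl by (simp add: place_def dvd_eq_mod_eq_0)
  finally have "of_int \<nu> - u \<in> M \<or> of_int \<nu> - v \<in> M \<or> of_int \<nu> - w \<in> M"
    using M_prime[of "(of_int \<nu> - u) * (of_int \<nu> - v)" "of_int \<nu> - w"] M_prime[of "of_int \<nu> - u" "of_int \<nu> - v"]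
      zV V_closed(4,6,9) by auto
  then obtain z where z: "z \<in> {u, v, w}" and zm: "cg z (of_int \<nu>)"
    using cg_sym unfolding cg_def by blast
  have "z \<noteq> 0" using z uvw by auto
  have u\<nu>: "unit (of_int \<nu>)" and uh: "unit (of_int h)" using pl uoi by (auto simp: place_def dvd_eq_mod_eq_0)
  have uz: "unit z" using unit_cg[OF u\<nu> zm] .
  define H where "H = (of_int h :: complex)"
  have "H \<noteq> 0" using \<open>h \<noteq> 0\<close> by (simp add: H_def)
  have HV: "H \<in> V" unfolding H_def by (rule V_closed)
  define g where "g = csqrt ((4 / z - 2)^2 - s3 * (4 / z))"
  have g2: "g^2 = (4 / z - 2)^2 - s3 * (4 / z)" by (simp add: g_def)
  have gz: "g^2 * (z * z * H) = 4 * (4 * H + H * z * z - 4 * H * z - 32 * z)"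
    unfolding g2 s3_def H_def[symmetric] using \<open>z \<noteq> 0\<close> \<open>H \<noteq> 0\<close> by (simp add: field_simps power2_eq_square)
  have num: "of_nat k \<in> V" for k by (rule V_closed)
  have nums: "4 \<in> V" "32 \<in> V" using num[of 4] num[of 32] by simp_all
  have uzH: "unit (z * z * H)" using uz uh unit_mult by (simp add: H_def)
  have "g^2 = 4 * (4 * H + H * z * z - 4 * H * z - 32 * z) * (1 / (z * z * H))"
    using gz \<open>z \<noteq> 0\<close> \<open>H \<noteq> 0\<close> by (simp add: field_simps)
  moreover have "\<dots> \<in> V" by (intro V_closed nums HV zV z unit_inverse uzH)
  ultimately have "g^2 \<in> V" by simp
  have gV: "g \<in> V"
  proof (rule ccontr)
    assume "g \<notin> V"
    then show False using notin_V_mult'[of g g] \<open>g^2 \<in> V\<close> by (simp add: power2_eq_square)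
  qed
  have zV': "z \<in> V" using zV z by blast
  have c1: "cg (4 * (4 * H + H * z * z - 4 * H * z - 32 * z))
    (4 * (4 * H + H * of_int \<nu> * of_int \<nu> - 4 * H * of_int \<nu> - 32 * of_int \<nu>))"
    by (intro cg_mult cg_add cg_diff cg_refl zm V_closed HV nums zV')
  have c2: "cg (of_int b * of_int b * (z * z * H)) (of_int b * of_int b * (of_int \<nu> * of_int \<nu> * H))"
    by (intro cg_mult cg_refl zm V_closed HV zV')
  have c3: "cg (of_int b * of_int b * (of_int \<nu> * of_int \<nu> * H))
    (4 * (4 * H + H * of_int \<nu> * of_int \<nu> - 4 * H * of_int \<nu> - 32 * of_int \<nu>))"
  proof -
    have "of_int (b * b * \<nu> * \<nu> * h - 4 * (4 * h + h * \<nu> * \<nu> - 4 * h * \<nu> - 32 * \<nu>)) \<in> M"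
      unfolding Mi using pl by (simp add: place_def dvd_eq_mod_eq_0)
    then show ?thesis by (simp add: cg_def H_def mult_ac)
  qed
  have "cg (g^2 * (z * z * H)) (of_int b * of_int b * (z * z * H))"
    unfolding gz using cg_trans[OF c1 cg_sym[OF cg_trans[OF c2 c3]]] .
  then have "(g - of_int b) * (g + of_int b) * (z * z * H) \<in> M"
    by (simp add: cg_def algebra_simps power2_eq_square)
  then have "(g - of_int b) * (g + of_int b) \<in> M" using unit_cancel uzH by blast
  then have "g - of_int b \<in> M \<or> g + of_int b \<in> M"
    using M_prime[of "g - of_int b" "g + of_int b"] gV V_closed(3,6,9) by blast
  then obtain \<beta> where \<beta>: "\<beta>^2 = g^2" "cg \<beta> (of_int b)"
  proof
    assume "g - of_int b \<in> M"
    then show ?thesis using that[of g] by (simp add: cg_def)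
  next
    assume "g + of_int b \<in> M"
    then have "- g - of_int b \<in> M" using M_minus by fastforce
    then show ?thesis using that[of "- g"] by (simp add: cg_def)
  qed
  show ?thesis
  proof (rule that)
    show "Phi_mod V (nat p) (z / 4) \<beta> \<nu> b"
      using pp p2 zm \<beta>(2) u\<nu> uoi by unfold_locales (auto simp: int_p)
    show "conjugate_over Qbar \<phi> (Phi (z / 4) \<beta>)" using cj[OF z] \<beta>(1) g2 by simp
    have "(z / 4)^2 * \<beta>^2 * H * 16 = \<beta>^2 * (z * z * H)" by (simp add: power2_eq_square)
    also have "\<dots> = g^2 * (z * z * H)" unfolding \<beta>(1) ..
    also have "\<dots> = ((1 - 2 * (z / 4))^2 * H - 32 * (z / 4)) * 16"
      unfolding gz by (simp add: power2_eq_square field_simps)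
    finally have "(z / 4)^2 * \<beta>^2 * H = (1 - 2 * (z / 4))^2 * H - 32 * (z / 4)"
      by (rule mult_right_cancel[THEN iffD1, rotated]) simp
    then show "(z / 4)^2 * \<beta>^2 * of_int h = (1 - 2 * (z / 4))^2 * of_int h - 32 * (z / 4)"
      unfolding H_def .
    show "z / 4 \<noteq> 0" using \<open>z \<noteq> 0\<close> by simp
  qed
qed

text \<open>For \<open>h = -4\<close>, one critical point is mapped to the other.\<close>

fun certificate :: "int \<Rightarrow> int \<Rightarrow> int \<times> int \<times> int \<times> nat \<times> int \<times> int \<times> int \<Rightarrow> bool" where
  "certificate h m (p, \<nu>, b, n, q, \<nu>', b') \<longleftrightarrow> place h m p \<nu> b \<and> place h m q \<nu>' b' \<and>
     (h = - 4 \<longrightarrow> (\<nu> + 2) mod p \<noteq> 0 \<and> (\<nu> * (2 + b) + 4) mod p = 0) \<and>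
     (case mod_step p \<nu> b 1 1 of (X, Y) \<Rightarrow> mod_returns p \<nu> b (h = - 4) n X Y) \<and>
     mod_avoids q \<nu>' b' (Suc n) 1 1 \<and> mod_avoids q \<nu>' (- b') (Suc n) 1 1"

text \<open>At the first place the critical point 1 is seen to be truly periodic. By conjugacy, 1 or
  -1 must then return after \<open>Suc n\<close> steps in the normal form of the second place, where
  the reductions of both orbits show that it does not.\<close>

theorem certificate_sound:
  assumes inv: "has_invariants \<phi> (8 * of_int m / of_int h) (32 / of_int h)"
    and cert: "certificate h m (p, \<nu>, b, n, q, \<nu>', b')"
  shows "\<not> fin_crit \<phi>"
proof
  assume fc: "fin_crit \<phi>"
  have c: "place h m p \<nu> b" "place h m q \<nu>' b'" "h = - 4 \<Longrightarrow> (\<nu> + 2) mod p \<noteq> 0" "h = - 4 \<Longrightarrow> (\<nu> * (2 + b) + 4) mod p = 0"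
    "mod_returns p \<nu> b (h = - 4) n (fst (mod_step p \<nu> b 1 1)) (snd (mod_step p \<nu> b 1 1))"
    "mod_avoids q \<nu>' b' (Suc n) 1 1" "mod_avoids q \<nu>' (- b') (Suc n) 1 1"
    using cert by (auto simp: case_prod_unfold)
  have "p > 2" "q > 2" using c(1,2) by (auto simp: place_def small_prime_def)
  then have int_pq: "int (nat p) = p" "int (nat q) = q" by simp_all
  obtain V \<mu> \<beta> where pm: "Phi_mod V (nat p) \<mu> \<beta> \<nu> b" and cj: "conjugate_over Qbar \<phi> (Phi \<mu> \<beta>)"
    and rel: "\<mu>^2 * \<beta>^2 * of_int h = (1 - 2 * \<mu>)^2 * of_int h - 32 * \<mu>" and \<mu>0: "\<mu> \<noteq> 0"
    using place_reduction[OF inv fc c(1)] by blast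
  interpret P: Phi_mod V "nat p" \<mu> \<beta> \<nu> b by (fact pm)
  \<comment> \<open>For \<open>h = - 4\<close> the relation \<open>rel\<close> reads
    \<open>(\<mu> * \<beta>)^2 = (1 + 2 * \<mu>)^2\<close>. One sign sends 1 to -1, the other -1 to
    1. The certificate states that 1 goes to -1 modulo p; with the other sign this would force \<nu>
    to be -2 modulo p.\<close>
  have "P.x 1 = - 1" if h: "h = - 4"
  proof -
    have "4 * ((\<mu> * \<beta> - (1 + 2 * \<mu>)) * (\<mu> * \<beta> + (1 + 2 * \<mu>))) = 0"
      using rel unfolding h by (simp add: power2_eq_square algebra_simps)
    then have "(\<mu> * \<beta> - (1 + 2 * \<mu>)) * (\<mu> * \<beta> + (1 + 2 * \<mu>)) = 0" by simp
    moreover have "\<mu> * \<beta> - (1 + 2 * \<mu>) \<noteq> 0"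
    proof
      assume *: "\<mu> * \<beta> - (1 + 2 * \<mu>) = 0"
      have 1: "P.cg (4 * \<mu> * (2 + \<beta>) + 4) (of_int \<nu> * (2 + of_int b) + 4)"
        using P.unit_\<mu> P.unit_4 P.unit_2 P.V_closed(3,4,9)
        by (intro P.cg_mult P.cg_add P.cg_refl P.\<nu> P.b) (auto simp: P.unit_def)
      have m: "of_int (\<nu> * (2 + b) + 4) \<in> P.M"
        using P.of_int_in_M_iff[OF P.p(1), of "\<nu> * (2 + b) + 4"] c(4)[OF h] unfolding int_pq dvd_eq_mod_eq_0 by blast
      have eq: "(of_int (\<nu> * (2 + b) + 4) :: complex) = of_int \<nu> * (2 + of_int b) + 4" by simp
      have "4 * \<mu> * (2 + \<beta>) + 4 \<in> P.M"
        using P.M_add[OF 1[unfolded P.cg_def] m[unfolded eq]] by (simp only: diff_add_cancel)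
      moreover have "4 * \<mu> * (2 + \<beta>) + 4 = (4 * \<mu> + 2) * 4" using * by algebra
      ultimately have "4 * \<mu> + 2 \<in> P.M" using P.unit_cancel[OF _ P.unit_4, of "4 * \<mu> + 2"] by metis
      moreover have "of_int \<nu> - 4 * \<mu> \<in> P.M" using P.cg_sym[OF P.\<nu>(1)] by (simp add: P.cg_def)
      ultimately have "of_int (\<nu> + 2) \<in> P.M"
        using P.M_add[of "of_int \<nu> - 4 * \<mu>" "4 * \<mu> + 2"] by simp
      then show False using P.of_int_in_M_iff[OF P.p(1), of "\<nu> + 2"] c(3)[OF h] unfolding int_pq dvd_eq_mod_eq_0 by blast
    qed
    ultimately have "\<mu> * \<beta> + (1 + 2 * \<mu>) = 0" by simp
    then show ?thesis by (simp add: P.x_def algebra_simps eq_neg_iff_add_eq_0)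
  qed
  moreover have "fin_crit (Phi \<mu> \<beta>)" using fin_crit_conjugate[OF cj fc] .
  ultimately have per: "(Phi \<mu> \<beta> ^^ Suc n) (Fin 1) = Fin 1"
    using P.Phi_periodic_1[of "h = - 4" n] c(5) by (simp only: int_pq)
  obtain W \<mu>' \<beta>' where qm: "Phi_mod W (nat q) \<mu>' \<beta>' \<nu>' b'" and cj': "conjugate_over Qbar \<phi> (Phi \<mu>' \<beta>')" and \<mu>0': "\<mu>' \<noteq> 0"
    using place_reduction[OF inv fc c(2)] by blast
  interpret Q: Phi_mod W "nat q" \<mu>' \<beta>' \<nu>' b' by (fact qm)
  have 1: "(Phi \<mu>' \<beta>' ^^ Suc n) (Fin 1) \<noteq> Fin 1"
    using c(6) by (intro Q.Phi_not_periodic_1) (simp only: int_pq)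
  interpret Q': Phi_mod W "nat q" \<mu>' "- \<beta>'" \<nu>' "- b'"
  proof unfold_locales
    show "Q.cg (- \<beta>') (of_int (- b'))" using Q.cg_diff[OF Q.cg_refl[of 0] Q.b] by simp
  qed (use Q.p Q.\<nu> in auto)
  have "(Phi \<mu>' (- \<beta>') ^^ Suc n) (Fin 1) \<noteq> Fin 1"
    using c(7) by (intro Q'.Phi_not_periodic_1) (simp only: int_pq)
  then have 2: "(Phi \<mu>' \<beta>' ^^ Suc n) (Fin (- 1)) \<noteq> Fin (- 1)" using Phi_uminus[OF \<mu>0'] by blast
  obtain f where f: "\<And>k P. (Phi \<mu>' \<beta>' ^^ k) (f P) = f ((Phi \<mu> \<beta> ^^ k) P)" "\<And>P. crit (Phi \<mu>' \<beta>') (f P) \<longleftrightarrow> crit (Phi \<mu> \<beta>) P"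
    by (rule conjugate_portrait[OF conjugate_trans[OF conjugate_sym[OF cj] cj']]) (rule that)
  have "crit (Phi \<mu>' \<beta>') (f (Fin 1))" using f(2) crit_Phi[OF \<mu>0] by blast
  then have "f (Fin 1) = Fin 1 \<or> f (Fin 1) = Fin (- 1)" using crit_Phi[OF \<mu>0'] by blast
  moreover have "(Phi \<mu>' \<beta>' ^^ Suc n) (f (Fin 1)) = f (Fin 1)" using f(1) per by metis
  ultimately show False using 1 2 by metis
qed

subsection \<open>The certificates for all candidates outside the census\<close>

text \<open>Pairs \<open>(h, m)\<close> in the order of the census without its three polynomials,
  for which \<open>s3 = 0\<close> and \<open>h\<close> does not exist.\<close>

definition census_invariants :: "(int \<times> int) list" where
  "census_invariants = [(- 4, - 6), (- 4, - 2), (- 4, - 4), (- 8, - 4), (- 12, - 2), (- 4, - 5), (- 8, 0), (- 8, - 2), (- 6, - 5)]"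

text \<open>The certificates were found by a computer search; \<open>None\<close> marks the invariants of a map of the
  census.\<close>

definition certificates :: "((int \<times> int) \<times> (int \<times> int \<times> int \<times> nat \<times> int \<times> int \<times> int) option) list" where
  "certificates = [
    ((-32, 4), Some (41, 4, 24, 2, 7, 4, 3)), ((-31, 4), Some (89, 58, 65, 21, 17, 15, 3)),
    ((-30, 4), Some (103, 20, 45, 7, 13, 10, 5)), ((-29, 3), Some (7, 2, 1, 1, 11, 6, 4)),
    ((-29, 4), Some (97, 66, 37, 2, 5, 3, 0)), ((-28, 3), Some (47, 18, 12, 3, 23, 15, 8)),
    ((-28, 4), Some (73, 51, 9, 3, 17, 7, 6)), ((-27, 3), Some (29, 12, 22, 2, 17, 11, 5)),
    ((-27, 4), Some (97, 62, 26, 10, 29, 24, 4)), ((-26, 2), Some (17, 6, 1, 3, 11, 5, 5)),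
    ((-26, 3), Some (101, 64, 64, 3, 11, 3, 4)), ((-26, 4), Some (53, 45, 5, 2, 23, 10, 1)),
    ((-25, 2), Some (67, 9, 59, 2, 53, 43, 11)), ((-25, 3), Some (11, 5, 0, 2, 3, 1, 0)),
    ((-25, 4), Some (13, 8, 3, 3, 7, 4, 3)), ((-24, 1), Some (13, 7, 8, 2, 23, 19, 0)),
    ((-24, 2), Some (29, 12, 0, 4, 11, 3, 1)), ((-24, 3), Some (37, 29, 13, 5, 13, 12, 3)),
    ((-24, 4), Some (83, 54, 42, 6, 5, 3, 0)), ((-24, 5), Some (37, 4, 29, 5, 5, 2, 1)),
    ((-23, 1), Some (13, 1, 3, 3, 11, 4, 0)), ((-23, 2), Some (83, 65, 54, 4, 37, 6, 7)),
    ((-23, 3), Some (83, 50, 80, 2, 7, 6, 0)), ((-23, 4), Some (53, 14, 7, 2, 17, 11, 8)),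
    ((-23, 5), Some (181, 96, 55, 8, 7, 3, 0)), ((-22, 1), Some (79, 36, 13, 4, 17, 10, 4)),
    ((-22, 2), Some (79, 52, 20, 6, 17, 14, 3)), ((-22, 3), Some (17, 9, 3, 4, 3, 1, 0)),
    ((-22, 4), Some (191, 83, 167, 13, 41, 26, 17)), ((-22, 5), Some (17, 1, 13, 4, 29, 15, 4)),
    ((-21, 0), Some (5, 2, 2, 1, 11, 9, 5)), ((-21, 1), Some (71, 44, 6, 2, 13, 5, 1)),
    ((-21, 2), Some (13, 6, 9, 2, 17, 13, 1)), ((-21, 3), Some (23, 8, 0, 2, 19, 4, 6)),
    ((-21, 4), Some (103, 52, 77, 14, 37, 10, 13)), ((-21, 5), Some (5, 2, 2, 1, 17, 5, 4)),
    ((-20, 0), Some (67, 33, 28, 3, 23, 13, 8)), ((-20, 1), Some (79, 65, 64, 9, 17, 7, 4)),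
    ((-20, 2), Some (53, 29, 34, 4, 7, 1, 3)), ((-20, 3), Some (251, 41, 231, 5, 23, 12, 9)),
    ((-20, 4), Some (67, 25, 26, 3, 37, 31, 16)), ((-20, 5), Some (11, 7, 6, 4, 53, 32, 12)),
    ((-19, 0), Some (41, 23, 35, 2, 3, 1, 0)), ((-19, 1), Some (43, 33, 2, 5, 37, 4, 18)),
    ((-19, 2), Some (73, 56, 8, 4, 17, 1, 0)), ((-19, 3), Some (11, 1, 8, 2, 3, 1, 0)),
    ((-19, 4), Some (127, 36, 96, 11, 71, 11, 14)), ((-19, 5), Some (7, 6, 4, 1, 5, 2, 1)),
    ((-18, -1), Some (41, 25, 10, 4, 47, 26, 8)), ((-18, 0), Some (53, 37, 37, 4, 19, 3, 0)),
    ((-18, 1), Some (13, 8, 6, 2, 7, 5, 0)), ((-18, 2), Some (13, 9, 0, 2, 11, 1, 4)),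
    ((-18, 3), Some (41, 15, 26, 6, 7, 2, 3)), ((-18, 4), Some (31, 1, 7, 3, 7, 4, 3)),
    ((-18, 5), Some (433, 57, 401, 4, 29, 23, 6)), ((-17, -1), Some (103, 29, 40, 22, 7, 1, 0)),
    ((-17, 0), Some (37, 7, 7, 2, 13, 9, 1)), ((-17, 1), Some (73, 12, 8, 2, 11, 10, 0)),
    ((-17, 2), Some (883, 579, 511, 11, 13, 5, 5)), ((-17, 3), Some (89, 23, 32, 6, 29, 13, 4)),
    ((-17, 4), Some (61, 43, 21, 6, 13, 10, 5)), ((-17, 5), Some (97, 20, 49, 5, 7, 4, 0)),
    ((-16, -2), Some (29, 15, 20, 2, 7, 3, 0)), ((-16, -1), Some (41, 24, 30, 4, 31, 21, 0)),
    ((-16, 0), Some (31, 6, 14, 4, 3, 1, 0)), ((-16, 1), Some (17, 9, 16, 6, 43, 14, 0)),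
    ((-16, 2), Some (101, 74, 54, 3, 13, 8, 0)), ((-16, 3), Some (37, 9, 12, 4, 3, 1, 0)),
    ((-16, 4), Some (31, 28, 25, 3, 19, 5, 0)), ((-16, 5), Some (5, 2, 2, 1, 7, 3, 0)),
    ((-16, 6), Some (47, 4, 35, 5, 11, 4, 5)), ((-15, -2), Some (13, 3, 9, 2, 31, 9, 0)),
    ((-15, -1), Some (313, 169, 132, 29, 11, 1, 5)), ((-15, 0), Some (13, 10, 7, 2, 19, 7, 5)),
    ((-15, 1), Some (43, 29, 17, 5, 17, 3, 7)), ((-15, 2), Some (281, 21, 104, 3, 11, 5, 5)),
    ((-15, 3), Some (7, 2, 1, 1, 11, 3, 4)), ((-15, 4), Some (79, 40, 43, 2, 17, 4, 6)),
    ((-15, 5), Some (47, 24, 13, 2, 11, 9, 0)), ((-15, 6), Some (13, 1, 4, 1, 41, 18, 3)),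
    ((-14, -2), Some (137, 59, 83, 2, 19, 8, 0)), ((-14, -1), Some (37, 12, 11, 4, 5, 3, 0)),
    ((-14, 0), Some (131, 10, 11, 2, 5, 2, 1)), ((-14, 1), Some (233, 76, 25, 4, 5, 1, 1)),
    ((-14, 2), Some (43, 3, 22, 3, 17, 11, 1)), ((-14, 3), Some (11, 5, 0, 2, 37, 28, 0)),
    ((-14, 4), Some (23, 11, 19, 2, 5, 3, 0)), ((-14, 5), Some (59, 8, 25, 2, 5, 2, 1)),
    ((-14, 6), Some (17, 9, 8, 3, 5, 1, 1)), ((-13, -3), Some (131, 118, 33, 7, 17, 14, 1)),
    ((-13, -2), Some (89, 14, 8, 5, 37, 23, 8)), ((-13, -1), Some (419, 321, 11, 23, 17, 10, 7)),
    ((-13, 0), Some (19, 14, 2, 7, 53, 34, 12)), ((-13, 1), Some (11, 7, 2, 3, 29, 1, 5)),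
    ((-13, 2), Some (7, 1, 3, 1, 5, 4, 0)), ((-13, 3), Some (53, 51, 22, 3, 17, 15, 7)),
    ((-13, 4), Some (11, 5, 7, 1, 29, 6, 9)), ((-13, 5), Some (37, 18, 30, 9, 17, 16, 0)),
    ((-13, 6), Some (89, 8, 6, 5, 19, 10, 5)), ((-12, -3), Some (43, 22, 0, 4, 31, 6, 10)),
    ((-12, -2), None), ((-12, -1), Some (59, 29, 0, 4, 19, 11, 4)),
    ((-12, 0), Some (29, 1, 11, 4, 19, 18, 0)), ((-12, 1), Some (83, 43, 62, 3, 11, 4, 0)),
    ((-12, 2), Some (29, 27, 1, 3, 19, 9, 3)), ((-12, 3), Some (137, 81, 119, 8, 43, 14, 11)),
    ((-12, 4), Some (13, 8, 3, 3, 17, 12, 7)), ((-12, 5), Some (7, 6, 4, 1, 11, 5, 3)),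
    ((-12, 6), Some (53, 28, 14, 5, 29, 10, 4)), ((-11, -3), Some (31, 1, 17, 9, 7, 4, 3)),
    ((-11, -2), Some (17, 6, 6, 2, 37, 5, 0)), ((-11, -1), Some (73, 3, 40, 2, 19, 6, 4)),
    ((-11, 0), Some (5, 2, 2, 1, 7, 1, 1)), ((-11, 1), Some (13, 7, 8, 2, 7, 5, 0)),
    ((-11, 2), Some (97, 16, 79, 2, 23, 3, 5)), ((-11, 3), Some (97, 5, 69, 8, 13, 12, 3)),
    ((-11, 4), Some (23, 16, 0, 3, 7, 4, 3)), ((-11, 5), Some (5, 2, 2, 1, 17, 9, 4)),
    ((-11, 6), Some (19, 8, 9, 2, 31, 9, 6)), ((-10, -4), Some (19, 8, 1, 3, 11, 8, 0)),
    ((-10, -3), Some (389, 234, 221, 4, 3, 1, 0)), ((-10, -2), Some (31, 12, 22, 2, 7, 4, 0)),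
    ((-10, -1), Some (61, 20, 50, 6, 7, 1, 0)), ((-10, 0), Some (17, 6, 4, 2, 3, 1, 0)),
    ((-10, 1), Some (13, 1, 3, 3, 19, 9, 5)), ((-10, 2), Some (79, 27, 50, 3, 31, 21, 8)),
    ((-10, 3), Some (59, 23, 27, 4, 3, 1, 0)), ((-10, 4), Some (29, 3, 21, 2, 19, 7, 1)),
    ((-10, 5), Some (37, 33, 19, 2, 7, 4, 0)), ((-10, 6), Some (101, 56, 6, 2, 3, 1, 0)),
    ((-9, -4), Some (31, 10, 22, 4, 5, 1, 1)), ((-9, -3), Some (109, 64, 89, 5, 13, 2, 6)),
    ((-9, -2), Some (47, 15, 11, 2, 7, 3, 0)), ((-9, -1), Some (11, 2, 10, 2, 5, 3, 0)),
    ((-9, 0), Some (257, 176, 25, 23, 5, 2, 1)), ((-9, 1), Some (23, 17, 3, 4, 5, 1, 1)),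
    ((-9, 2), Some (67, 53, 21, 2, 17, 6, 1)), ((-9, 3), Some (13, 3, 6, 1, 7, 6, 0)),
    ((-9, 4), Some (643, 87, 566, 15, 23, 4, 5)), ((-9, 5), Some (11, 7, 6, 4, 5, 2, 1)),
    ((-9, 6), Some (19, 13, 15, 1, 5, 1, 1)), ((-8, -5), Some (29, 25, 18, 2, 11, 7, 4)),
    ((-8, -4), None), ((-8, -3), Some (29, 11, 10, 3, 59, 28, 23)), ((-8, -2), None),
    ((-8, -1), Some (599, 429, 377, 6, 23, 10, 11)), ((-8, 0), None),
    ((-8, 1), Some (139, 97, 26, 3, 13, 5, 1)), ((-8, 2), Some (13, 6, 9, 2, 31, 14, 7)),
    ((-8, 3), Some (7, 2, 1, 1, 11, 1, 3)), ((-8, 4), Some (53, 22, 33, 4, 47, 34, 21)),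
    ((-8, 5), Some (191, 177, 55, 9, 17, 7, 8)), ((-8, 6), Some (83, 41, 20, 2, 11, 7, 4)),
    ((-8, 7), Some (11, 4, 4, 1, 5, 4, 0)), ((-7, -5), Some (89, 27, 37, 4, 19, 7, 0)),
    ((-7, -4), Some (37, 23, 4, 7, 29, 16, 7)), ((-7, -3), Some (37, 5, 9, 2, 3, 1, 0)),
    ((-7, -2), Some (11, 8, 10, 2, 13, 1, 0)), ((-7, -1), Some (131, 126, 10, 8, 13, 4, 0)),
    ((-7, 0), Some (37, 12, 34, 5, 19, 11, 5)), ((-7, 1), Some (31, 6, 5, 4, 41, 19, 15)),
    ((-7, 2), Some (223, 39, 202, 11, 73, 40, 0)), ((-7, 3), Some (67, 10, 25, 4, 3, 1, 0)),
    ((-7, 4), Some (17, 16, 5, 1, 13, 12, 1)), ((-7, 5), Some (19, 1, 14, 1, 17, 4, 5)),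
    ((-7, 6), Some (61, 14, 8, 12, 3, 1, 0)), ((-7, 7), Some (17, 1, 10, 2, 31, 20, 14)),
    ((-6, -5), None), ((-6, -4), Some (13, 11, 12, 4, 37, 35, 17)),
    ((-6, -3), Some (761, 503, 222, 5, 11, 7, 0)), ((-6, -2), Some (47, 24, 4, 8, 31, 17, 5)),
    ((-6, -1), Some (13, 3, 10, 3, 43, 35, 0)), ((-6, 0), Some (5, 2, 2, 1, 17, 5, 7)),
    ((-6, 1), Some (29, 28, 18, 2, 11, 10, 0)), ((-6, 2), Some (7, 1, 3, 1, 17, 3, 0)),
    ((-6, 3), Some (263, 239, 91, 2, 31, 25, 10)), ((-6, 4), Some (31, 21, 28, 3, 17, 11, 8)),
    ((-6, 5), Some (5, 2, 2, 1, 17, 10, 3)), ((-6, 6), Some (11, 8, 2, 1, 37, 5, 13)),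
    ((-6, 7), Some (293, 82, 114, 14, 17, 13, 7)), ((-5, -6), Some (59, 17, 10, 3, 29, 13, 8)),
    ((-5, -5), Some (31, 8, 10, 2, 11, 4, 5)), ((-5, -4), Some (83, 9, 61, 10, 13, 4, 6)),
    ((-5, -3), Some (71, 10, 5, 4, 41, 20, 4)), ((-5, -2), Some (7, 6, 4, 1, 13, 12, 0)),
    ((-5, -1), Some (331, 97, 307, 18, 23, 1, 5)), ((-5, 0), Some (11, 1, 1, 1, 17, 12, 0)),
    ((-5, 1), Some (13, 8, 7, 1, 17, 10, 4)), ((-5, 2), Some (13, 9, 0, 2, 17, 14, 3)),
    ((-5, 3), Some (17, 9, 14, 1, 23, 5, 6)), ((-5, 4), Some (73, 21, 13, 4, 37, 6, 16)),
    ((-5, 5), Some (7, 6, 4, 1, 17, 1, 4)), ((-5, 6), Some (23, 11, 9, 1, 11, 4, 5)),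
    ((-5, 7), Some (29, 7, 6, 6, 37, 19, 18)), ((-4, -6), None), ((-4, -5), None),
    ((-4, -4), None), ((-4, -3), Some (73, 46, 36, 4, 3, 1, 0)), ((-4, -2), None),
    ((-4, -1), Some (43, 31, 27, 5, 11, 1, 5)), ((-4, 0), Some (13, 9, 12, 4, 3, 1, 0)),
    ((-4, 1), Some (5, 1, 4, 2, 7, 5, 0)), ((-4, 2), Some (19, 1, 13, 4, 11, 5, 5)),
    ((-4, 3), Some (7, 2, 3, 2, 3, 1, 0)), ((-4, 4), Some (199, 43, 146, 30, 5, 3, 0)),
    ((-4, 5), Some (59, 21, 54, 3, 5, 2, 1)), ((-4, 6), Some (5, 1, 4, 2, 3, 1, 0)),
    ((-4, 7), Some (11, 6, 1, 2, 7, 1, 1)), ((-3, -6), Some (13, 1, 8, 3, 59, 25, 21)),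
    ((-3, -5), Some (71, 26, 55, 7, 29, 12, 4)), ((-3, -4), Some (23, 19, 11, 3, 29, 22, 3)),
    ((-3, -3), Some (359, 10, 119, 26, 11, 3, 0)), ((-3, -2), Some (31, 6, 23, 6, 7, 4, 0)),
    ((-3, -1), Some (11, 2, 6, 1, 7, 1, 0)), ((-3, 0), Some (409, 79, 19, 42, 37, 11, 17)),
    ((-3, 1), Some (23, 7, 0, 3, 17, 7, 4)), ((-3, 2), Some (127, 14, 67, 7, 19, 8, 5)),
    ((-3, 3), Some (19, 10, 1, 1, 11, 5, 0)), ((-3, 4), Some (31, 16, 24, 2, 23, 10, 1)),
    ((-3, 5), Some (31, 23, 9, 5, 7, 4, 0)), ((-3, 6), Some (101, 46, 67, 3, 7, 1, 0)),
    ((-3, 7), Some (13, 1, 8, 3, 41, 13, 0)), ((-2, -7), Some (601, 356, 209, 8, 17, 2, 7)),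
    ((-2, -6), Some (47, 29, 18, 4, 41, 36, 10)), ((-2, -5), Some (89, 52, 83, 5, 17, 4, 0)),
    ((-2, -4), Some (19, 13, 11, 4, 7, 6, 0)), ((-2, -3), Some (37, 7, 13, 6, 41, 8, 0)),
    ((-2, -2), Some (13, 3, 9, 2, 7, 3, 0)), ((-2, -1), Some (41, 3, 9, 2, 19, 7, 6)),
    ((-2, 0), Some (13, 10, 7, 2, 19, 1, 7)), ((-2, 1), Some (11, 7, 2, 3, 41, 13, 3)),
    ((-2, 2), Some (281, 224, 44, 2, 11, 3, 1)), ((-2, 3), Some (71, 21, 52, 7, 7, 6, 0)),
    ((-2, 4), Some (11, 5, 7, 1, 31, 8, 7)), ((-2, 5), Some (73, 47, 4, 6, 7, 3, 0)),
    ((-2, 6), Some (13, 1, 4, 1, 19, 3, 8)), ((-2, 7), Some (59, 19, 26, 7, 17, 7, 7)),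
    ((-1, -7), Some (61, 7, 51, 4, 17, 4, 4)), ((-1, -6), Some (97, 19, 42, 3, 31, 7, 13)),
    ((-1, -5), Some (5, 2, 2, 1, 41, 9, 13)), ((-1, -4), Some (7, 2, 1, 1, 11, 1, 0)),
    ((-1, -3), Some (157, 99, 95, 7, 13, 2, 5)), ((-1, -2), Some (41, 20, 7, 8, 37, 32, 0)),
    ((-1, -1), Some (13, 12, 8, 1, 11, 2, 3)), ((-1, 0), Some (5, 2, 2, 1, 19, 13, 3)),
    ((-1, 1), Some (17, 1, 9, 1, 11, 4, 0)), ((-1, 2), Some (19, 5, 9, 1, 23, 8, 1)),
    ((-1, 3), Some (7, 2, 1, 1, 37, 14, 0)), ((-1, 4), Some (23, 12, 4, 1, 17, 5, 5)),
    ((-1, 5), Some (5, 2, 2, 1, 7, 5, 1)), ((-1, 6), Some (29, 24, 16, 5, 23, 6, 8)),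
    ((-1, 7), Some (89, 23, 42, 3, 11, 1, 0)), ((8, 9), Some (7, 1, 3, 1, 13, 1, 1)),
    ((16, 10), Some (13, 2, 3, 1, 5, 2, 1)), ((24, 11), Some (31, 3, 3, 1, 7, 3, 1)),
    ((32, 12), Some (19, 4, 0, 2, 3, 1, 0))]"

definition verified :: "(int \<times> int) \<times> (int \<times> int \<times> int \<times> nat \<times> int \<times> int \<times> int) option \<Rightarrow> bool" where
  "verified x = (case x of ((h, m), None) \<Rightarrow> List.member census_invariants (h, m) | ((h, m), Some c) \<Rightarrow> certificate h m c)"

lemma certificates_verified: "list_all verified certificates"
  by code_simp

text \<open>The table runs through the candidates in lexicographic order, so the comparison is an
  equality of lists.\<close>

lemma certificates_complete:
  "filter (\<lambda>(h, m). candidate h m) (List.product [-32..32] [-12..12]) = map fst certificates"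
  by code_simp

subsection \<open>Critical points and portraits of quadratic maps\<close>

text \<open>The other point in the fiber of \<open>[x : y]\<close> is \<open>[?p : - ?q]\<close>.
  The two coincide exactly at the zeros of the Jacobian form of numerator and denominator.\<close>

lemma crit_quad_proj:
  assumes res: "quad_res a b c d e f \<noteq> 0" and xy: "(x, y) \<noteq> (0, 0)"
  shows "crit (quad a b c d e f) (proj x y) \<longleftrightarrow>
    (a * e - b * d) * x^2 + 2 * (a * f - c * d) * x * y + (b * f - c * e) * y^2 = 0"
proof -
  define A B C where "A = a * f - c * d" and "B = a * e - b * d" and "C = b * f - c * e"
  have det: "A^2 - B * C \<noteq> 0" using res by (simp add: quad_res_def A_def B_def C_def)
  let ?p = "A * x + C * y" and ?q = "B * x + A * y"
  have pq: "(?p, - ?q) \<noteq> (0, 0)"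
  proof
    assume "(?p, - ?q) = (0, 0)"
    then have "?p = 0" "- ?q = 0" by (simp_all only: prod.inject)
    then have "?p = 0" "?q = 0" by (simp_all only: neg_equal_0_iff_equal)
    then have "(A^2 - B * C) * x = 0" "(A^2 - B * C) * y = 0" by algebra+
    then show False using det xy by simp
  qed
  have fiber: "quad a b c d e f (proj u v) = quad a b c d e f (proj x y) \<longleftrightarrow> u * y = v * x \<or> u * ?q + v * ?p = 0"
    if uv: "(u, v) \<noteq> (0, 0)" for u v
  proof -
    have "(a * u^2 + b * u * v + c * v^2) * (d * x^2 + e * x * y + f * y^2) -
      (a * x^2 + b * x * y + c * y^2) * (d * u^2 + e * u * v + f * v^2) = (u * y - v * x) * (u * ?q + v * ?p)"
      unfolding A_def B_def C_def by algebra
    then show ?thesis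
      unfolding quad_proj[OF uv] quad_proj[OF xy] proj_eq_iff[OF quad_nz[OF res uv] quad_nz[OF res xy]]
      by (metis eq_iff_diff_eq_0 mult_eq_0_iff)
  qed
  have "crit (quad a b c d e f) (proj x y) \<longleftrightarrow> x * ?q + y * ?p = 0"
  proof
    assume crit: "crit (quad a b c d e f) (proj x y)"
    have "?p * ?q + (- ?q) * ?p = 0" by algebra
    then have "quad a b c d e f (proj ?p (- ?q)) = quad a b c d e f (proj x y)" using fiber[OF pq] by blast
    then have "proj ?p (- ?q) = proj x y" using crit unfolding crit_def by blast
    then have "?p * y = x * - ?q" by (simp only: proj_eq_iff[OF pq xy])
    then show "x * ?q + y * ?p = 0" by algebra
  next
    assume W: "x * ?q + y * ?p = 0"
    show "crit (quad a b c d e f) (proj x y)"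
      unfolding crit_def
    proof (intro allI impI)
      fix Q assume Q: "quad a b c d e f Q = quad a b c d e f (proj x y)"
      obtain u v where uv: "(u, v) \<noteq> (0, 0)" "Q = proj u v" by (rule P1_cases_proj)
      have "u * y = v * x"
      proof (rule ccontr)
        assume ne: "u * y \<noteq> v * x"
        then have "u * ?q + v * ?p = 0" using Q fiber[OF uv(1)] uv(2) by blast
        then have "(u * y - v * x) * ?q = 0" "(u * y - v * x) * ?p = 0" using W by algebra+
        then have "?q = 0" "?p = 0" using ne by simp_all
        then show False using pq by simp
      qed
      then show "Q = proj x y" unfolding uv(2) proj_eq_iff[OF uv(1) xy] by (simp add: mult.commute)
    qed
  qed
  also have "x * ?q + y * ?p = B * x^2 + 2 * A * x * y + C * y^2" by (simp add: algebra_simps power2_eq_square)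
  finally show ?thesis by (simp add: A_def B_def C_def)
qed

lemma crit_quad:
  assumes "quad_res a b c d e f \<noteq> 0"
  shows "crit (quad a b c d e f) Infty \<longleftrightarrow> a * e - b * d = 0"
    and "crit (quad a b c d e f) (Fin z) \<longleftrightarrow> (a * e - b * d) * z^2 + 2 * (a * f - c * d) * z + (b * f - c * e) = 0"
  using crit_quad_proj[OF assms, of 1 0] crit_quad_proj[OF assms, of z 1] by (simp_all add: proj_def)

text \<open>For each critical point, \<open>i\<close> is the preperiod and \<open>j\<close> the
  number of points in the orbit, so \<open>j - i\<close> is the period. Two critical points with
  equal data contribute a single pair.\<close>

definition portrait :: "('a P1 \<Rightarrow> 'a P1) \<Rightarrow> (nat \<times> nat) set" where
  "portrait \<phi> = {(i, j). \<exists>P. crit \<phi> P \<and> i < j \<and> (\<phi> ^^ i) P = (\<phi> ^^ j) P \<and> inj_on (\<lambda>n. (\<phi> ^^ n) P) {..<j}}"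

lemma portrait_conjugate:
  assumes "conjugate_over K \<phi> \<psi>"
  shows "portrait \<psi> = portrait \<phi>"
proof -
  obtain f where f: "bij f" "\<And>n P. (\<psi> ^^ n) (f P) = f ((\<phi> ^^ n) P)" "\<And>P. crit \<psi> (f P) \<longleftrightarrow> crit \<phi> P"
    by (rule conjugate_portrait[OF assms]) (rule that)
  have surj: "(\<exists>P. X P) \<longleftrightarrow> (\<exists>P. X (f P))" for X
  proof
    assume "\<exists>P. X P"
    then obtain P where "X P" ..
    moreover obtain Q where "P = f Q" using bij_is_surj[OF f(1)] by (rule surjE)
    ultimately show "\<exists>P. X (f P)" by auto
  qed auto
  have "f P = f Q \<longleftrightarrow> P = Q" for P Q using bij_is_inj[OF f(1)] by (rule inj_eq)
  then have "(crit \<psi> (f P) \<and> i < j \<and> (\<psi> ^^ i) (f P) = (\<psi> ^^ j) (f P) \<and> inj_on (\<lambda>n. (\<psi> ^^ n) (f P)) {..<j}) =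
      (crit \<phi> P \<and> i < j \<and> (\<phi> ^^ i) P = (\<phi> ^^ j) P \<and> inj_on (\<lambda>n. (\<phi> ^^ n) P) {..<j})" for P i j
    unfolding f(2,3) inj_on_def by simp
  then show ?thesis
    unfolding portrait_def by (subst surj) simp
qed

text \<open>The whole orbit of the head, with the last point returning to the one at index
  \<open>i\<close>; evaluating the map once at each entry verifies it.\<close>

definition cycle_list :: "('a \<Rightarrow> 'a) \<Rightarrow> 'a list \<Rightarrow> nat \<Rightarrow> bool" where
  "cycle_list \<phi> xs i \<longleftrightarrow> xs \<noteq> [] \<and> distinct xs \<and> i < length xs \<and> map \<phi> xs = tl xs @ [xs ! i]"

lemma cycle_list_funpow:
  assumes "cycle_list \<phi> xs i"
  shows "k < length xs \<Longrightarrow> (\<phi> ^^ k) (hd xs) = xs ! k"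
    and "(\<phi> ^^ length xs) (hd xs) = xs ! i"
    and "finite (range (\<lambda>n. (\<phi> ^^ n) (hd xs)))"
proof -
  have xs: "xs \<noteq> []" "map \<phi> xs = tl xs @ [xs ! i]" "i < length xs" using assms by (auto simp: cycle_list_def)
  have step: "\<phi> (xs ! k) = (if Suc k = length xs then xs ! i else xs ! Suc k)" if "k < length xs" for k
  proof -
    have "\<phi> (xs ! k) = (tl xs @ [xs ! i]) ! k" using that by (simp flip: xs(2))
    also have "\<dots> = (if Suc k = length xs then xs ! i else xs ! Suc k)"
      using that xs(1) by (auto simp: nth_append nth_tl less_diff_conv)
    finally show ?thesis .
  qed
  show *: "(\<phi> ^^ k) (hd xs) = xs ! k" if "k < length xs" for k
    using that
  proof (induction k)
    case (Suc k)
    then show ?case using step[of k] by simp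
  qed (use xs in \<open>simp add: hd_conv_nth\<close>)
  obtain l where l: "length xs = Suc l" using xs(1) by (cases xs) auto
  show "(\<phi> ^^ length xs) (hd xs) = xs ! i" using *[of l] step[of l] l by simp
  have "(\<phi> ^^ n) (hd xs) \<in> set xs" for n
  proof (induction n)
    case (Suc n)
    then obtain k where "k < length xs" "(\<phi> ^^ n) (hd xs) = xs ! k" by (auto simp: in_set_conv_nth)
    then show ?case using step[of k] xs(3) by (auto intro!: nth_mem)
  qed (use xs in simp)
  then show "finite (range (\<lambda>n. (\<phi> ^^ n) (hd xs)))" by (meson finite_set finite_subset image_subsetI)
qed

lemma cycle_list_unique:
  assumes xs: "cycle_list \<phi> xs i"
  shows "j < k \<and> (\<phi> ^^ j) (hd xs) = (\<phi> ^^ k) (hd xs) \<and> inj_on (\<lambda>n. (\<phi> ^^ n) (hd xs)) {..<k} \<longleftrightarrow>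
    (j, k) = (i, length xs)"
proof -
  have d: "distinct xs" and i: "i < length xs" using xs by (auto simp: cycle_list_def)
  note fp = cycle_list_funpow(1,2)[OF xs]
  have inj: "inj_on (\<lambda>n. (\<phi> ^^ n) (hd xs)) {..<length xs}"
    using fp(1) d by (auto simp: inj_on_def nth_eq_iff_index_eq)
  show ?thesis
  proof
    assume *: "j < k \<and> (\<phi> ^^ j) (hd xs) = (\<phi> ^^ k) (hd xs) \<and> inj_on (\<lambda>n. (\<phi> ^^ n) (hd xs)) {..<k}"
    have "\<not> k < length xs" using * inj by (auto simp: inj_on_def)
    moreover have "\<not> length xs < k"
    proof
      assume "length xs < k"
      then have "i \<in> {..<k}" "length xs \<in> {..<k}" using i by auto
      moreover have "(\<phi> ^^ i) (hd xs) = (\<phi> ^^ length xs) (hd xs)" using fp i by simp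
      ultimately have "i = length xs" using * by (meson inj_onD)
      then show False using i by simp
    qed
    ultimately have k: "k = length xs" by simp
    have "xs ! j = xs ! i" using conjunct1[OF conjunct2[OF *]] fp(1)[of j] fp(2) conjunct1[OF *] unfolding k by simp
    moreover have "j < length xs" using * k by blast
    ultimately have "j = i" using i nth_eq_iff_index_eq[OF d] by blast
    then show "(j, k) = (i, length xs)" using k by simp
  next
    assume "(j, k) = (i, length xs)"
    then show "j < k \<and> (\<phi> ^^ j) (hd xs) = (\<phi> ^^ k) (hd xs) \<and> inj_on (\<lambda>n. (\<phi> ^^ n) (hd xs)) {..<k}"
      using fp i inj by simp
  qed
qed

lemma portrait_of_cycle_lists:
  assumes crit: "\<And>P. crit \<phi> P \<longleftrightarrow> P = hd xs \<or> P = hd ys"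
    and xs: "cycle_list \<phi> xs i" and ys: "cycle_list \<phi> ys k"
  shows "fin_crit \<phi> \<and> portrait \<phi> = {(i, length xs), (k, length ys)}"
proof
  show "fin_crit \<phi>"
    unfolding fin_crit_def crit using cycle_list_funpow(3)[OF xs] cycle_list_funpow(3)[OF ys] by auto
  have "portrait \<phi> = {(j, l). (j, l) = (i, length xs)} \<union> {(j, l). (j, l) = (k, length ys)}"
    unfolding portrait_def crit conj_disj_distribR ex_disj_distrib simp_thms(39)
    unfolding cycle_list_unique[OF xs, symmetric] cycle_list_unique[OF ys, symmetric] by auto
  then show "portrait \<phi> = {(i, length xs), (k, length ys)}" by auto
qed

lemma quad_Fin: "quad a b c d e f (Fin z) = proj (a * z^2 + b * z + c) (d * z^2 + e * z + f)"
  and quad_Infty: "quad a b c d e f Infty = proj a d"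
  by (simp_all add: quad_def)

lemma all_P1: "(\<forall>P. X P) \<longleftrightarrow> X Infty \<and> (\<forall>z. X (Fin z))"
  by (metis P1.exhaust)

lemma portrait_of_cycle_lists':
  assumes "\<forall>P. crit \<phi> P \<longleftrightarrow> P = hd xs \<or> P = hd ys" "cycle_list \<phi> xs i" "cycle_list \<phi> ys k"
    "length xs = l" "length ys = m"
  shows "fin_crit \<phi> \<and> portrait \<phi> = {(i, l), (k, m)}"
  using portrait_of_cycle_lists[of \<phi> xs ys i k] assms by auto

lemmas quad_eval = cycle_list_def quad_Fin quad_Infty proj_def

subsection \<open>The census\<close>

definition census_quads :: "(complex P1 \<Rightarrow> complex P1) list" where
  "census_quads =
    [quad 1 0 0 0 0 1, quad 0 0 1 1 0 0, quad 1 0 (- 2) 0 0 1, quad 1 0 (- 1) 0 0 1,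
     quad 0 0 1 2 (- 4) 2, quad 0 0 1 1 (- 2) 1, quad 0 0 (- 1) 4 (- 4) 0, quad 0 0 (- 4) 9 (- 12) 0,
     quad 0 0 2 1 (- 2) 1, quad 0 2 1 (- 2) 4 0, quad 0 (- 2) 0 2 (- 4) 1, quad 3 (- 4) 1 0 (- 4) 1]"

lemma ratmap_list_quad:
  assumes "a \<noteq> 0 \<or> d \<noteq> 0" "p = [:c, b, a:]" "q = [:f, e, d:]"
  shows "ratmap p q = quad a b c d e f"
  using ratmap_quad[of p q] assms by (auto simp: numeral_2_eq_2)

lemma census_eq: "census = census_quads"
  unfolding census_def census_quads_def
  by (simp add: power2_eq_square one_pCons[symmetric]) (intro conjI ratmap_list_quad; simp)

text \<open>The singletons belong to maps whose two critical points have the same preperiod and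
  period.\<close>

definition census_portraits :: "(nat \<times> nat) set list" where
  "census_portraits = [{(0, 1)}, {(0, 2)}, {(0, 1), (2, 3)}, {(0, 1), (0, 2)}, {(3, 5), (2, 4)}, {(0, 3)},
     {(2, 4), (0, 2)}, {(3, 5), (0, 2)}, {(3, 4), (2, 3)}, {(3, 5)}, {(3, 4)}, {(0, 2), (2, 3)}]"

lemma census_portrait_1: "fin_crit (quad 1 0 0 0 0 (1::complex)) \<and> portrait (quad 1 0 0 0 0 (1::complex)) = {(0, 1), (0, 1)}"
  by (rule portrait_of_cycle_lists'[of _ "[Fin 0]" "[Infty]"])
     (simp_all add: all_P1 crit_quad quad_res_def quad_eval)

lemma census_portrait_2: "fin_crit (quad 0 0 1 1 0 (0::complex)) \<and> portrait (quad 0 0 1 1 0 (0::complex)) = {(0, 2), (0, 2)}"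
  by (rule portrait_of_cycle_lists'[of _ "[Fin 0, Infty]" "[Infty, Fin 0]"])
     (simp_all add: all_P1 crit_quad quad_res_def quad_eval)

lemma census_portrait_3: "fin_crit (quad 1 0 (- 2) 0 0 (1::complex)) \<and> portrait (quad 1 0 (- 2) 0 0 (1::complex)) = {(0, 1), (2, 3)}"
  by (rule portrait_of_cycle_lists'[of _ "[Infty]" "[Fin 0, Fin (- 2), Fin 2]"])
     (simp_all add: all_P1 crit_quad quad_res_def quad_eval)

lemma census_portrait_4: "fin_crit (quad 1 0 (- 1) 0 0 (1::complex)) \<and> portrait (quad 1 0 (- 1) 0 0 (1::complex)) = {(0, 1), (0, 2)}"
  by (rule portrait_of_cycle_lists'[of _ "[Infty]" "[Fin 0, Fin (- 1)]"])
     (simp_all add: all_P1 crit_quad quad_res_def quad_eval)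

lemma census_portrait_5: "fin_crit (quad 0 0 1 2 (- 4) (2::complex)) \<and> portrait (quad 0 0 1 2 (- 4) (2::complex)) = {(3, 5), (2, 4)}"
  by (rule portrait_of_cycle_lists'[of _ "[Fin 1, Infty, Fin 0, Fin (1 / 2), Fin 2]" "[Infty, Fin 0, Fin (1 / 2), Fin 2]"])
     (simp_all add: all_P1 crit_quad quad_res_def quad_eval numeral_2_eq_2 numeral_3_eq_3 power2_eq_square)

lemma census_portrait_6: "fin_crit (quad 0 0 1 1 (- 2) (1::complex)) \<and> portrait (quad 0 0 1 1 (- 2) (1::complex)) = {(0, 3), (0, 3)}"
  by (rule portrait_of_cycle_lists'[of _ "[Fin 1, Infty, Fin 0]" "[Infty, Fin 0, Fin 1]"])
     (simp_all add: all_P1 crit_quad quad_res_def quad_eval)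

lemma census_portrait_7: "fin_crit (quad 0 0 (- 1) 4 (- 4) (0::complex)) \<and> portrait (quad 0 0 (- 1) 4 (- 4) (0::complex)) = {(2, 4), (0, 2)}"
  by (rule portrait_of_cycle_lists'[of _ "[Fin (1 / 2), Fin 1, Infty, Fin 0]" "[Infty, Fin 0]"])
     (simp_all add: all_P1 crit_quad quad_res_def quad_eval power2_eq_square mult.commute)

lemma census_portrait_8: "fin_crit (quad 0 0 (- 4) 9 (- 12) (0::complex)) \<and> portrait (quad 0 0 (- 4) 9 (- 12) (0::complex)) = {(3, 5), (0, 2)}"
  by (rule portrait_of_cycle_lists'[of _ "[Fin (2 / 3), Fin 1, Fin (4 / 3), Infty, Fin 0]" "[Infty, Fin 0]"])
     (simp_all add: all_P1 crit_quad quad_res_def quad_eval power2_eq_square mult.commute)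

lemma census_portrait_9: "fin_crit (quad 0 0 2 1 (- 2) (1::complex)) \<and> portrait (quad 0 0 2 1 (- 2) (1::complex)) = {(3, 4), (2, 3)}"
  by (rule portrait_of_cycle_lists'[of _ "[Fin 1, Infty, Fin 0, Fin 2]" "[Infty, Fin 0, Fin 2]"])
     (simp_all add: all_P1 crit_quad quad_res_def quad_eval)

lemma self_eq_double_square_iff: "z = 2 * z^2 \<longleftrightarrow> z = 0 \<or> z * 2 = 1" for z :: complex
proof -
  have "z = 2 * z^2 \<longleftrightarrow> z * (1 - z * 2) = 0" by (simp add: power2_eq_square algebra_simps)
  then show ?thesis by auto
qed

lemma census_portrait_12: "fin_crit (quad 3 (- 4) 1 0 (- 4) (1::complex)) \<and> portrait (quad 3 (- 4) 1 0 (- 4) (1::complex)) = {(0, 2), (2, 3)}"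
  by (rule portrait_of_cycle_lists'[of _ "[Fin 0, Fin 1]" "[Fin (1 / 2), Fin (1 / 4), Infty]"])
     (simp_all add: all_P1 crit_quad quad_res_def quad_eval self_eq_double_square_iff, simp_all add: power2_eq_square)

lemma census_portrait_10:
  "fin_crit (quad 0 2 1 (- 2) 4 (0::complex)) \<and> portrait (quad 0 2 1 (- 2) 4 (0::complex)) = {(3, 5), (3, 5)}"
proof -
  \<comment> \<open>The critical points are the zeros of \<open>z^2 + z - 1\<close>. The orbit is
    computed for any \<open>r\<close> with \<open>r^2 = 5\<close>, which covers both by conjugacy of
    the square roots.\<close>
  define s where "s = csqrt 5"
  have s: "s^2 = 5" by (simp only: s_def power2_csqrt)
  have cyc: "cycle_list (quad 0 2 1 (- 2) 4 0) [Fin ((r - 1) / 2), Fin ((r + 3) / 4), Fin 2, Infty, Fin 0] 3"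
    if r: "r^2 = 5" for r :: complex
  proof -
    have ne: "r \<noteq> t" if "t^2 \<noteq> 5" for t using r that by auto
    have nr: "r \<noteq> 0" "r \<noteq> 1" "r \<noteq> 5" "r \<noteq> - 1" "r \<noteq> 3" "r \<noteq> - 3" "r \<noteq> - 5" by (rule ne; simp)+
    have d1: "- 2 * ((r - 1) / 2)^2 + 4 * ((r - 1) / 2) = 3 * r - 5"
      using r by (simp add: power2_eq_square field_simps)
    have nz1: "3 * r - 5 \<noteq> 0"
    proof
      assume "3 * r - 5 = 0"
      then have "9 * r^2 = 25" by algebra
      then show False using r by simp
    qed
    have v1: "(2 * ((r - 1) / 2) + 1) / (3 * r - 5) = (r + 3) / 4"
      using nz1 r by (simp add: field_simps power2_eq_square)
    have d2: "- 2 * ((r + 3) / 4)^2 + 4 * ((r + 3) / 4) = (r + 5) / 4"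
      using r by (simp add: power2_eq_square field_simps)
    have nz2: "(r + 5) / 4 \<noteq> 0" using nr(7) by (simp add: eq_neg_iff_add_eq_0)
    have v2: "(2 * ((r + 3) / 4) + 1) / ((r + 5) / 4) = 2"
    proof -
      have "2 * ((r + 3) / 4) + 1 = 2 * ((r + 5) / 4)" by (simp add: field_simps)
      then show ?thesis using nonzero_mult_div_cancel_right[OF nz2, of 2] by metis
    qed
    have 1: "quad 0 2 1 (- 2) 4 0 (Fin ((r - 1) / 2)) = Fin ((r + 3) / 4)"
      using d1 v1 nz1 by (simp add: quad_Fin proj_def)
    have 2: "quad 0 2 1 (- 2) 4 0 (Fin ((r + 3) / 4)) = Fin 2"
      unfolding quad_Fin proj_def add_0_right d2 mult_zero_left add_0_left using v2 nz2 by simp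
    have "(r - 1) / 2 \<noteq> (r + 3) / 4" "(r - 1) / 2 \<noteq> 2" "(r - 1) / 2 \<noteq> 0" "(r + 3) / 4 \<noteq> 2" "(r + 3) / 4 \<noteq> 0"
      using nr by (auto simp: field_simps eq_neg_iff_add_eq_0)
    then show ?thesis using 1 2 by (simp add: cycle_list_def quad_Fin quad_Infty proj_def)
  qed
  show ?thesis
  proof (rule portrait_of_cycle_lists'[OF _ cyc[OF s] cyc[of "- s"]])
    have key: "4 * z^2 + 4 * z = 4 \<longleftrightarrow> z = (s - 1) / 2 \<or> z = (- s - 1) / 2" for z
    proof -
      have "4 * z^2 + 4 * z - 4 = 4 * ((z - (s - 1) / 2) * (z - (- s - 1) / 2))"
        using s by (simp add: power2_eq_square field_simps)
      moreover have "4 * z^2 + 4 * z = 4 \<longleftrightarrow> 4 * z^2 + 4 * z - 4 = 0" by simp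
      ultimately show ?thesis by simp
    qed
    show "\<forall>P. crit (quad 0 2 1 (- 2) 4 (0::complex)) P \<longleftrightarrow>
      P = hd [Fin ((s - 1) / 2), Fin ((s + 3) / 4), Fin 2, Infty, Fin 0] \<or>
      P = hd [Fin ((- s - 1) / 2), Fin ((- s + 3) / 4), Fin 2, Infty, Fin 0]"
      by (simp add: all_P1 crit_quad quad_res_def key)
  qed (use s in simp_all)
qed

lemma census_portrait_11:
  "fin_crit (quad 0 (- 2) 0 2 (- 4) (1::complex)) \<and> portrait (quad 0 (- 2) 0 2 (- 4) (1::complex)) = {(3, 4), (3, 4)}"
proof -
  \<comment> \<open>The critical points are the zeros of \<open>2 * z^2 - 1\<close>, again treated
    together.\<close>
  define s where "s = csqrt (1 / 2)"
  have s: "2 * s^2 = 1" unfolding s_def power2_csqrt by simp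
  have cyc: "cycle_list (quad 0 (- 2) 0 2 (- 4) 1) [Fin r, Fin (1 + r), Infty, Fin 0] 3"
    if r: "2 * r^2 = 1" for r :: complex
  proof -
    have ne: "r \<noteq> t" if "2 * t^2 \<noteq> 1" for t using r that by auto
    have nr: "r \<noteq> 0" "r \<noteq> - 1" by (rule ne; simp add: power2_eq_square)+
    have d1: "2 * r^2 + - 4 * r + 1 = 2 - 4 * r" using r by simp
    have nz: "2 - 4 * r \<noteq> 0"
    proof
      assume "2 - 4 * r = 0"
      then have "8 * (2 * r^2) = 4" by algebra
      then show False unfolding r by simp
    qed
    have "(1 + r) * (2 - 4 * r) = - 2 * r" using r by (simp add: algebra_simps power2_eq_square)
    then have v1: "- 2 * r / (2 - 4 * r) = 1 + r" using nz by (metis nonzero_mult_div_cancel_right)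
    have 1: "quad 0 (- 2) 0 2 (- 4) 1 (Fin r) = Fin (1 + r)"
      unfolding quad_Fin proj_def d1 using v1 nz by simp
    have d2: "2 * (1 + r)^2 + - 4 * (1 + r) + 1 = 0" using r by (simp add: algebra_simps power2_eq_square)
    have 2: "quad 0 (- 2) 0 2 (- 4) 1 (Fin (1 + r)) = Infty"
      unfolding quad_Fin proj_def d2 by simp
    show ?thesis using 1 2 nr by (simp add: cycle_list_def quad_Fin quad_Infty proj_def eq_neg_iff_add_eq_0 add.commute)
  qed
  show ?thesis
  proof (rule portrait_of_cycle_lists'[OF _ cyc[OF s] cyc[of "- s"]])
    have "4 * z^2 - 2 = 4 * ((z - s) * (z + s))" for z
      using s by (simp add: power2_eq_square algebra_simps)
    then have "4 * z^2 - 2 = 0 \<longleftrightarrow> z = s \<or> z = - s" for z by (auto simp: eq_neg_iff_add_eq_0)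
    then show "\<forall>P. crit (quad 0 (- 2) 0 2 (- 4) (1::complex)) P \<longleftrightarrow>
      P = hd [Fin s, Fin (1 + s), Infty, Fin 0] \<or> P = hd [Fin (- s), Fin (1 + - s), Infty, Fin 0]"
      by (simp add: all_P1 crit_quad quad_res_def)
  qed (use s in simp_all)
qed

lemma length_census: "length census = 12"
  by (simp add: census_def)

lemma census_portraits:
  assumes "i < 12"
  shows "fin_crit (census ! i)" "portrait (census ! i) = census_portraits ! i"
proof -
  have "list_all2 (\<lambda>\<phi> S. fin_crit \<phi> \<and> portrait \<phi> = S) census_quads census_portraits"
    unfolding census_quads_def census_portraits_def
    using census_portrait_1 census_portrait_2 census_portrait_3 census_portrait_4 census_portrait_5 census_portrait_6
      census_portrait_7 census_portrait_8 census_portrait_9 census_portrait_10 census_portrait_11 census_portrait_12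
    by simp
  then show "fin_crit (census ! i)" "portrait (census ! i) = census_portraits ! i"
    using assms length_census unfolding census_eq by (auto simp: list_all2_conv_all_nth)
qed

lemma census_not_conjugate:
  assumes "i < 12" "j < 12" "i \<noteq> j"
  shows "\<not> conjugate_over K (census ! i) (census ! j)"
proof -
  have "distinct census_portraits" by (simp add: census_portraits_def insert_eq_iff doubleton_eq_iff)
  moreover have "length census_portraits = 12" by (simp add: census_portraits_def)
  ultimately have "census_portraits ! i \<noteq> census_portraits ! j" using assms by (simp add: nth_eq_iff_index_eq)
  then show ?thesis using portrait_conjugate census_portraits(2) assms(1,2) by metis
qed

lemma census_rational:
  assumes "\<psi> \<in> set census"
  shows "rational_map \<rat> 2 \<psi>"
proof -
  have "rational_map \<rat> 2 (quad a b c d e f)"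
    if "{a, b, c, d, e, f} \<subseteq> \<rat>" "quad_res a b c d e f \<noteq> 0" for a b c d e f :: complex
    unfolding rational_map_2_iff[OF Rats_0] using that
    by (intro exI[of _ a] exI[of _ b] exI[of _ c] exI[of _ d] exI[of _ e] exI[of _ f]) simp
  then show ?thesis
    using assms unfolding census_eq census_quads_def by (auto simp: quad_res_def)
qed

lemma PCF_iff_fin_crit:
  fixes \<phi> :: "complex P1 \<Rightarrow> complex P1"
  assumes "rational_map \<rat> 2 \<phi>"
  shows "PCF \<phi> \<longleftrightarrow> fin_crit \<phi>"
proof -
  have "rational_map UNIV 2 \<phi>" using assms unfolding rational_map_def by blast
  then show ?thesis unfolding fin_crit_def by (rule PCF_iff_crit)
qed

lemma census_quadratic_PCF: "\<psi> \<in> set census \<Longrightarrow> \<psi> \<in> quadratic_PCF_over_Q"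
  using census_rational[of \<psi>] PCF_iff_fin_crit[of \<psi>] census_portraits(1) length_census
  by (auto simp: quadratic_PCF_over_Q_def in_set_conv_nth)

subsection \<open>Polynomials\<close>

text \<open>Infinity has multiplier 0, and the finite fixed points multiply to \<open>c\<close>, so
  their multipliers multiply to \<open>4 * c\<close>. The map
  \<open>z -> \<epsilon> * (z + r) / (z - r)\<close> sends the fixed point \<open>r\<close> to
  infinity and its other preimage \<open>- r\<close> to 0; the sign \<epsilon> is adapted to
  \<beta>.\<close>

lemma has_invariants_polynomial:
  assumes "c \<in> \<rat>"
  shows "has_invariants (quad 1 0 c 0 0 1) (4 * c) 0"
  unfolding has_invariants_def
proof (intro allI impI)
  fix \<kappa> \<beta> :: complex
  assume \<kappa>: "\<kappa> \<noteq> 0" "\<kappa>^3 - (0 + 2) * \<kappa>^2 + 4 * c * \<kappa> - 0 = 0" and \<beta>: "\<beta>^2 = (\<kappa> - 2)^2 - 0 * \<kappa>"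
  have "\<kappa> * (\<kappa>^2 - 2 * \<kappa> + 4 * c) = 0" using \<kappa>(2) by algebra
  then have q: "\<kappa>^2 - 2 * \<kappa> + 4 * c = 0" using \<kappa>(1) by simp
  define r where "r = \<kappa> / 2"
  have k: "\<kappa> = 2 * r" by (simp add: r_def)
  have "4 * c = 4 * (r - r^2)" using q unfolding k by algebra
  then have c: "c = r - r^2" by (rule mult_left_cancel[THEN iffD1, rotated]) simp
  have "r \<noteq> 0" using \<kappa>(1) by (simp add: r_def)
  obtain \<epsilon> :: complex where \<epsilon>: "\<epsilon> = 1 \<or> \<epsilon> = - 1" "\<beta> = \<epsilon> * (2 * r - 2)"
    using \<beta> unfolding k by (metis (no_types) diff_zero mult_1 mult_minus1 mult_zero_left power2_eq_iff)
  have \<epsilon>2: "\<epsilon> * \<epsilon> = 1" using \<epsilon>(1) by auto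
  have "poly [:4 * c, - 2, 1:] \<kappa> = 0" using q by (simp add: power2_eq_square algebra_simps)
  moreover have "\<forall>i. coeff [:4 * c, - 2, 1:] i \<in> \<rat>" using assms by (auto simp: coeff_pCons split: nat.splits)
  moreover have "[:4 * c, - 2, 1:] \<noteq> 0" by simp
  ultimately have "\<kappa> \<in> Qbar" by (auto simp: Qbar_def algebraic_altdef)
  then have rQ: "r \<in> Qbar" unfolding r_def by (intro Qbar_divide) (simp_all add: Qbar_Rats)
  define i where "i = 1 / \<kappa>"
  have i: "i * (2 * r) = 1" using \<kappa>(1) by (simp add: i_def k)
  show "conjugate_over Qbar (quad 1 0 c 0 0 1) (Phi (1 / \<kappa>) \<beta>)"
    unfolding Phi_def i_def[symmetric]
  proof (rule conjugate_quadI[where \<alpha> = \<epsilon> and \<beta> = "\<epsilon> * r" and \<gamma> = 1 and \<delta> = "- r" and k = \<epsilon>])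
    show "{\<epsilon>, \<epsilon> * r, 1, - r} \<subseteq> Qbar" using rQ \<epsilon>(1) by (auto intro!: Qbar_intros)
    show "\<epsilon> * - r - \<epsilon> * r * 1 \<noteq> 0" using \<epsilon>(1) \<open>r \<noteq> 0\<close> by auto
    show "\<epsilon> \<noteq> 0" using \<epsilon>(1) by auto
    show "quad_res 1 0 c 0 0 1 \<noteq> 0" by (simp add: quad_res_def)
    show "i * (\<epsilon> * x + \<epsilon> * r * y)\<^sup>2 + i * \<beta> * (\<epsilon> * x + \<epsilon> * r * y) * (1 * x + - r * y) + i * (1 * x + - r * y)\<^sup>2 =
      \<epsilon> * (\<epsilon> * (1 * x\<^sup>2 + 0 * x * y + c * y\<^sup>2) + \<epsilon> * r * (0 * x\<^sup>2 + 0 * x * y + 1 * y\<^sup>2))" for x y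
      using \<epsilon>2 i unfolding \<epsilon>(2) c by algebra
    show "0 * (\<epsilon> * x + \<epsilon> * r * y)\<^sup>2 + 1 * (\<epsilon> * x + \<epsilon> * r * y) * (1 * x + - r * y) + 0 * (1 * x + - r * y)\<^sup>2 =
      \<epsilon> * (1 * (1 * x\<^sup>2 + 0 * x * y + c * y\<^sup>2) + - r * (0 * x\<^sup>2 + 0 * x * y + 1 * y\<^sup>2))" for x y
      unfolding c by algebra
  qed
qed

section \<open>Critical orbits of quadratic polynomials with rational parameter\<close>

fun quadratic_orbit :: "'a::comm_ring_1 \<Rightarrow> nat \<Rightarrow> 'a" where
  "quadratic_orbit c 0 = 0"
| "quadratic_orbit c (Suc n) = (quadratic_orbit c n)^2 + c"

lemma quadratic_orbit_not_inj:
  assumes "fin_crit (quad 1 0 c 0 0 (1::complex))"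
  shows "\<not> inj (quadratic_orbit c)"
proof
  assume "inj (quadratic_orbit c)"
  have orbit: "(quad 1 0 c 0 0 1 ^^ n) (Fin 0) = Fin (quadratic_orbit c n)" for n
    by (induction n) (simp_all add: quad_Fin proj_def)
  have "crit (quad 1 0 c 0 0 1) (Fin 0)" by (simp add: crit_quad quad_res_def)
  then have "finite (range (\<lambda>n. Fin (quadratic_orbit c n)))" using assms unfolding fin_crit_def by (simp flip: orbit)
  then have "finite (Fin ` range (quadratic_orbit c))" by (simp add: image_image)
  then have "finite (range (quadratic_orbit c))" by (rule finite_imageD) (auto simp: inj_on_def)
  then show False using \<open>inj (quadratic_orbit c)\<close> finite_imageD infinite_UNIV_nat by blast
qed

text \<open>If \<open>c\<close> is outside \<open>V\<close>, each nonzero orbit point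
  \<open>x\<close> is too, and \<open>c / x\<close> stays in \<open>V\<close>. The next quotient
  \<open>x + c / x\<close> is then outside \<open>V\<close>, and the critical orbit escapes.\<close>

lemma (in valuation_ring) quadratic_parameter_in_V:
  assumes "fin_crit (quad 1 0 c 0 0 1)"
  shows "c \<in> V"
proof (rule ccontr)
  assume c: "c \<notin> V"
  let ?x = "quadratic_orbit c"
  have x: "?x (Suc n) \<notin> V \<and> c / ?x (Suc n) \<in> V \<and> ?x (Suc (Suc n)) / ?x (Suc n) \<notin> V" for n
  proof (induction n)
    case 0
    have "c \<noteq> 0" using c V_closed(2) by auto
    moreover have "c + 1 \<notin> V" using c V_closed(1) V_closed(6)[of "c + 1" 1] by auto
    ultimately show ?case using c V_closed(1) by (simp add: power2_eq_square add_divide_distrib)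
  next
    case (Suc n)
    let ?y = "?x (Suc n)" and ?z = "?x (Suc (Suc n))"
    have nz: "?y \<noteq> 0" using Suc V_closed(2) by metis
    have z: "?z \<notin> V" using notin_V_mult'[of ?y "?z / ?y"] Suc nz by simp
    then have znz: "?z \<noteq> 0" using V_closed(2) by metis
    have "1 / (?z / ?y) \<in> V" using total[of "?z / ?y"] Suc by blast
    then have "c / ?y * (1 / (?z / ?y)) \<in> V" using V_closed(4) Suc by blast
    then have cz: "c / ?z \<in> V" using nz znz by simp
    have "?x (Suc (Suc (Suc n))) / ?z = ?z + c / ?z"
      using znz by (simp add: add_divide_distrib power2_eq_square)
    then have "?x (Suc (Suc (Suc n))) / ?z \<notin> V" using z cz V_closed(6)[of "?z + c / ?z" "c / ?z"] by auto
    then show ?case using z cz by blast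
  qed
  have nz: "?x (Suc n) \<noteq> 0" for n using x[of n] V_closed(2) by metis
  have up: "?x (Suc (n + Suc m)) / ?x (Suc n) \<notin> V" for n m
  proof (induction m)
    case 0
    show ?case using x[of n] by simp
  next
    case (Suc m)
    have "?x (Suc (n + Suc (Suc m))) / ?x (Suc n) =
      (?x (Suc (n + Suc m)) / ?x (Suc n)) * (?x (Suc (Suc (n + Suc m))) / ?x (Suc (n + Suc m)))"
      using nz[of "n + Suc m"] by (simp del: quadratic_orbit.simps)
    then show ?case using notin_V_mult'[OF Suc] x[of "n + Suc m"] by metis
  qed
  have neq: "?x i \<noteq> ?x j" if "i < j" for i j
  proof (cases i)
    case 0
    obtain j' where "j = Suc j'" using \<open>i < j\<close> by (cases j) auto
    then show ?thesis using 0 nz[of j'] by simp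
  next
    case (Suc i')
    obtain m where "j = Suc (i' + Suc m)" using \<open>i < j\<close> Suc by (metis add_Suc less_imp_Suc_add add_Suc_right)
    then show ?thesis using up[of i' m] nz[of i'] V_closed(1) Suc by (metis divide_self)
  qed
  then have "inj ?x" by (metis injI linorder_neqE_nat)
  then show False using quadratic_orbit_not_inj[OF assms] by blast
qed

lemma quadratic_orbit_of_int: "quadratic_orbit (of_int k) n = of_int (quadratic_orbit k n)"
  by (induction n) simp_all

text \<open>For all other integers the absolute values along the orbit increase strictly. If
  \<open>k\<close> is at most -3, then \<open>\<bar>x\<bar> \<ge> - k \<ge> 3\<close> holds after
  the first step and gives \<open>x^2 + k \<ge> 3 * \<bar>x\<bar> - \<bar>x\<bar>\<close>.\<close>

lemma integer_quadratic_parameter: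
  assumes "\<not> inj (quadratic_orbit (k :: int))"
  shows "k \<in> {- 2, - 1, 0}"
proof (rule ccontr)
  assume k: "k \<notin> {- 2, - 1, 0}"
  let ?x = "quadratic_orbit k"
  have "\<bar>?x n\<bar> < \<bar>?x (Suc n)\<bar>" for n
  proof (cases "k > 0")
    case True
    have nn: "?x n \<ge> 0" using True by (cases n) auto
    have "y \<le> y^2" if "0 \<le> y" for y :: int using that self_le_power[of y 2] by (cases "y = 0") auto
    from this[OF nn] show ?thesis using nn True by simp
  next
    case False
    then have k3: "k \<le> - 3" using k by auto
    have "n > 0 \<longrightarrow> \<bar>?x n\<bar> \<ge> - k" for n
    proof (induction n)
      case (Suc n)
      show ?case
      proof (cases "n = 0")
        case False
        then have "\<bar>?x n\<bar> \<ge> - k" using Suc by simp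
        then have "\<bar>?x n\<bar> * \<bar>?x n\<bar> \<ge> 3 * - k" using k3 by (intro mult_mono) auto
        then show ?thesis using k3 by (simp add: power2_eq_square abs_mult_self_eq)
      qed (use k3 in simp)
    qed simp
    show ?thesis
    proof (cases "n = 0")
      case True
      then show ?thesis using k3 by simp
    next
      case False
      then have *: "\<bar>?x n\<bar> \<ge> - k" using \<open>n > 0 \<longrightarrow> \<bar>?x n\<bar> \<ge> - k\<close> by simp
      then have "\<bar>?x n\<bar> * \<bar>?x n\<bar> \<ge> 3 * \<bar>?x n\<bar>" using k3 by (intro mult_right_mono) auto
      then have "(?x n)^2 \<ge> 3 * \<bar>?x n\<bar>" by (simp add: power2_eq_square)
      then show ?thesis using * k3 by simp
    qed
  qed
  then have "strict_mono (\<lambda>n. \<bar>?x n\<bar>)" by (simp add: strict_mono_Suc_iff)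
  then have "inj (\<lambda>n. \<bar>?x n\<bar>)" by (rule strict_mono_imp_inj_on)
  then have "inj ?x" by (auto simp: inj_on_def)
  then show False using assms by blast
qed

lemma polynomial_classification:
  fixes c :: complex
  assumes "c \<in> \<rat>" "fin_crit (quad 1 0 c 0 0 1)"
  shows "c \<in> {- 2, - 1, 0}"
proof -
  obtain k where k: "c = of_int k"
    using Rats_integral[OF assms(1)] valuation_ring.quadratic_parameter_in_V[OF _ assms(2)] by metis
  have "\<not> inj (quadratic_orbit k)"
  proof
    assume "inj (quadratic_orbit k)"
    then have "inj (quadratic_orbit c)" unfolding k by (auto simp: inj_on_def quadratic_orbit_of_int)
    then show False using quadratic_orbit_not_inj[OF assms(2)] by blast
  qed
  then have "k \<in> {- 2, - 1, 0}" by (rule integer_quadratic_parameter)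
  then show ?thesis by (auto simp: k)
qed

subsection \<open>The classification\<close>

text \<open>The factor \<open>k\<close> makes the denominator monic, and the invariants are
  cross-multiplied so that concrete maps can be checked by evaluation.\<close>

lemma has_invariants_quad_scaled:
  fixes a b e f :: complex
  assumes "quad_res 0 a b 1 e f \<noteq> 0" "{a, b, e, f} \<subseteq> \<rat>" "k \<noteq> 0" "h \<noteq> 0"
    and "8 * of_int m * quad_res 0 a b 1 e f = of_int h * (4*f^3 - e^2*f^2 + 10*b*e*f - 2*b*e^3 + 12*b^2 - 4*a*f^2
               - 7*a*b*e + 5*a^2*f - a^2*e^2 - 2*a^3)"
    and "32 * quad_res 0 a b 1 e f = of_int h * (b*e^3 - 4*b*e*f - 8*b^2 + 4*a*f^2 - a*e^2*f + 6*a*b*e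
               - 4*a^2*f + a^3)"
  shows "has_invariants (quad 0 (k * a) (k * b) k (k * e) (k * f)) (8 * of_int m / of_int h) (32 / of_int h)"
proof -
  have "quad 0 (k * a) (k * b) k (k * e) (k * f) = quad 0 a b 1 e f"
    using quad_scale[OF \<open>k \<noteq> 0\<close>, of 0 a b 1 e f] by simp
  then show ?thesis using assms by (simp add: has_invariants_quad)
qed

lemma census_has_invariants:
  "list_all2 (\<lambda>\<phi> (h, m). has_invariants \<phi> (8 * of_int m / of_int h) (32 / of_int h))
    (quad 0 0 1 1 0 0 # drop 4 census_quads) census_invariants"
proof -
  have 12: "has_invariants (quad 3 (- 4) 1 0 (- 4) 1) (8 * of_int (- 5) / of_int (- 6)) (32 / of_int (- 6))"
  proof (rule has_invariants_conjugate)
    show "conjugate_over Qbar (quad 3 (- 4) 1 0 (- 4) 1) (quad 0 (1 * 0) (1 * - 3) 1 (1 * - 2) (1 * 0))"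
    \<comment> \<open>This map fixes infinity. The change \<open>z -> (1 - z) / z\<close> sends 0 to
      infinity and its image 1 to 0, which gives the required form.\<close>
    proof (rule conjugate_quadI[where \<alpha> = "- 1" and \<beta> = 1 and \<gamma> = 1 and \<delta> = 0 and k = 1])
      show "{- 1, 1, 1, 0} \<subseteq> Qbar" by (auto intro!: Qbar_intros)
    qed (simp_all add: quad_res_def algebra_simps power2_eq_square)
    show "has_invariants (quad 0 (1 * 0) (1 * - 3) 1 (1 * - 2) (1 * 0)) (8 * of_int (- 5) / of_int (- 6)) (32 / of_int (- 6))"
      by (rule has_invariants_quad_scaled) (simp_all add: quad_res_def)
  qed
  show ?thesis
    unfolding census_quads_def census_invariants_def
    using has_invariants_quad_scaled[of 0 1 0 0 1 "- 4" "- 6"]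
      has_invariants_quad_scaled[of 0 "1 / 2" "- 2" 1 2 "- 4" "- 2"]
      has_invariants_quad_scaled[of 0 1 "- 2" 1 1 "- 4" "- 4"]
      has_invariants_quad_scaled[of 0 "- 1 / 4" "- 1" 0 4 "- 8" "- 4"]
      has_invariants_quad_scaled[of 0 "- 4 / 9" "- 4 / 3" 0 9 "- 12" "- 2"]
      has_invariants_quad_scaled[of 0 2 "- 2" 1 1 "- 4" "- 5"]
      has_invariants_quad_scaled[of "- 1" "- 1 / 2" "- 2" 0 "- 2" "- 8" 0]
      has_invariants_quad_scaled[of "- 1" 0 "- 2" "1 / 2" 2 "- 8" "- 2"] 12
    by (simp add: quad_res_def power2_eq_square power3_eq_cube)
qed

lemma candidate_excluded_or_census:
  assumes "candidate h m" "\<bar>h\<bar> \<le> 32" "\<bar>m\<bar> \<le> 12"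
  shows "(h, m) \<in> set census_invariants \<or> (\<exists>c. certificate h m c)"
proof -
  have "(h, m) \<in> set (filter (\<lambda>(h, m). candidate h m) (List.product [-32..32] [-12..12]))"
    unfolding set_filter set_product set_upto using assms by auto
  then have "(h, m) \<in> fst ` set certificates" unfolding certificates_complete set_map .
  then obtain x where x: "x \<in> set certificates" "fst x = (h, m)" by (elim imageE) (metis)
  have "verified x" using certificates_verified x(1) unfolding list_all_iff by (rule bspec)
  obtain y where y: "x = ((h, m), y)" using x(2) by (metis prod.collapse)
  show ?thesis
  proof (cases y)
    case None
    have "List.member census_invariants (h, m)"
      using \<open>verified x\<close> unfolding verified_def y None prod.case option.case .
    then have "(h, m) \<in> set census_invariants" by (simp only: List.member_iff)
    then show ?thesis by (rule disjI1)
  next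
    case (Some d)
    have "certificate h m d"
      using \<open>verified x\<close> unfolding verified_def y Some prod.case option.case .
    then show ?thesis by (intro disjI2 exI)
  qed
qed

theorem census_complete:
  assumes "\<phi> \<in> quadratic_PCF_over_Q"
  shows "\<exists>\<psi>\<in>set census. conjugate_over Qbar \<phi> \<psi>"
proof -
  have rat: "rational_map \<rat> 2 \<phi>" and fc: "fin_crit \<phi>"
    using assms PCF_iff_fin_crit by (auto simp: quadratic_PCF_over_Q_def)
  obtain s2 s3 where s: "s2 \<in> \<rat>" "s3 \<in> \<rat>" and inv: "has_invariants \<phi> s2 s3"
    using rational_has_invariants[OF rat] by blast
  show ?thesis
  proof (cases "s3 = 0")
    case True
    define c where "c = s2 / 4"
    have c: "c \<in> \<rat>" using s by (simp add: c_def)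
    have "has_invariants \<phi> (4 * c) 0" using inv True by (simp add: c_def)
    then have cj: "conjugate_over Qbar \<phi> (quad 1 0 c 0 0 1)"
      by (rule conjugate_same_invariants[OF _ has_invariants_polynomial[OF c]])
    then have "c \<in> {- 2, - 1, 0}" using polynomial_classification[OF c] fin_crit_conjugate fc by blast
    then have "quad 1 0 c 0 0 1 \<in> set census" unfolding census_eq census_quads_def by auto
    then show ?thesis using cj by blast
  next
    case False
    obtain h m where hm: "candidate h m" "\<bar>h\<bar> \<le> 32" "\<bar>m\<bar> \<le> 12" "s3 = 32 / of_int h" "s2 = 8 * of_int m / of_int h"
      by (rule finite_multiplier_invariants[OF inv s False fc])
    have inv': "has_invariants \<phi> (8 * of_int m / of_int h) (32 / of_int h)" using inv hm(4,5) by simp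
    have "\<not> certificate h m c" for c
      using certificate_sound[OF inv'] fc by (metis prod_cases7)
    then have "(h, m) \<in> set census_invariants" using candidate_excluded_or_census hm by blast
    then obtain n where n: "n < length census_invariants" "census_invariants ! n = (h, m)" by (auto simp: in_set_conv_nth)
    define \<psi> where "\<psi> = (quad 0 0 1 1 0 0 # drop 4 census_quads) ! n"
    have "has_invariants \<psi> (8 * of_int m / of_int h) (32 / of_int h)"
      using list_all2_nthD2[OF census_has_invariants n(1)] n(2) by (simp add: \<psi>_def)
    then have "conjugate_over Qbar \<phi> \<psi>" by (rule conjugate_same_invariants[OF inv'])
    moreover have "length census_invariants = 9" by (simp add: census_invariants_def)
    then have "\<psi> \<in> set (quad 0 0 1 1 0 0 # drop 4 census_quads)"
      unfolding \<psi>_def using n(1) by (intro nth_mem) (simp add: census_quads_def)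
    moreover have "set (quad 0 0 1 1 0 0 # drop 4 census_quads) \<subseteq> set census"
      unfolding census_eq census_quads_def by simp
    ultimately show ?thesis by blast
  qed
qed

theorem theorem1p1:
  shows "card (quadratic_PCF_over_Q // Qbar_conj_rel) = 12
    \<and> (\<forall>\<psi> \<in> set census. \<psi> \<in> quadratic_PCF_over_Q)
    \<and> (\<forall>\<phi> \<in> quadratic_PCF_over_Q.
         \<exists>!i. i < length census \<and> conjugate_over Qbar \<phi> (census ! i))
    \<and> (\<forall>i < length census. \<forall>j < length census.
         i \<noteq> j \<longrightarrow> \<not> conjugate_over Qbar (census ! i) (census ! j))"
proof (intro conjI)
  show "\<forall>\<psi> \<in> set census. \<psi> \<in> quadratic_PCF_over_Q" using census_quadratic_PCF by blast
  show nc: "\<forall>i < length census. \<forall>j < length census.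
         i \<noteq> j \<longrightarrow> \<not> conjugate_over Qbar (census ! i) (census ! j)"
    using census_not_conjugate by (simp add: length_census)
  have ex: "\<exists>i < length census. conjugate_over Qbar \<phi> (census ! i)" if "\<phi> \<in> quadratic_PCF_over_Q" for \<phi>
    using census_complete[OF that] by (metis in_set_conv_nth)
  have uniq: "i = j" if "conjugate_over Qbar \<phi> (census ! i)" "conjugate_over Qbar \<phi> (census ! j)"
    "i < length census" "j < length census" for \<phi> i j
    using nc conjugate_trans[OF conjugate_sym[OF that(1)] that(2)] that(3,4) by blast
  show "\<forall>\<phi> \<in> quadratic_PCF_over_Q. \<exists>!i. i < length census \<and> conjugate_over Qbar \<phi> (census ! i)"
    using ex uniq by blast
  have Q: "census ! i \<in> quadratic_PCF_over_Q" if "i < length census" for i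
    using census_quadratic_PCF that by simp
  have equiv: "equiv quadratic_PCF_over_Q Qbar_conj_rel"
  proof (rule equivI)
    show "refl_on quadratic_PCF_over_Q Qbar_conj_rel"
      by (auto simp: refl_on_def Qbar_conj_rel_def conjugate_refl)
    show "sym Qbar_conj_rel" by (auto simp: sym_def Qbar_conj_rel_def intro: conjugate_sym)
    show "trans Qbar_conj_rel" by (auto simp: trans_def Qbar_conj_rel_def intro: conjugate_trans)
  qed (auto simp: Qbar_conj_rel_def)
  have "bij_betw (\<lambda>i. Qbar_conj_rel `` {census ! i}) {..<length census} (quadratic_PCF_over_Q // Qbar_conj_rel)"
  proof (rule bij_betwI')
    fix i j assume ij: "i \<in> {..<length census}" "j \<in> {..<length census}"
    have "Qbar_conj_rel `` {census ! i} = Qbar_conj_rel `` {census ! j} \<longleftrightarrow> (census ! i, census ! j) \<in> Qbar_conj_rel"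
      using eq_equiv_class_iff[OF equiv] Q ij by simp
    also have "\<dots> \<longleftrightarrow> i = j"
      using nc ij Q conjugate_refl by (auto simp: Qbar_conj_rel_def)
    finally show "Qbar_conj_rel `` {census ! i} = Qbar_conj_rel `` {census ! j} \<longleftrightarrow> i = j" .
  next
    fix i assume "i \<in> {..<length census}"
    then show "Qbar_conj_rel `` {census ! i} \<in> quadratic_PCF_over_Q // Qbar_conj_rel"
      using Q by (simp add: quotientI)
  next
    fix X assume "X \<in> quadratic_PCF_over_Q // Qbar_conj_rel"
    then obtain \<phi> where \<phi>: "\<phi> \<in> quadratic_PCF_over_Q" "X = Qbar_conj_rel `` {\<phi>}" by (rule quotientE)
    obtain i where i: "i < length census" "conjugate_over Qbar \<phi> (census ! i)" using ex[OF \<phi>(1)] by blast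
    have "(\<phi>, census ! i) \<in> Qbar_conj_rel" using \<phi>(1) Q[OF i(1)] i(2) by (simp add: Qbar_conj_rel_def)
    then have "X = Qbar_conj_rel `` {census ! i}" using equiv_class_eq[OF equiv] \<phi>(2) by blast
    then show "\<exists>i\<in>{..<length census}. X = Qbar_conj_rel `` {census ! i}" using i(1) by blast
  qed
  then show "card (quadratic_PCF_over_Q // Qbar_conj_rel) = 12"
    using bij_betw_same_card by (fastforce simp: length_census)
qed

end
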